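(* Given a sorted input $x_1 \le \dots \le x_n$ of real numbers and an integer $k \ge 1$, an optimal 1D $k$-Means clustering, i.e. centroids $\mathcal{M}=\{\mu_1,\dots,\mu_k\}\subset\mathbb{R}$ minimizing $\sum_{\ell=1}^n \min_{\mu\in\mathcal{M}} (x_\ell-\mu)^2$, can be computed in $O(kn)$ time using $O(n)$ space.
   Context: Model of computation: a real RAM in which arithmetic operations and comparisons on real numbers take constant time and each real number occupies one unit of space. *)

theory Defs
  imports Complex_Main
begin

text \<open>
  Real RAM: finitely many named registers and a random access memory, each register and each cell
  holding one real number. Every instruction takes one unit of time. There is no rounding and no
  real-to-integer conversion, and the only constants a program may mention are integers.
\<close>

type_synonym reg = nat

datatype instr =
    Const reg int
  | Move reg reg
  | Add reg reg reg
  | Sub reg reg reg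
  | Mul reg reg reg
  | Div reg reg reg
  | Load reg reg
  | Store reg reg
  | Jump nat
  | JumpLe reg reg nat
  | Output reg
  | Halt

type_synonym program = "instr list"

record config =
  pc :: nat
  regs :: "reg \<Rightarrow> real"
  mem :: "nat \<Rightarrow> real"
  out :: "real list"

definition set_reg :: "reg \<Rightarrow> real \<Rightarrow> config \<Rightarrow> config" where
  "set_reg r v c = c\<lparr>pc := Suc (pc c), regs := (regs c)(r := v)\<rparr>"

text \<open>
  A real is usable as an address into a memory of \<open>s\<close> cells only if it is one of
  \<open>0, \<dots>, s - 1\<close>.
\<close>

definition address :: "nat \<Rightarrow> real \<Rightarrow> nat option" where
  "address s v = (if v \<in> \<nat> \<and> v < real s then Some (nat \<lfloor>v\<rfloor>) else None)"

text \<open>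
  The effect of one instruction on a machine whose memory has \<open>s\<close> cells. The result \<open>None\<close> is a
  fault (division by zero, or an access outside the memory), except for \<^const>\<open>Halt\<close>. The output is
  write-only.
\<close>

fun exec :: "nat \<Rightarrow> instr \<Rightarrow> config \<Rightarrow> config option" where
  "exec s (Const r z) c = Some (set_reg r (of_int z) c)"
| "exec s (Move r a) c = Some (set_reg r (regs c a) c)"
| "exec s (Add r a b) c = Some (set_reg r (regs c a + regs c b) c)"
| "exec s (Sub r a b) c = Some (set_reg r (regs c a - regs c b) c)"
| "exec s (Mul r a b) c = Some (set_reg r (regs c a * regs c b) c)"
| "exec s (Div r a b) c =
    (if regs c b = 0 then None else Some (set_reg r (regs c a / regs c b) c))"
| "exec s (Load r a) c =
    (case address s (regs c a) of
      None \<Rightarrow> None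
    | Some i \<Rightarrow> Some (set_reg r (mem c i) c))"
| "exec s (Store a r) c =
    (case address s (regs c a) of
      None \<Rightarrow> None
    | Some i \<Rightarrow> Some (c\<lparr>pc := Suc (pc c), mem := (mem c)(i := regs c r)\<rparr>))"
| "exec s (Jump l) c = Some (c\<lparr>pc := l\<rparr>)"
| "exec s (JumpLe a b l) c =
    Some (c\<lparr>pc := (if regs c a \<le> regs c b then l else Suc (pc c))\<rparr>)"
| "exec s (Output r) c = Some (c\<lparr>pc := Suc (pc c), out := out c @ [regs c r]\<rparr>)"
| "exec s Halt c = None"

definition step :: "nat \<Rightarrow> program \<Rightarrow> config \<Rightarrow> config \<Rightarrow> bool" where
  "step s p c c' \<longleftrightarrow> pc c < length p \<and> exec s (p ! pc c) c = Some c'"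

definition halted :: "program \<Rightarrow> config \<Rightarrow> bool" where
  "halted p c \<longleftrightarrow> pc c < length p \<and> p ! pc c = Halt"

fun instr_regs :: "instr \<Rightarrow> reg set" where
  "instr_regs (Const r z) = {r}"
| "instr_regs (Move r a) = {r, a}"
| "instr_regs (Add r a b) = {r, a, b}"
| "instr_regs (Sub r a b) = {r, a, b}"
| "instr_regs (Mul r a b) = {r, a, b}"
| "instr_regs (Div r a b) = {r, a, b}"
| "instr_regs (Load r a) = {r, a}"
| "instr_regs (Store a r) = {a, r}"
| "instr_regs (Jump l) = {}"
| "instr_regs (JumpLe a b l) = {a, b}"
| "instr_regs (Output r) = {r}"
| "instr_regs Halt = {}"

definition num_regs :: "program \<Rightarrow> nat" where
  "num_regs p = card (\<Union>i \<in> set p. instr_regs i)"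

text \<open>
  Input convention: register 0 holds \<open>n\<close>, register 1 holds \<open>k\<close>, memory cells \<open>0, \<dots>, n - 1\<close> hold
  the points, and everything else is 0.
\<close>

definition init_config :: "real list \<Rightarrow> nat \<Rightarrow> config" where
  "init_config xs k =
    \<lparr>pc = 0,
     regs = (\<lambda>_. 0)(0 := real (length xs), 1 := real k),
     mem = (\<lambda>i. if i < length xs then xs ! i else 0),
     out = []\<rparr>"

text \<open>
  On input \<open>(xs, k)\<close> the program \<open>p\<close> halts with output \<open>ys\<close> after \<open>t\<close> instructions in total (the
  final \<^const>\<open>Halt\<close> included), using \<open>s\<close> units of space: its registers together with all of the
  memory, whose cells \<open>0, \<dots>, m - 1\<close> include those occupied by the input.
  The write-only output stream is not counted, as \<open>k\<close> centroids do not fit into \<open>O(n)\<close> cells when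
  \<open>k\<close> is much larger than \<open>n\<close>.
\<close>

definition computes_in :: "program \<Rightarrow> real list \<Rightarrow> nat \<Rightarrow> real list \<Rightarrow> nat \<Rightarrow> nat \<Rightarrow> bool" where
  "computes_in p xs k ys t s \<longleftrightarrow>
    (\<exists>m j c. length xs \<le> m \<and> s = num_regs p + m \<and> t = Suc j \<and>
      (step m p ^^ j) (init_config xs k) c \<and> halted p c \<and> out c = ys)"

definition kmeans_cost :: "real list \<Rightarrow> real set \<Rightarrow> real" where
  "kmeans_cost xs M = (\<Sum>x\<leftarrow>xs. MIN \<mu>\<in>M. (x - \<mu>)\<^sup>2)"

text \<open>The centroids \<open>\<mu>\<^sub>1, \<dots>, \<mu>\<^sub>k\<close> form a list and need not be distinct, so \<open>k\<close> may exceed \<open>n\<close>.\<close>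

definition optimal_kmeans :: "real list \<Rightarrow> nat \<Rightarrow> real list \<Rightarrow> bool" where
  "optimal_kmeans xs k ms \<longleftrightarrow>
    length ms = k \<and>
    (\<forall>ms'. length ms' = k \<longrightarrow> kmeans_cost xs (set ms) \<le> kmeans_cost xs (set ms'))"

end

theory Submission
  imports Defs "HOL-Library.Sublist"
begin

text \<open>
  On sorted points an optimal clustering consists of consecutive blocks, and the cost of a block, extended
  by 0 to empty ones, satisfies the Monge inequality. Hence one layer of the dynamic program over the
  number of clusters is the computation of all row minima of a totally monotone matrix, which SMAWK does
  in linear time: reduce the columns for strides 1, 2, 4, ..., then fill in the rows between those already
  solved while the stride shrinks back to 1. Only the current layer is kept, together with the position at
  which an optimal partition crosses the middle layer (Hirschberg); a stack of pending pieces then replaces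
  recursion. A piece with \<open>q\<close> clusters and \<open>N\<close> points is split in time \<open>O(q (N + 1))\<close>, and the
  potential \<open>4 q N + q\<^sup>2\<close>, summed over the stack, pays for all splits. If \<open>k > n\<close>, then \<open>n\<close> clusters
  already have cost 0 and the output is padded.
\<close>

section \<open>Structured programs for the real RAM\<close>

text \<open>\<open>Loop c a b d\<close> runs \<open>c\<close>, leaves if \<open>a \<le> b\<close>, and otherwise runs \<open>d\<close> and starts again.\<close>

datatype com =
    Block "instr list"
  | Seq com com  (infixr \<open>;;\<close> 60)
  | Cond reg reg com com
  | Loop com reg reg com

abbreviation Until :: "reg \<Rightarrow> reg \<Rightarrow> com \<Rightarrow> com" where
  "Until a b c \<equiv> Loop (Block []) a b c"

fun code_length :: "com \<Rightarrow> nat" where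
  "code_length (Block is) = length is"
| "code_length (c ;; d) = code_length c + code_length d"
| "code_length (Cond a b c d) = code_length c + code_length d + 2"
| "code_length (Loop c a b d) = code_length c + code_length d + 2"

fun compile :: "nat \<Rightarrow> com \<Rightarrow> program" where
  "compile l (Block is) = is"
| "compile l (c ;; d) = compile l c @ compile (l + code_length c) d"
| "compile l (Cond a b c d) =
    JumpLe a b (l + code_length d + 2) # compile (Suc l) d @
    Jump (l + code_length c + code_length d + 2) # compile (l + code_length d + 2) c"
| "compile l (Loop c a b d) =
    compile l c @ JumpLe a b (l + code_length c + code_length d + 2) #
    compile (Suc (l + code_length c)) d @ [Jump l]"

lemma length_compile [simp]: "length (compile l c) = code_length c"
  by (induction c arbitrary: l) auto

type_synonym state = "(reg \<Rightarrow> real) \<times> (nat \<Rightarrow> real) \<times> real list"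

definition config_at :: "nat \<Rightarrow> state \<Rightarrow> config" where
  "config_at l s = (case s of (R, M, Y) \<Rightarrow> \<lparr>pc = l, regs = R, mem = M, out = Y\<rparr>)"

definition runs :: "nat \<Rightarrow> com \<Rightarrow> state \<Rightarrow> nat \<Rightarrow> state \<Rightarrow> bool" where
  "runs m c s t s' \<longleftrightarrow> (\<forall>p l. prefix (compile l c) (drop l p) \<longrightarrow>
     (step m p ^^ t) (config_at l s) (config_at (l + code_length c) s'))"

lemma runsI:
  assumes "\<And>p l. prefix (compile l c) (drop l p) \<Longrightarrow>
    (step m p ^^ t) (config_at l s) (config_at (l + code_length c) s')"
  shows "runs m c s t s'"
  using assms by (simp add: runs_def)

lemma runsD:
  assumes "runs m c s t s'" "prefix (compile l c) (drop l p)" "l' = l + code_length c"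
  shows "(step m p ^^ t) (config_at l s) (config_at l' s')"
  using assms by (simp add: runs_def)

lemma prefix_append_iff: "prefix (xs @ ys) zs \<longleftrightarrow> prefix xs zs \<and> prefix ys (drop (length xs) zs)"
  by (auto simp: prefix_def)

lemma prefix_Cons_drop_iff:
  "prefix (x # xs) (drop l zs) \<longleftrightarrow> l < length zs \<and> zs ! l = x \<and> prefix xs (drop (Suc l) zs)"
  by (cases "l < length zs") (auto simp flip: Cons_nth_drop_Suc)

lemmas code_prefix_simps = prefix_append_iff prefix_Cons_drop_iff drop_drop add_ac

lemma step_JumpLe:
  assumes "l < length p" "p ! l = JumpLe a b l'"
  shows "step m p (config_at l (R, M, Y)) (config_at (if R a \<le> R b then l' else Suc l) (R, M, Y))"
  using assms by (simp add: step_def config_at_def)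

lemma step_Jump:
  assumes "l < length p" "p ! l = Jump l'"
  shows "step m p (config_at l (R, M, Y)) (config_at l' (R, M, Y))"
  using assms by (simp add: step_def config_at_def)

lemma runs_Nil: "runs m (Block []) s 0 s"
  by (rule runsI) simp

lemma runs_instr:
  assumes "\<And>l. exec m i (config_at l s) = Some (config_at (Suc l) s')"
  shows "runs m (Block [i]) s 1 s'"
proof (rule runsI)
  fix p l assume "prefix (compile l (Block [i])) (drop l p)"
  then have "l < length p" "p ! l = i" by (simp_all add: prefix_Cons_drop_iff)
  with assms[of l] show "(step m p ^^ 1) (config_at l s) (config_at (l + code_length (Block [i])) s')"
    unfolding relpowp_1 by (cases s) (simp add: step_def config_at_def)
qed

lemma runs_Seq:
  assumes "runs m c s t s'" "runs m d s' u s''"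
  shows "runs m (c ;; d) s (t + u) s''"
proof (rule runsI)
  fix p l assume "prefix (compile l (c ;; d)) (drop l p)"
  then have "prefix (compile l c) (drop l p)"
      "prefix (compile (l + code_length c) d) (drop (l + code_length c) p)"
    by (simp_all add: code_prefix_simps)
  from relpowp_trans[OF runsD[OF assms(1) this(1) refl] runsD[OF assms(2) this(2) refl]]
  show "(step m p ^^ (t + u)) (config_at l s) (config_at (l + code_length (c ;; d)) s'')"
    by (simp add: add.assoc)
qed

lemma runs_Block_Cons: "runs m (Block [i] ;; Block is) s t s' \<Longrightarrow> runs m (Block (i # is)) s t s'"
  by (simp add: runs_def)

lemma runs_Cond_le:
  assumes "runs m c (R, M, Y) t s'" "R a \<le> R b"
  shows "runs m (Cond a b c d) (R, M, Y) (Suc t) s'"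
proof (rule runsI)
  fix p l assume "prefix (compile l (Cond a b c d)) (drop l p)"
  then have jump: "l < length p" "p ! l = JumpLe a b (l + code_length d + 2)"
      and c: "prefix (compile (l + code_length d + 2) c) (drop (l + code_length d + 2) p)"
    by (simp_all add: code_prefix_simps)
  have "step m p (config_at l (R, M, Y)) (config_at (l + code_length d + 2) (R, M, Y))"
    using step_JumpLe[OF jump, of m R M Y] assms(2) by simp
  then show "(step m p ^^ Suc t) (config_at l (R, M, Y)) (config_at (l + code_length (Cond a b c d)) s')"
    by (rule relpowp_Suc_I2) (rule runsD[OF assms(1) c], simp)
qed

lemma runs_Cond_gr:
  assumes "runs m d (R, M, Y) t s'" "R b < R a"
  shows "runs m (Cond a b c d) (R, M, Y) (Suc (Suc t)) s'"
proof (rule runsI)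
  fix p l assume "prefix (compile l (Cond a b c d)) (drop l p)"
  then have jumpLe: "l < length p" "p ! l = JumpLe a b (l + code_length d + 2)"
      and d: "prefix (compile (Suc l) d) (drop (Suc l) p)"
      and jump: "Suc (l + code_length d) < length p"
        "p ! Suc (l + code_length d) = Jump (l + code_length (Cond a b c d))"
    by (simp_all add: code_prefix_simps)
  obtain R' M' Y' where s': "s' = (R', M', Y')" by (cases s')
  have "step m p (config_at l (R, M, Y)) (config_at (Suc l) (R, M, Y))"
    using step_JumpLe[OF jumpLe, of m R M Y] assms(2) by simp
  also have "(step m p ^^ t) (config_at (Suc l) (R, M, Y)) (config_at (Suc (l + code_length d)) s')"
    by (rule runsD[OF assms(1) d]) simp
  also have "step m p (config_at (Suc (l + code_length d)) s') (config_at (l + code_length (Cond a b c d)) s')"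
    unfolding s' by (rule step_Jump[OF jump])
  finally show
    "(step m p ^^ Suc (Suc t)) (config_at l (R, M, Y)) (config_at (l + code_length (Cond a b c d)) s')" .
qed

lemma prefix_compile_Loop:
  assumes "prefix (compile l (Loop c a b d)) (drop l p)"
  shows "prefix (compile l c) (drop l p)"
    and "l + code_length c < length p"
    and "p ! (l + code_length c) = JumpLe a b (l + code_length (Loop c a b d))"
    and "prefix (compile (Suc (l + code_length c)) d) (drop (Suc (l + code_length c)) p)"
    and "Suc (l + code_length c + code_length d) < length p"
    and "p ! Suc (l + code_length c + code_length d) = Jump l"
  using assms by (simp_all add: code_prefix_simps)

lemma runs_Loop_exit:
  assumes "runs m c s t (R, M, Y)" "R a \<le> R b"
  shows "runs m (Loop c a b d) s (Suc t) (R, M, Y)"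
proof (rule runsI)
  fix p l assume "prefix (compile l (Loop c a b d)) (drop l p)"
  note code = prefix_compile_Loop[OF this]
  have "step m p (config_at (l + code_length c) (R, M, Y))
      (config_at (l + code_length (Loop c a b d)) (R, M, Y))"
    using step_JumpLe[OF code(2,3), of m R M Y] assms(2) by simp
  then show "(step m p ^^ Suc t) (config_at l s) (config_at (l + code_length (Loop c a b d)) (R, M, Y))"
    by (rule relpowp_Suc_I[rotated]) (rule runsD[OF assms(1) code(1) refl])
qed

lemma runs_Loop_iterate:
  assumes head: "runs m c s t (R, M, Y)" and continue: "R b < R a"
    and body: "runs m d (R, M, Y) u s'" and rest: "runs m (Loop c a b d) s' v s''"
  shows "runs m (Loop c a b d) s (t + u + v + 2) s''"
proof (rule runsI)
  fix p l assume Loop: "prefix (compile l (Loop c a b d)) (drop l p)"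
  note code = prefix_compile_Loop[OF this]
  let ?d = "Suc (l + code_length c)"
  obtain R' M' Y' where s': "s' = (R', M', Y')" by (cases s')
  have "(step m p ^^ t) (config_at l s) (config_at (l + code_length c) (R, M, Y))"
    by (rule runsD[OF head code(1) refl])
  also have "step m p (config_at (l + code_length c) (R, M, Y)) (config_at ?d (R, M, Y))"
    using step_JumpLe[OF code(2,3), of m R M Y] continue by simp
  also have "(step m p ^^ u) (config_at ?d (R, M, Y)) (config_at (?d + code_length d) s')"
    by (rule runsD[OF body code(4) refl])
  also have "step m p (config_at (?d + code_length d) s') (config_at l s')"
    using step_Jump[OF code(5,6)] by (simp add: s')
  also have "(step m p ^^ v) (config_at l s') (config_at (l + code_length (Loop c a b d)) s'')"
    by (rule runsD[OF rest Loop refl])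
  finally show "(step m p ^^ (t + u + v + 2)) (config_at l s) (config_at (l + code_length (Loop c a b d)) s'')"
    by simp
qed

section \<open>Weakest preconditions with fuel\<close>

type_synonym assertion = "(reg \<Rightarrow> real) \<Rightarrow> (nat \<Rightarrow> real) \<Rightarrow> real list \<Rightarrow> real \<Rightarrow> bool"

text \<open>
  The last argument of an assertion is the remaining fuel. An instruction consumes at least one unit of
  it, and it may become negative: a lower bound on the fuel left over bounds the running time from above.
\<close>

definition wp :: "nat \<Rightarrow> com \<Rightarrow> assertion \<Rightarrow> assertion" where
  "wp m c Q R M Y f \<longleftrightarrow>
    (\<exists>t R' M' Y' f'. runs m c (R, M, Y) t (R', M', Y') \<and> f' + real t \<le> f \<and> Q R' M' Y' f')"

lemma wpI:
  assumes "runs m c (R, M, Y) t (R', M', Y')" "f' + real t \<le> f" "Q R' M' Y' f'"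
  shows "wp m c Q R M Y f"
  using assms unfolding wp_def by blast

lemma wpE:
  assumes "wp m c Q R M Y f"
  obtains t R' M' Y' f' where "runs m c (R, M, Y) t (R', M', Y')" "f' + real t \<le> f" "Q R' M' Y' f'"
  using assms unfolding wp_def by blast

lemma wp_mono:
  assumes "wp m c P R M Y f" and "\<And>R' M' Y' f'. P R' M' Y' f' \<Longrightarrow> Q R' M' Y' f'"
  shows "wp m c Q R M Y f"
  using assms unfolding wp_def by meson

lemma wp_Seq:
  assumes "wp m c P R M Y f" and "\<And>R' M' Y' f'. P R' M' Y' f' \<Longrightarrow> wp m d Q R' M' Y' f'"
  shows "wp m (c ;; d) Q R M Y f"
proof -
  obtain t R1 M1 Y1 f1 where c: "runs m c (R, M, Y) t (R1, M1, Y1)" "f1 + real t \<le> f"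
      and "P R1 M1 Y1 f1"
    using assms(1) by (rule wpE)
  from assms(2)[OF this(3)] obtain u R2 M2 Y2 f2
    where d: "runs m d (R1, M1, Y1) u (R2, M2, Y2)" "f2 + real u \<le> f1" and "Q R2 M2 Y2 f2"
    by (rule wpE)
  show ?thesis
    by (rule wpI[OF runs_Seq[OF c(1) d(1)]]) (use c(2) d(2) \<open>Q R2 M2 Y2 f2\<close> in auto)
qed

lemma wp_Seq_nested: "wp m c (wp m d Q) R M Y f \<Longrightarrow> wp m (c ;; d) Q R M Y f"
  by (rule wp_Seq)

fun instr_wp :: "nat \<Rightarrow> instr \<Rightarrow> assertion \<Rightarrow> assertion" where
  "instr_wp m (Const r z) Q R M Y f = Q (R(r := of_int z)) M Y (f - 1)"
| "instr_wp m (Move r a) Q R M Y f = Q (R(r := R a)) M Y (f - 1)"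
| "instr_wp m (Add r a b) Q R M Y f = Q (R(r := R a + R b)) M Y (f - 1)"
| "instr_wp m (Sub r a b) Q R M Y f = Q (R(r := R a - R b)) M Y (f - 1)"
| "instr_wp m (Mul r a b) Q R M Y f = Q (R(r := R a * R b)) M Y (f - 1)"
| "instr_wp m (Div r a b) Q R M Y f = (R b \<noteq> 0 \<and> Q (R(r := R a / R b)) M Y (f - 1))"
| "instr_wp m (Load r a) Q R M Y f =
    (case address m (R a) of None \<Rightarrow> False | Some i \<Rightarrow> Q (R(r := M i)) M Y (f - 1))"
| "instr_wp m (Store a r) Q R M Y f =
    (case address m (R a) of None \<Rightarrow> False | Some i \<Rightarrow> Q R (M(i := R r)) Y (f - 1))"
| "instr_wp m (Output r) Q R M Y f = Q R M (Y @ [R r]) (f - 1)"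
| "instr_wp m _ Q R M Y f = False"

fun block_wp :: "nat \<Rightarrow> instr list \<Rightarrow> assertion \<Rightarrow> assertion" where
  "block_wp m [] Q = Q"
| "block_wp m (i # is) Q = instr_wp m i (block_wp m is Q)"

lemma wp_instr:
  assumes "instr_wp m i Q R M Y f"
  shows "wp m (Block [i]) Q R M Y f"
proof -
  obtain R' M' Y' where "\<And>l. exec m i (config_at l (R, M, Y)) = Some (config_at (Suc l) (R', M', Y'))"
      and "Q R' M' Y' (f - 1)"
    using assms by (cases i) (auto simp: set_reg_def config_at_def split: option.splits)
  then show ?thesis by (intro wpI[OF runs_instr]) auto
qed

lemma wp_Block:
  assumes "block_wp m is Q R M Y f"
  shows "wp m (Block is) Q R M Y f"
  using assms
proof (induction "is" arbitrary: R M Y f)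
  case Nil
  then show ?case by (intro wpI[OF runs_Nil]) auto
next
  case (Cons i "is")
  then have "wp m (Block [i]) (block_wp m is Q) R M Y f" by (simp add: wp_instr)
  then have "wp m (Block [i] ;; Block is) Q R M Y f" by (rule wp_Seq) (rule Cons.IH)
  then show ?case unfolding wp_def using runs_Block_Cons by blast
qed

lemma wp_Block_Seq:
  assumes "block_wp m is (wp m c Q) R M Y f"
  shows "wp m (Block is ;; c) Q R M Y f"
  using wp_Block[OF assms] by (rule wp_Seq_nested)

lemma wp_Cond:
  assumes "R a \<le> R b \<Longrightarrow> wp m c Q R M Y (f - 2)" and "R b < R a \<Longrightarrow> wp m d Q R M Y (f - 2)"
  shows "wp m (Cond a b c d) Q R M Y f"
proof (cases "R a \<le> R b")
  case True
  from assms(1)[OF this] show ?thesis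
    by (rule wpE) (rule wpI[OF runs_Cond_le[OF _ True]], auto)
next
  case False
  then have "R b < R a" by simp
  from assms(2)[OF this] show ?thesis
    by (rule wpE) (rule wpI[OF runs_Cond_gr[OF _ \<open>R b < R a\<close>]], auto)
qed

text \<open>Fuel drops with every iteration, so a lower bound on it makes the loop terminate.\<close>

lemma wp_Loop:
  assumes inv: "I R M Y f"
    and bounded: "\<And>R M Y f. I R M Y f \<Longrightarrow> B \<le> f"
    and head: "\<And>R M Y f. I R M Y f \<Longrightarrow> wp m c J R M Y f"
    and exit: "\<And>R M Y f. J R M Y f \<Longrightarrow> R a \<le> R b \<Longrightarrow> Q R M Y (f - 1)"
    and body: "\<And>R M Y f. J R M Y f \<Longrightarrow> R b < R a \<Longrightarrow> wp m d I R M Y (f - 2)"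
  shows "wp m (Loop c a b d) Q R M Y f"
  using inv
proof (induction "nat \<lfloor>f - B\<rfloor>" arbitrary: R M Y f rule: less_induct)
  case less
  obtain t R1 M1 Y1 f1 where first: "runs m c (R, M, Y) t (R1, M1, Y1)" "f1 + real t \<le> f"
      and "J R1 M1 Y1 f1"
    by (rule wpE[OF head[OF less.prems]])
  show ?case
  proof (cases "R1 a \<le> R1 b")
    case True
    show ?thesis
      by (rule wpI[OF runs_Loop_exit[OF first(1) True]]) (use first(2) exit[OF \<open>J R1 M1 Y1 f1\<close> True] in auto)
  next
    case False
    then have less_ab: "R1 b < R1 a" by simp
    obtain u R2 M2 Y2 f2 where second: "runs m d (R1, M1, Y1) u (R2, M2, Y2)" "f2 + real u \<le> f1 - 2"
        and "I R2 M2 Y2 f2"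
      by (rule wpE[OF body[OF \<open>J R1 M1 Y1 f1\<close> less_ab]])
    have "nat \<lfloor>f2 - B\<rfloor> < nat \<lfloor>f - B\<rfloor>"
      using bounded[OF \<open>I R2 M2 Y2 f2\<close>] first(2) second(2) by linarith
    from less.hyps[OF this \<open>I R2 M2 Y2 f2\<close>] obtain v R3 M3 Y3 f3
      where rest: "runs m (Loop c a b d) (R2, M2, Y2) v (R3, M3, Y3)" "f3 + real v \<le> f2"
        and "Q R3 M3 Y3 f3"
      by (rule wpE)
    show ?thesis
      by (rule wpI[OF runs_Loop_iterate[OF first(1) less_ab second(1) rest(1)]])
        (use first(2) second(2) rest(2) \<open>Q R3 M3 Y3 f3\<close> in auto)
  qed
qed

lemma wp_Until:
  assumes "I R M Y f"
    and "\<And>R M Y f. I R M Y f \<Longrightarrow> B \<le> f"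
    and "\<And>R M Y f. I R M Y f \<Longrightarrow> R a \<le> R b \<Longrightarrow> Q R M Y (f - 1)"
    and "\<And>R M Y f. I R M Y f \<Longrightarrow> R b < R a \<Longrightarrow> wp m c I R M Y (f - 2)"
  shows "wp m (Until a b c) Q R M Y f"
  using assms(1,2) _ assms(3,4) by (rule wp_Loop) (auto intro: wp_Block)

lemma wp_Until_count:
  fixes n :: nat and T :: real
  assumes init: "P 0 R M Y"
    and guard: "\<And>i R M Y. i \<le> n \<Longrightarrow> P i R M Y \<Longrightarrow> R a \<le> R b \<longleftrightarrow> i = n"
    and body: "\<And>i R M Y f. i < n \<Longrightarrow> P i R M Y \<Longrightarrow>
      wp m c (\<lambda>R' M' Y' f'. P (Suc i) R' M' Y' \<and> f - T \<le> f') R M Y f"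
    and "0 \<le> T"
  shows "wp m (Until a b c) (\<lambda>R' M' Y' f'. P n R' M' Y' \<and> f - (T + 2) * real n - 1 \<le> f') R M Y f"
proof -
  define I where "I = (\<lambda>R' M' Y' f'. \<exists>i\<le>n. P i R' M' Y' \<and> f - (T + 2) * real i \<le> f')"
  show ?thesis
  proof (rule wp_Until[where I = I and B = "f - (T + 2) * real n"])
    show "I R M Y f" unfolding I_def using init by auto
  next
    fix R' M' Y' f' assume "I R' M' Y' f'"
    then obtain i where "i \<le> n" "f - (T + 2) * real i \<le> f'" unfolding I_def by blast
    moreover have "(T + 2) * real i \<le> (T + 2) * real n"
      using \<open>i \<le> n\<close> \<open>0 \<le> T\<close> by (intro mult_left_mono) auto
    ultimately show "f - (T + 2) * real n \<le> f'" by linarith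
  next
    fix R' M' Y' f' assume "I R' M' Y' f'" "R' a \<le> R' b"
    then show "P n R' M' Y' \<and> f - (T + 2) * real n - 1 \<le> f' - 1"
      unfolding I_def using guard by auto
  next
    fix R' M' Y' f' assume "I R' M' Y' f'" and less_ab: "R' b < R' a"
    then obtain i where i: "i \<le> n" "P i R' M' Y'" "f - (T + 2) * real i \<le> f'"
      unfolding I_def by blast
    then have "i < n" using guard[OF i(1,2)] less_ab by simp
    from body[OF this i(2), of "f' - 2"] show "wp m c I R' M' Y' (f' - 2)"
    proof (rule wp_mono, elim conjE)
      fix R'' M'' Y'' f'' assume "P (Suc i) R'' M'' Y''" "f' - 2 - T \<le> f''"
      moreover have "f - (T + 2) * real (Suc i) \<le> f' - 2 - T" using i(3) by (simp add: algebra_simps)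
      ultimately show "I R'' M'' Y'' f''"
        unfolding I_def using \<open>i < n\<close> by (intro exI[of _ "Suc i"]) auto
    qed
  qed
qed

lemma computes_in_compile:
  assumes "wp m c (\<lambda>R M Y f. 0 \<le> f \<and> P Y)
      (regs (init_config xs k)) (mem (init_config xs k)) [] (real T)"
    and "length xs \<le> m"
  defines "p \<equiv> compile 0 c @ [Halt]"
  obtains t ys where "computes_in p xs k ys t (num_regs p + m)" "P ys" "t \<le> Suc T"
proof -
  obtain t R M Y f where run: "runs m c (regs (init_config xs k), mem (init_config xs k), []) t (R, M, Y)"
      and f: "f + real t \<le> real T" "0 \<le> f" and Y: "P Y"
    by (rule wpE[OF assms(1)]) blast
  have "config_at 0 (regs (init_config xs k), mem (init_config xs k), []) = init_config xs k"
    by (simp add: init_config_def config_at_def)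
  moreover have "prefix (compile 0 c) (drop 0 p)" by (simp add: p_def)
  ultimately have "(step m p ^^ t) (init_config xs k) (config_at (code_length c) (R, M, Y))"
    using runsD[OF run, of 0 p] by simp
  moreover have "halted p (config_at (code_length c) (R, M, Y))"
    by (simp add: halted_def p_def nth_append config_at_def)
  ultimately have "computes_in p xs k Y (Suc t) (num_regs p + m)"
    unfolding computes_in_def using assms(2)
    by (intro exI[of _ m] exI[of _ t] exI[of _ "config_at (code_length c) (R, M, Y)"])
      (auto simp: config_at_def)
  moreover have "t \<le> T" using f by linarith
  ultimately show ?thesis using that Y by simp
qed

section \<open>Optimal clusterings of consecutive points\<close>

definition sq_dev :: "(nat \<Rightarrow> real) \<Rightarrow> nat \<Rightarrow> nat \<Rightarrow> real \<Rightarrow> real" where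
  "sq_dev x a b \<mu> = (\<Sum>i=a..<b. (x i - \<mu>)\<^sup>2)"

definition mean :: "(nat \<Rightarrow> real) \<Rightarrow> nat \<Rightarrow> nat \<Rightarrow> real" where
  "mean x a b = (\<Sum>i=a..<b. x i) / (real b - real a)"

definition sse :: "(nat \<Rightarrow> real) \<Rightarrow> nat \<Rightarrow> nat \<Rightarrow> real" where
  "sse x a b = sq_dev x a b (mean x a b)"

lemma sq_dev_empty [simp]: "b \<le> a \<Longrightarrow> sq_dev x a b \<mu> = 0"
  by (simp add: sq_dev_def)

lemma sq_dev_concat: "a \<le> b \<Longrightarrow> b \<le> c \<Longrightarrow> sq_dev x a b \<mu> + sq_dev x b c \<mu> = sq_dev x a c \<mu>"
  unfolding sq_dev_def by (rule sum.atLeastLessThan_concat)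

lemma sq_dev_subset: "a' \<le> a \<Longrightarrow> b \<le> b' \<Longrightarrow> sq_dev x a b \<mu> \<le> sq_dev x a' b' \<mu>"
  unfolding sq_dev_def by (intro sum_mono2) auto

lemma sq_dev_closer:
  assumes "\<And>i. a \<le> i \<Longrightarrow> i < b \<Longrightarrow> \<bar>x i - \<nu>\<bar> \<le> \<bar>x i - \<mu>\<bar>"
  shows "sq_dev x a b \<nu> \<le> sq_dev x a b \<mu>"
  unfolding sq_dev_def using assms by (intro sum_mono) (auto simp: abs_le_square_iff)

lemma sq_dev_eq:
  "sq_dev x a b \<mu> = (\<Sum>i=a..<b. (x i)\<^sup>2) - 2 * \<mu> * (\<Sum>i=a..<b. x i) + real (b - a) * \<mu>\<^sup>2"
proof -
  have "sq_dev x a b \<mu> = (\<Sum>i=a..<b. (x i)\<^sup>2 - 2 * \<mu> * x i + \<mu>\<^sup>2)"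
    unfolding sq_dev_def by (intro sum.cong) (auto simp: power2_eq_square algebra_simps)
  then show ?thesis by (simp add: sum.distrib sum_subtractf sum_distrib_left)
qed

lemma sse_eq:
  assumes "a < b"
  shows "sse x a b = (\<Sum>i=a..<b. (x i)\<^sup>2) - (\<Sum>i=a..<b. x i)\<^sup>2 / (real b - real a)"
proof -
  define d where "d = real b - real a"
  have "d > 0" "real (b - a) = d" using assms by (simp_all add: d_def)
  then show ?thesis
    by (simp add: sse_def sq_dev_eq mean_def field_simps power2_eq_square flip: d_def)
qed

lemma sse_empty [simp]: "b \<le> a \<Longrightarrow> sse x a b = 0"
  by (simp add: sse_def)

lemma sse_nonneg [simp]: "0 \<le> sse x a b"
  by (simp add: sse_def sq_dev_def sum_nonneg)

lemma sse_le_sq_dev: "sse x a b \<le> sq_dev x a b \<mu>"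
proof (cases "a < b")
  case True
  define d where "d = real b - real a"
  have "d > 0" using True by (simp add: d_def)
  then have "sq_dev x a b \<mu> = sse x a b + ((\<Sum>i=a..<b. x i) - \<mu> * d)\<^sup>2 / d"
    using True by (simp add: sse_eq sq_dev_eq of_nat_diff field_simps power2_eq_square flip: d_def)
  then show ?thesis using \<open>d > 0\<close> by simp
qed simp

lemma sse_mono:
  assumes "a' \<le> a" "b \<le> b'"
  shows "sse x a b \<le> sse x a' b'"
  unfolding sse_def[of x a' b'] using sse_le_sq_dev sq_dev_subset[OF assms] by (rule order_trans)

lemma sse_disjoint_le:
  assumes "a \<le> a'" "b \<le> a'" "b \<le> b'"
  shows "sse x a b + sse x a' b' \<le> sse x a b'"
proof (cases "a \<le> b \<and> a' \<le> b'")
  case True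
  let ?\<mu> = "mean x a b'"
  have "sse x a b + sse x a' b' \<le> sq_dev x a b ?\<mu> + sq_dev x b b' ?\<mu>"
    using assms by (intro add_mono sse_le_sq_dev order_trans[OF sse_le_sq_dev sq_dev_subset]) auto
  also have "\<dots> = sse x a b'" using True assms by (simp add: sq_dev_concat sse_def)
  finally show ?thesis .
next
  case False
  then show ?thesis
    using sse_mono[of a a b b' x] sse_mono[of a a' b' b' x] assms by auto
qed

lemma mean_bounds:
  assumes x: "mono_on {..<n} x" and "a < b" "b \<le> n"
  shows "x a \<le> mean x a b" "mean x a b \<le> x (b - 1)"
proof -
  have d: "real (card {a..<b}) = real b - real a" "real b - real a > 0" using assms(2) by auto
  have "(real b - real a) * x a \<le> sum x {a..<b}"
    unfolding d(1)[symmetric] using assms by (intro sum_bounded_below mono_onD[OF x]) auto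
  then show "x a \<le> mean x a b" by (simp add: mean_def pos_le_divide_eq[OF d(2)] mult.commute)
  have "sum x {a..<b} \<le> (real b - real a) * x (b - 1)"
    unfolding d(1)[symmetric] using assms by (intro sum_bounded_above mono_onD[OF x]) auto
  then show "mean x a b \<le> x (b - 1)" by (simp add: mean_def pos_divide_le_eq[OF d(2)] mult.commute)
qed

text \<open>
  Exchange argument: of the means of the outer and of the inner block, the smaller one serves the
  left and the larger one the right of the two overlapping blocks.
\<close>

lemma sse_monge:
  assumes x: "mono_on {..<n} x" and "a \<le> a'" "b \<le> b'" "b' \<le> n"
  shows "sse x a b + sse x a' b' \<le> sse x a' b + sse x a b'"
proof (cases "a' < b")
  case False
  then show ?thesis using sse_disjoint_le[of a a' b b' x] assms by simp
next
  case True
  define \<mu> where "\<mu> = mean x a b'"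
  define \<nu> where "\<nu> = mean x a' b"
  have inner: "x a' \<le> \<nu>" "\<nu> \<le> x (b - 1)"
    unfolding \<nu>_def using mean_bounds[OF x True] assms by auto
  have total: "sse x a' b + sse x a b' = sq_dev x a' b \<nu> + sq_dev x a b' \<mu>"
    by (simp add: sse_def \<mu>_def \<nu>_def)
  show ?thesis
  proof (cases "\<mu> \<le> \<nu>")
    case mean_le: True
    have "x (b - 1) \<le> x i" if "b \<le> i" "i < b'" for i
      using that assms True by (intro mono_onD[OF x]) auto
    then have "sq_dev x b b' \<nu> \<le> sq_dev x b b' \<mu>"
      using inner(2) mean_le by (intro sq_dev_closer) (force simp: abs_if)
    moreover have "sse x a b + sse x a' b' \<le> sq_dev x a b \<mu> + sq_dev x a' b' \<nu>"
      by (intro add_mono sse_le_sq_dev)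
    ultimately show ?thesis
      using total sq_dev_concat[of a b b' x \<mu>] sq_dev_concat[of a' b b' x \<nu>] assms True by simp
  next
    case mean_gr: False
    have "x i \<le> x a'" if "a \<le> i" "i < a'" for i
      using that assms True by (intro mono_onD[OF x]) auto
    then have "sq_dev x a a' \<nu> \<le> sq_dev x a a' \<mu>"
      using inner(1) mean_gr by (intro sq_dev_closer) (force simp: abs_if)
    moreover have "sse x a b + sse x a' b' \<le> sq_dev x a b \<nu> + sq_dev x a' b' \<mu>"
      by (intro add_mono sse_le_sq_dev)
    ultimately show ?thesis
      using total sq_dev_concat[of a a' b' x \<mu>] sq_dev_concat[of a a' b x \<nu>] assms True by simp
  qed
qed

text \<open>\<open>opt x q a b\<close> is the least cost of partitioning \<open>x a, \<dots>, x (b - 1)\<close> by \<open>q\<close> separators into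
  \<open>q + 1\<close> consecutive, possibly empty clusters.\<close>

fun opt :: "(nat \<Rightarrow> real) \<Rightarrow> nat \<Rightarrow> nat \<Rightarrow> nat \<Rightarrow> real" where
  "opt x 0 a b = sse x a b"
| "opt x (Suc q) a b = (MIN j\<in>{a..b}. opt x q a j + sse x j b)"

declare opt.simps(2) [simp del]

lemma opt_Suc_le: "a \<le> j \<Longrightarrow> j \<le> b \<Longrightarrow> opt x (Suc q) a b \<le> opt x q a j + sse x j b"
  by (auto simp: opt.simps intro!: Min_le)

lemma opt_Suc_attained:
  assumes "a \<le> b"
  obtains j where "a \<le> j" "j \<le> b" "opt x (Suc q) a b = opt x q a j + sse x j b"
proof -
  have "opt x (Suc q) a b \<in> (\<lambda>j. opt x q a j + sse x j b) ` {a..b}"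
    unfolding opt.simps using assms by (intro Min_in) auto
  then show ?thesis using that by auto
qed

lemma opt_nonneg: "a \<le> b \<Longrightarrow> 0 \<le> opt x q a b"
proof (induction q arbitrary: b)
  case (Suc q)
  obtain j where "a \<le> j" "j \<le> b" "opt x (Suc q) a b = opt x q a j + sse x j b"
    using opt_Suc_attained[OF Suc.prems] .
  then show ?case using Suc.IH[of j] by simp
qed simp

lemma opt_empty [simp]: "opt x q a a = 0"
  by (induction q) (auto simp: opt.simps)

lemma opt_mono: "a \<le> b \<Longrightarrow> b \<le> b' \<Longrightarrow> opt x q a b \<le> opt x q a b'"
proof (induction q arbitrary: b b')
  case 0
  then show ?case by (simp add: sse_mono)
next
  case (Suc q)
  then obtain j where j: "a \<le> j" "j \<le> b'" "opt x (Suc q) a b' = opt x q a j + sse x j b'"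
    using opt_Suc_attained[of a b'] by (metis le_trans)
  show ?case
  proof (cases "j \<le> b")
    case True
    have "opt x (Suc q) a b \<le> opt x q a j + sse x j b" using j True by (intro opt_Suc_le)
    also have "\<dots> \<le> opt x (Suc q) a b'" using j Suc.prems sse_mono[of j j b b' x] by simp
    finally show ?thesis .
  next
    case False
    have "opt x (Suc q) a b \<le> opt x q a b + sse x b b" using Suc.prems by (intro opt_Suc_le) auto
    also have "\<dots> \<le> opt x q a j" using Suc.IH[of b j] Suc.prems False by simp
    also have "\<dots> \<le> opt x (Suc q) a b'" using j by simp
    finally show ?thesis .
  qed
qed

lemma opt_concat_le:
  "a \<le> b \<Longrightarrow> b \<le> c \<Longrightarrow> opt x (Suc (p + q)) a c \<le> opt x p a b + opt x q b c"
proof (induction q arbitrary: c)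
  case 0
  then show ?case using opt_Suc_le[of a b c x p] by simp
next
  case (Suc q)
  obtain j where j: "b \<le> j" "j \<le> c" "opt x (Suc q) b c = opt x q b j + sse x j c"
    using opt_Suc_attained[OF Suc.prems(2)] .
  have "opt x (Suc (p + Suc q)) a c \<le> opt x (Suc (p + q)) a j + sse x j c"
    using opt_Suc_le[of a j c x "Suc (p + q)"] j Suc.prems by simp
  also have "\<dots> \<le> opt x p a b + opt x q b j + sse x j c" using Suc.IH[of j] Suc.prems j by simp
  finally show ?case using j by simp
qed

definition last_sep_cost :: "(nat \<Rightarrow> real) \<Rightarrow> nat \<Rightarrow> nat \<Rightarrow> nat \<Rightarrow> nat \<Rightarrow> real" where
  "last_sep_cost x q a r c = opt x q a (a + c) + sse x (a + c) (a + r)"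

lemma last_sep_cost_monge:
  assumes "mono_on {..<n} x" "r \<le> r'" "c \<le> c'" "a + r' \<le> n"
  shows "last_sep_cost x q a r c + last_sep_cost x q a r' c' \<le>
    last_sep_cost x q a r c' + last_sep_cost x q a r' c"
  using sse_monge[OF assms(1), of "a + c" "a + c'" "a + r" "a + r'"] assms(2-4)
  by (simp add: last_sep_cost_def)

lemma opt_Suc_row_min:
  assumes "\<And>c. c \<le> m \<Longrightarrow> last_sep_cost x q a m t \<le> last_sep_cost x q a m c"
  shows "opt x (Suc q) a (a + m) = last_sep_cost x q a m (min t m)"
proof (rule antisym)
  show "opt x (Suc q) a (a + m) \<le> last_sep_cost x q a m (min t m)"
    using opt_Suc_le[of a "a + min t m" "a + m" x q] by (simp add: last_sep_cost_def)
  obtain j where j: "a \<le> j" "j \<le> a + m"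
      "opt x (Suc q) a (a + m) = opt x q a j + sse x j (a + m)"
    using opt_Suc_attained[of a "a + m"] by auto
  have "last_sep_cost x q a m (min t m) \<le> last_sep_cost x q a m t"
    using opt_mono[of a "a + m" "a + t" x q] by (auto simp: last_sep_cost_def min_def)
  also have "\<dots> \<le> last_sep_cost x q a m (j - a)" using j by (intro assms) auto
  finally show "last_sep_cost x q a m (min t m) \<le> opt x (Suc q) a (a + m)"
    using j by (simp add: last_sep_cost_def)
qed

text \<open>Some optimal partition of the first \<open>j\<close> points by \<open>k\<close> separators has its \<open>h\<close>-th separator at \<open>c\<close>,
  counting from \<open>a\<close>; as long as there are fewer than \<open>h\<close> separators, \<open>c\<close> is the right end \<open>j\<close>.\<close>

definition crossing :: "(nat \<Rightarrow> real) \<Rightarrow> nat \<Rightarrow> nat \<Rightarrow> nat \<Rightarrow> nat \<Rightarrow> nat \<Rightarrow> bool" where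
  "crossing x h k a j c \<longleftrightarrow> c \<le> j \<and> (if k < h then c = j else
     opt x k a (a + j) = opt x (h - 1) a (a + c) + opt x (k - h) (a + c) (a + j))"

lemma crossing_Suc:
  assumes "0 < h" and t: "crossing x h k a t c" "t \<le> j" and "h \<le> Suc k"
    and opt: "opt x (Suc k) a (a + j) = opt x k a (a + t) + sse x (a + t) (a + j)"
  shows "crossing x h (Suc k) a j c"
proof (cases "k < h")
  case True
  then have "h = Suc k" "c = t" using assms by (auto simp: crossing_def)
  then show ?thesis using t(2) opt by (simp add: crossing_def)
next
  case False
  then have c: "c \<le> t" "opt x k a (a + t) = opt x (h - 1) a (a + c) + opt x (k - h) (a + c) (a + t)"
    using t(1) by (auto simp: crossing_def)
  have "opt x (Suc (k - h)) (a + c) (a + j) \<le> opt x (k - h) (a + c) (a + t) + sse x (a + t) (a + j)"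
    using c t(2) by (intro opt_Suc_le) auto
  moreover have "opt x (Suc ((h - 1) + Suc (k - h))) a (a + j)
      \<le> opt x (h - 1) a (a + c) + opt x (Suc (k - h)) (a + c) (a + j)"
    using c(1) t(2) by (intro opt_concat_le) auto
  moreover have "Suc ((h - 1) + Suc (k - h)) = Suc k" "Suc k - h = Suc (k - h)"
    using False \<open>0 < h\<close> by auto
  ultimately show ?thesis using c t(2) opt False by (simp add: crossing_def)
qed

subsection \<open>Comparison with arbitrary sets of centroids\<close>

definition sq_dist :: "real set \<Rightarrow> real \<Rightarrow> real" where
  "sq_dist S y = (MIN \<mu>\<in>S. (y - \<mu>)\<^sup>2)"

lemma sq_dist_le: "finite S \<Longrightarrow> \<mu> \<in> S \<Longrightarrow> sq_dist S y \<le> (y - \<mu>)\<^sup>2"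
  unfolding sq_dist_def by (intro Min_le) auto

lemma sq_dist_nonneg: "finite S \<Longrightarrow> S \<noteq> {} \<Longrightarrow> 0 \<le> sq_dist S y"
  unfolding sq_dist_def by (intro Min.boundedI) auto

lemma le_sq_dist_iff: "finite S \<Longrightarrow> S \<noteq> {} \<Longrightarrow> d \<le> sq_dist S y \<longleftrightarrow> (\<forall>\<mu>\<in>S. d \<le> (y - \<mu>)\<^sup>2)"
  unfolding sq_dist_def by simp

lemma sq_dist_insert: "finite S \<Longrightarrow> S \<noteq> {} \<Longrightarrow> sq_dist (insert v S) y = min ((y - v)\<^sup>2) (sq_dist S y)"
  unfolding sq_dist_def image_insert by (intro Min_insert) auto

lemma sq_dist_antimono: "finite T \<Longrightarrow> S \<noteq> {} \<Longrightarrow> S \<subseteq> T \<Longrightarrow> sq_dist T y \<le> sq_dist S y"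
  unfolding sq_dist_def by (intro Min_antimono) auto

lemma closer_to_larger:
  fixes u v y z :: real
  assumes "u \<le> v" "y \<le> z" "(y - v)\<^sup>2 \<le> (y - u)\<^sup>2"
  shows "(z - v)\<^sup>2 \<le> (z - u)\<^sup>2"
proof -
  have "0 \<le> (z - y) * (v - u)" using assms by simp
  moreover have "(z - u)\<^sup>2 - (z - v)\<^sup>2 = (y - u)\<^sup>2 - (y - v)\<^sup>2 + 2 * ((z - y) * (v - u))"
    by (simp add: power2_eq_square algebra_simps)
  ultimately show ?thesis using assms(3) by simp
qed

lemma sq_dist_insert_upper_split:
  fixes x :: "nat \<Rightarrow> real"
  assumes S: "finite S" "S \<noteq> {}" "\<And>u. u \<in> S \<Longrightarrow> u \<le> v"
    and x: "mono_on {..<n} x" and "a \<le> b" "b \<le> n"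
  obtains j where "a \<le> j" "j \<le> b"
    "\<And>i. a \<le> i \<Longrightarrow> i < j \<Longrightarrow> sq_dist (insert v S) (x i) = sq_dist S (x i)"
    "\<And>i. j \<le> i \<Longrightarrow> i < b \<Longrightarrow> sq_dist (insert v S) (x i) = (x i - v)\<^sup>2"
proof -
  define switched where "switched j \<longleftrightarrow> a \<le> j \<and> (j = b \<or> (x j - v)\<^sup>2 \<le> sq_dist S (x j))" for j
  define j where "j = (LEAST j. switched j)"
  have "switched b" using \<open>a \<le> b\<close> by (simp add: switched_def)
  then have "switched j" unfolding j_def by (rule LeastI)
  moreover from \<open>switched b\<close> have "j \<le> b" unfolding j_def by (rule Least_le)
  ultimately have j: "a \<le> j" "j \<le> b" "j = b \<or> (x j - v)\<^sup>2 \<le> sq_dist S (x j)"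
    by (auto simp: switched_def)
  have "sq_dist (insert v S) (x i) = sq_dist S (x i)" if "a \<le> i" "i < j" for i
  proof -
    have "\<not> switched i" using that(2) unfolding j_def by (rule not_less_Least)
    then have "sq_dist S (x i) < (x i - v)\<^sup>2" using that j by (simp add: switched_def)
    then show ?thesis using S by (simp add: sq_dist_insert)
  qed
  moreover have "sq_dist (insert v S) (x i) = (x i - v)\<^sup>2" if i: "j \<le> i" "i < b" for i
  proof -
    have "x j \<le> x i" using i \<open>b \<le> n\<close> by (intro mono_onD[OF x]) auto
    moreover have "(x j - v)\<^sup>2 \<le> sq_dist S (x j)" using j i by auto
    ultimately have "(x i - v)\<^sup>2 \<le> sq_dist S (x i)"
      using S by (auto simp: le_sq_dist_iff intro: closer_to_larger)
    then show ?thesis using S by (simp add: sq_dist_insert)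
  qed
  ultimately show ?thesis using that j by blast
qed

lemma opt_le_sum_sq_dist:
  assumes x: "mono_on {..<n} x"
  shows "finite S \<Longrightarrow> S \<noteq> {} \<Longrightarrow> card S \<le> Suc q \<Longrightarrow> a \<le> b \<Longrightarrow> b \<le> n \<Longrightarrow>
    opt x q a b \<le> (\<Sum>i=a..<b. sq_dist S (x i))"
proof (induction q arbitrary: S b)
  case 0
  then have "card S = 1" by (simp add: card_gt_0_iff le_Suc_eq)
  then obtain \<mu> where "S = {\<mu>}" by (auto simp: card_1_singleton_iff)
  then show ?case using sse_le_sq_dev[of x a b \<mu>] by (simp add: sq_dist_def sq_dev_def)
next
  case (Suc q)
  define v where "v = Max S"
  define S' where "S' = S - {v}"
  have "v \<in> S" and upper: "\<And>u. u \<in> S' \<Longrightarrow> u \<le> v"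
    using Suc.prems by (simp_all add: v_def S'_def)
  then have S: "S = insert v S'" "finite S'" "v \<notin> S'" using Suc.prems by (auto simp: S'_def)
  have card: "card S' \<le> Suc q" using S Suc.prems by simp
  show ?case
  proof (cases "S' = {}")
    case True
    have "opt x (Suc q) a b \<le> opt x q a a + sse x a b" using Suc.prems by (intro opt_Suc_le) auto
    also have "\<dots> \<le> (\<Sum>i=a..<b. (x i - v)\<^sup>2)" using sse_le_sq_dev[of x a b v] by (simp add: sq_dev_def)
    finally show ?thesis using S True by (simp add: sq_dist_def)
  next
    case False
    obtain j where j: "a \<le> j" "j \<le> b"
        and before: "\<And>i. a \<le> i \<Longrightarrow> i < j \<Longrightarrow> sq_dist S (x i) = sq_dist S' (x i)"
        and after: "\<And>i. j \<le> i \<Longrightarrow> i < b \<Longrightarrow> sq_dist S (x i) = (x i - v)\<^sup>2"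
      unfolding S(1) using sq_dist_insert_upper_split[OF S(2) False upper x Suc.prems(4,5)] by blast
    have "opt x (Suc q) a b \<le> opt x q a j + sse x j b" using j by (intro opt_Suc_le)
    also have "\<dots> \<le> (\<Sum>i=a..<j. sq_dist S' (x i)) + (\<Sum>i=j..<b. (x i - v)\<^sup>2)"
      using Suc.IH[OF S(2) False card j(1)] j Suc.prems sse_le_sq_dev[of x j b v]
      by (simp add: sq_dev_def)
    also have "\<dots> = (\<Sum>i=a..<j. sq_dist S (x i)) + (\<Sum>i=j..<b. sq_dist S (x i))"
      using before after by (intro arg_cong2[of _ _ _ _ "(+)"] sum.cong) auto
    also have "\<dots> = (\<Sum>i=a..<b. sq_dist S (x i))" using j by (intro sum.atLeastLessThan_concat)
    finally show ?thesis .
  qed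
qed

lemma kmeans_cost_eq: "kmeans_cost xs S = (\<Sum>i=0..<length xs. sq_dist S (xs ! i))"
  unfolding kmeans_cost_def sq_dist_def by (simp add: sum_list_sum_nth)

lemma opt_le_kmeans_cost:
  assumes "sorted xs" "1 \<le> length ms"
  shows "opt ((!) xs) (length ms - 1) 0 (length xs) \<le> kmeans_cost xs (set ms)"
  unfolding kmeans_cost_eq
proof (rule opt_le_sum_sq_dist)
  show "mono_on {..<length xs} ((!) xs)"
    using assms(1) by (auto intro!: mono_onI sorted_nth_mono)
  show "card (set ms) \<le> Suc (length ms - 1)" using card_length[of ms] assms(2) by simp
  show "set ms \<noteq> {}" using assms(2) by auto
qed auto

lemma kmeans_cost_self: "kmeans_cost xs (set xs) \<le> 0"
proof -
  have "sq_dist (set xs) (xs ! i) \<le> 0" if "i < length xs" for i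
    using sq_dist_le[of "set xs" "xs ! i" "xs ! i"] that by simp
  then show ?thesis unfolding kmeans_cost_eq by (intro sum_nonpos) auto
qed

lemma optimal_kmeans_padded:
  assumes xs: "sorted xs" "1 \<le> length xs" and k: "1 \<le> k"
  defines "l \<equiv> min k (length xs)"
  assumes ms: "length ms = l" "kmeans_cost xs (set ms) \<le> opt ((!) xs) (l - 1) 0 (length xs)"
  shows "optimal_kmeans xs k (ms @ replicate (k - l) c)"
  unfolding optimal_kmeans_def
proof (intro conjI allI impI)
  let ?ms = "ms @ replicate (k - l) c"
  show "length ?ms = k" using ms(1) by (simp add: l_def)
  fix ms' :: "real list" assume ms': "length ms' = k"
  have "ms \<noteq> []" using ms(1) xs(2) k by (auto simp: l_def)
  then have "kmeans_cost xs (set ?ms) \<le> kmeans_cost xs (set ms)"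
    unfolding kmeans_cost_eq by (intro sum_mono sq_dist_antimono) auto
  also have "\<dots> \<le> opt ((!) xs) (l - 1) 0 (length xs)" by (rule ms(2))
  also have "\<dots> \<le> kmeans_cost xs (set ms')"
  proof (cases "k \<le> length xs")
    case True
    then show ?thesis using opt_le_kmeans_cost[of xs ms'] xs k ms' by (simp add: l_def)
  next
    case False
    then have "opt ((!) xs) (l - 1) 0 (length xs) \<le> 0"
      using order_trans[OF opt_le_kmeans_cost[OF xs] kmeans_cost_self] by (simp add: l_def)
    also have "0 \<le> kmeans_cost xs (set ms')"
      unfolding kmeans_cost_eq using ms' k by (intro sum_nonneg sq_dist_nonneg) auto
    finally show ?thesis .
  qed
  finally show "kmeans_cost xs (set ?ms) \<le> kmeans_cost xs (set ms')" .
qed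

section \<open>Row minima of totally monotone matrices\<close>

locale totally_monotone =
  fixes A :: "nat \<Rightarrow> nat \<Rightarrow> 'a :: linorder" and N :: nat
  assumes right_wins_below:
      "r \<le> r' \<Longrightarrow> r' \<le> N \<Longrightarrow> c \<le> c' \<Longrightarrow> A r c' \<le> A r c \<Longrightarrow> A r' c' \<le> A r' c"
    and left_wins_above:
      "r \<le> r' \<Longrightarrow> r' \<le> N \<Longrightarrow> c \<le> c' \<Longrightarrow> A r' c \<le> A r' c' \<Longrightarrow> A r c \<le> A r c'"
    and first_row: "A 0 0 \<le> A 0 c"
begin

definition rows :: "nat \<Rightarrow> nat set" where
  "rows \<sigma> = {r. r \<le> N \<and> \<sigma> dvd r}"

definition covers :: "nat \<Rightarrow> nat set \<Rightarrow> nat set \<Rightarrow> bool" where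
  "covers \<sigma> S C \<longleftrightarrow> (\<forall>c\<in>C. \<forall>r\<in>rows \<sigma>. \<exists>s\<in>S. A r s \<le> A r c)"

lemma rows_double: "rows (2 * \<sigma>) \<subseteq> rows \<sigma>"
  by (auto simp: rows_def)

lemma covers_rows_mono: "covers \<sigma> S C \<Longrightarrow> rows \<sigma>' \<subseteq> rows \<sigma> \<Longrightarrow> covers \<sigma>' S C"
  unfolding covers_def by blast

lemma covers_superset: "S \<subseteq> T \<Longrightarrow> covers \<sigma> S C \<Longrightarrow> covers \<sigma> T C"
  unfolding covers_def by blast

lemma covers_refl: "C \<subseteq> S \<Longrightarrow> covers \<sigma> S C"
  unfolding covers_def by blast

lemma covers_insert: "covers \<sigma> S (insert c C) \<longleftrightarrow> covers \<sigma> S {c} \<and> covers \<sigma> S C"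
  unfolding covers_def by blast

lemma covers_trans: "covers \<sigma> T S \<Longrightarrow> covers \<sigma> S C \<Longrightarrow> covers \<sigma> T C"
  unfolding covers_def by (meson order_trans)

subsection \<open>Reduction of the columns\<close>

definition top_row :: "nat \<Rightarrow> nat list \<Rightarrow> nat" where
  "top_row \<sigma> st = (length st - 1) * \<sigma>"

definition reduction_stack :: "nat \<Rightarrow> nat list \<Rightarrow> bool" where
  "reduction_stack \<sigma> st \<longleftrightarrow> st \<noteq> [] \<and> hd st = 0 \<and> sorted_wrt (<) st \<and> top_row \<sigma> st \<le> N \<and>
    (\<forall>t. Suc t < length st \<longrightarrow> A (t * \<sigma>) (st ! t) \<le> A (t * \<sigma>) (st ! Suc t))"

definition candidate :: "nat \<Rightarrow> nat set \<Rightarrow> nat list \<Rightarrow> nat \<Rightarrow> bool" where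
  "candidate \<sigma> C st c \<longleftrightarrow> reduction_stack \<sigma> st \<and> covers \<sigma> (insert c (set st)) C \<and> (\<forall>s\<in>set st. s < c)"

lemma reduction_stack_Nil [simp]: "\<not> reduction_stack \<sigma> []"
  by (simp add: reduction_stack_def)

lemma reduction_stack_snoc:
  "reduction_stack \<sigma> (st @ [s]) \<longleftrightarrow> (if st = [] then s = 0 else
     reduction_stack \<sigma> st \<and> (\<forall>t\<in>set st. t < s) \<and> length st * \<sigma> \<le> N \<and>
     A (top_row \<sigma> st) (last st) \<le> A (top_row \<sigma> st) s)"
proof (cases "st = []")
  case True
  then show ?thesis by (auto simp: reduction_stack_def top_row_def)
next
  case False
  then obtain h where h: "length st = Suc h" by (cases st) auto
  have "(\<forall>t. Suc t < length (st @ [s]) \<longrightarrow> A (t * \<sigma>) ((st @ [s]) ! t) \<le> A (t * \<sigma>) ((st @ [s]) ! Suc t)) \<longleftrightarrow>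
      (\<forall>t. Suc t < length st \<longrightarrow> A (t * \<sigma>) (st ! t) \<le> A (t * \<sigma>) (st ! Suc t)) \<and>
      A (h * \<sigma>) (last st) \<le> A (h * \<sigma>) s"
    using False h by (auto simp: nth_append less_Suc_eq last_conv_nth)
  then show ?thesis
    using False h by (auto simp: reduction_stack_def top_row_def sorted_wrt_append)
qed

text \<open>The popped column is beaten by \<open>c\<close> from its own row on and by the column below it on the stack in the
  rows before. Column 0 is never popped, since it is optimal in row 0.\<close>

lemma candidate_pop:
  assumes cand: "candidate \<sigma> C (st @ [s]) c"
    and less: "A (length st * \<sigma>) c < A (length st * \<sigma>) s"
  shows "st \<noteq> []" "candidate \<sigma> C st c"
proof -
  have stack: "reduction_stack \<sigma> (st @ [s])" and cov: "covers \<sigma> (insert c (set (st @ [s]))) C"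
      and "s < c" and smaller: "\<forall>t\<in>set st. t < c"
    using cand by (auto simp: candidate_def)
  show "st \<noteq> []"
  proof
    assume "st = []"
    then have "s = 0" using stack[unfolded reduction_stack_snoc] by simp
    then show False using less first_row[of c] \<open>st = []\<close> by simp
  qed
  with stack have st: "reduction_stack \<sigma> st" "\<forall>t\<in>set st. t < s" "length st * \<sigma> \<le> N"
      and beaten: "A (top_row \<sigma> st) (last st) \<le> A (top_row \<sigma> st) s"
    by (auto simp: reduction_stack_snoc)
  have "\<exists>t\<in>insert c (set st). A r t \<le> A r s" if r: "r \<in> rows \<sigma>" for r
  proof (cases "length st * \<sigma> \<le> r")
    case True
    then have "A r c \<le> A r s"
      using r less \<open>s < c\<close> by (intro right_wins_below[of "length st * \<sigma>" r s c]) (auto simp: rows_def)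
    then show ?thesis by blast
  next
    case False
    obtain u where u: "r = u * \<sigma>" using r by (auto simp: rows_def dvd_def mult.commute)
    then have "u < length st" using False by (meson mult_le_mono1 not_le)
    then have "r \<le> top_row \<sigma> st" unfolding u top_row_def by (intro mult_right_mono) auto
    moreover have "last st \<in> set st" using \<open>st \<noteq> []\<close> by simp
    ultimately show ?thesis
      using st left_wins_above[OF _ _ _ beaten, of r] by (auto simp: reduction_stack_def less_imp_le)
  qed
  then have "covers \<sigma> (insert c (set st)) {s}" by (simp add: covers_def)
  then have "covers \<sigma> (insert c (set st)) (insert c (set (st @ [s])))"
    unfolding covers_def by auto
  then show "candidate \<sigma> C st c"
    using st(1) smaller cov unfolding candidate_def by (blast intro: covers_trans)
qed

lemma candidate_push:
  assumes "candidate \<sigma> C st c" "A (top_row \<sigma> st) (last st) \<le> A (top_row \<sigma> st) c" "length st * \<sigma> \<le> N"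
  shows "reduction_stack \<sigma> (st @ [c])" "covers \<sigma> (set (st @ [c])) (insert c C)"
  using assms by (cases "st = []"; auto simp: candidate_def reduction_stack_snoc covers_def)+

lemma candidate_skip:
  assumes cand: "candidate \<sigma> C st c"
    and worse: "A (top_row \<sigma> st) (last st) \<le> A (top_row \<sigma> st) c" and full: "N < length st * \<sigma>"
  shows "covers \<sigma> (set st) (insert c C)"
proof -
  have st: "st \<noteq> []" "top_row \<sigma> st \<le> N" "last st < c" and cov: "covers \<sigma> (insert c (set st)) C"
    using cand by (auto simp: candidate_def reduction_stack_def)
  have "A r (last st) \<le> A r c" if r: "r \<in> rows \<sigma>" for r
  proof -
    obtain u where u: "r = u * \<sigma>" "r \<le> N" using r by (auto simp: rows_def dvd_def mult.commute)
    then have "u < length st" using full by (meson le_less_trans mult_less_cancel2)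
    then have "r \<le> top_row \<sigma> st" unfolding u(1) top_row_def by (intro mult_right_mono) auto
    then show ?thesis using left_wins_above[OF _ st(2) _ worse] st(3) by simp
  qed
  then have c: "covers \<sigma> (set st) {c}" using st(1) unfolding covers_def by (auto intro!: bexI[of _ "last st"])
  moreover have "covers \<sigma> (set st) (set st)" by (rule covers_refl) simp
  ultimately have "covers \<sigma> (set st) (insert c (set st))" by (simp add: covers_insert[of _ _ c "set st"])
  then have "covers \<sigma> (set st) C" using cov by (rule covers_trans)
  with c show ?thesis by (simp add: covers_insert[of _ _ c C])
qed

definition sufficient :: "nat \<Rightarrow> nat list \<Rightarrow> bool" where
  "sufficient \<sigma> cs \<longleftrightarrow> cs \<noteq> [] \<and> hd cs = 0 \<and> sorted_wrt (<) cs \<and> set cs \<subseteq> {..N} \<and> covers \<sigma> (set cs) {..N}"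

lemma sufficient_all: "sufficient \<sigma> [0..<N + 1]"
  by (auto simp: sufficient_def hd_upt intro!: covers_refl simp del: upt_Suc)

lemma sufficient_double: "sufficient \<sigma> cs \<Longrightarrow> sufficient (2 * \<sigma>) cs"
  unfolding sufficient_def using covers_rows_mono rows_double by blast

lemma sufficient_reduction_stack:
  assumes "sufficient \<sigma> cs" "reduction_stack \<sigma> st" "set st \<subseteq> set cs" "covers \<sigma> (set st) (set cs)"
  shows "sufficient \<sigma> st"
  using assms unfolding sufficient_def reduction_stack_def by (blast intro: covers_trans)

subsection \<open>Interpolation of the rows\<close>

definition row_min :: "nat \<Rightarrow> nat \<Rightarrow> bool" where
  "row_min r t \<longleftrightarrow> t \<le> N \<and> (\<forall>c\<le>N. A r t \<le> A r c)"

definition upper_limit :: "nat list \<Rightarrow> nat \<Rightarrow> nat \<Rightarrow> bool" where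
  "upper_limit cs r t \<longleftrightarrow> (if r \<le> N then row_min r t \<and> t \<in> set cs else t = N)"

definition range_min :: "nat list \<Rightarrow> nat \<Rightarrow> nat \<Rightarrow> nat \<Rightarrow> nat \<Rightarrow> bool" where
  "range_min cs r l u b \<longleftrightarrow> b \<in> set cs \<and> l \<le> b \<and> b \<le> u \<and>
    (\<forall>s\<in>set cs. l \<le> s \<longrightarrow> s \<le> u \<longrightarrow> A r b \<le> A r s)"

lemma row_min_between:
  assumes cs: "sufficient \<sigma> cs" and r: "r1 \<le> r" "r \<le> r2" "r \<in> rows \<sigma>"
    and lower: "row_min r1 t1" "t1 \<in> set cs" and upper: "upper_limit cs r2 t2"
    and b: "range_min cs r t1 t2 b"
  shows "row_min r b"
proof -
  have rN: "r \<le> N" and csN: "set cs \<subseteq> {..N}" and cov: "covers \<sigma> (set cs) {..N}"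
    using r(3) cs by (auto simp: rows_def sufficient_def)
  have "t1 \<le> t2" "b \<in> set cs" and between: "\<And>s. s \<in> set cs \<Longrightarrow> t1 \<le> s \<Longrightarrow> s \<le> t2 \<Longrightarrow> A r b \<le> A r s"
    using b by (auto simp: range_min_def)
  have best: "A r b \<le> A r s" if s: "s \<in> set cs" for s
  proof -
    consider "s < t1" | "t1 \<le> s" "s \<le> t2" | "t2 < s" using \<open>t1 \<le> t2\<close> by linarith
    then show ?thesis
    proof cases
      case 1
      have "A r1 t1 \<le> A r1 s" using lower(1) s csN by (auto simp: row_min_def)
      then have "A r t1 \<le> A r s" using 1 r(1) rN by (intro right_wins_below[of r1 r s t1]) auto
      then show ?thesis using between[OF lower(2)] \<open>t1 \<le> t2\<close> by simp
    next
      case 2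
      then show ?thesis using between[OF s] by simp
    next
      case 3
      then have "r2 \<le> N" using upper s csN by (auto simp: upper_limit_def split: if_splits)
      then have t2: "row_min r2 t2" "t2 \<in> set cs" using upper by (auto simp: upper_limit_def)
      then have "A r2 t2 \<le> A r2 s" using s csN by (auto simp: row_min_def)
      then have "A r t2 \<le> A r s" using 3 r(2) \<open>r2 \<le> N\<close> by (intro left_wins_above[of r r2 t2 s]) auto
      then show ?thesis using between[OF t2(2)] \<open>t1 \<le> t2\<close> by simp
    qed
  qed
  have "A r b \<le> A r c" if c: "c \<le> N" for c
  proof -
    obtain s where s: "s \<in> set cs" "A r s \<le> A r c" using cov c r(3) unfolding covers_def by blast
    then show ?thesis using best[OF s(1)] by simp
  qed
  then show ?thesis using \<open>b \<in> set cs\<close> csN by (auto simp: row_min_def)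
qed

definition row_mins :: "nat set \<Rightarrow> nat list \<Rightarrow> (nat \<Rightarrow> nat) \<Rightarrow> bool" where
  "row_mins S cs t \<longleftrightarrow> t 0 = 0 \<and> (\<forall>r\<in>S. row_min r (t r) \<and> t r \<in> set cs) \<and> mono_on S t"

lemma row_minsD:
  assumes "row_mins S cs t" "r \<in> S"
  shows "row_min r (t r)" "t r \<in> set cs"
  using assms by (auto simp: row_mins_def)

lemma row_mins_columns_mono: "row_mins S cs t \<Longrightarrow> set cs \<subseteq> set ds \<Longrightarrow> row_mins S ds t"
  unfolding row_mins_def by blast

lemma row_mins_insert:
  assumes "row_mins S cs t" "0 < r" "row_min r b" "b \<in> set cs"
    and "\<And>s. s \<in> S \<Longrightarrow> s < r \<Longrightarrow> t s \<le> b" "\<And>s. s \<in> S \<Longrightarrow> r < s \<Longrightarrow> b \<le> t s"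
  shows "row_mins (insert r S) cs (t(r := b))"
  unfolding row_mins_def
proof (intro conjI)
  show "(t(r := b)) 0 = 0" using assms(1,2) by (simp add: row_mins_def)
  show "\<forall>s\<in>insert r S. row_min s ((t(r := b)) s) \<and> (t(r := b)) s \<in> set cs"
    using assms(1,3,4) by (auto simp: row_mins_def)
  show "mono_on (insert r S) (t(r := b))"
  proof (rule mono_onI)
    fix s s' assume "s \<in> insert r S" "s' \<in> insert r S" "s \<le> s'"
    moreover have "mono_on S t" using assms(1) by (simp add: row_mins_def)
    ultimately show "(t(r := b)) s \<le> (t(r := b)) s'"
      using assms(5,6) by (auto dest: mono_onD)
  qed
qed

definition solved_rows :: "nat \<Rightarrow> nat \<Rightarrow> nat set" where
  "solved_rows \<sigma> k = rows (2 * \<sigma>) \<union> {r \<in> rows \<sigma>. r < k}"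

lemma solved_rows_start [simp]: "solved_rows \<sigma> \<sigma> = rows (2 * \<sigma>)"
  by (auto simp: solved_rows_def rows_def dest: dvd_imp_le)

lemma solved_rows_end: "N < k \<Longrightarrow> solved_rows \<sigma> k = rows \<sigma>"
  using rows_double by (auto simp: solved_rows_def rows_def)

lemma solved_rows_neighbours:
  assumes "s \<in> solved_rows \<sigma> k" "k = Suc (2 * u) * \<sigma>"
  shows "s < k \<Longrightarrow> s \<le> 2 * u * \<sigma>" "k \<le> s \<Longrightarrow> Suc (Suc (2 * u)) * \<sigma> \<le> s"
proof -
  obtain v where v: "s = v * \<sigma>" "even v \<or> s < k"
  proof -
    have "2 * \<sigma> dvd s \<or> \<sigma> dvd s \<and> s < k" using assms(1) by (auto simp: solved_rows_def rows_def)
    then show ?thesis using that[of "s div \<sigma>"] that[of "2 * (s div (2 * \<sigma>))"] by (auto elim!: dvdE)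
  qed
  show "s \<le> 2 * u * \<sigma>" if "s < k"
  proof -
    have "v < Suc (2 * u)" using that unfolding assms(2) v(1) mult_less_cancel2 by blast
    then show ?thesis unfolding v(1) by (intro mult_right_mono) auto
  qed
  show "Suc (Suc (2 * u)) * \<sigma> \<le> s" if "k \<le> s"
  proof -
    have "even v" using that v(2) by simp
    moreover have "Suc (2 * u) \<le> v \<or> \<sigma> = 0" using that unfolding assms(2) v(1) mult_le_cancel2 by blast
    ultimately have "Suc (Suc (2 * u)) \<le> v \<or> \<sigma> = 0" by (cases "v = Suc (2 * u)") auto
    then show ?thesis unfolding v(1) by (auto intro!: mult_right_mono simp del: mult_Suc)
  qed
qed

lemma solved_rows_step:
  assumes "k = Suc (2 * u) * \<sigma>" "k \<le> N"
  shows "solved_rows \<sigma> (k + 2 * \<sigma>) = insert k (solved_rows \<sigma> k)"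
proof (intro equalityI subsetI)
  fix s assume s: "s \<in> solved_rows \<sigma> (k + 2 * \<sigma>)"
  show "s \<in> insert k (solved_rows \<sigma> k)"
  proof (cases "s \<in> rows (2 * \<sigma>)")
    case False
    then obtain v where v: "s = v * \<sigma>" "odd v" "s < k + 2 * \<sigma>" "s \<le> N"
      using s by (auto simp: solved_rows_def rows_def dvd_def mult.commute)
    then have "v * \<sigma> < Suc (Suc (Suc (2 * u))) * \<sigma>" using assms(1) by simp
    then have "v < Suc (Suc (Suc (2 * u)))" unfolding mult_less_cancel2 by blast
    then have "v \<le> Suc (2 * u)" using v(2) by (cases "v = Suc (Suc (2 * u))") auto
    then have "s \<le> k" unfolding assms(1) v(1) by (intro mult_right_mono) auto
    then show ?thesis using v by (auto simp: solved_rows_def rows_def)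
  qed (simp add: solved_rows_def)
next
  fix s assume "s \<in> insert k (solved_rows \<sigma> k)"
  then show "s \<in> solved_rows \<sigma> (k + 2 * \<sigma>)"
    using assms by (cases "\<sigma> = 0") (auto simp: solved_rows_def rows_def)
qed

end

definition last_upto :: "nat list \<Rightarrow> nat \<Rightarrow> nat \<Rightarrow> bool" where
  "last_upto cs u p \<longleftrightarrow> p < length cs \<and> cs ! p \<le> u \<and> (\<forall>s\<in>set cs. s \<le> u \<longrightarrow> s \<le> cs ! p)"

lemma sorted_wrt_less_nth_le_iff:
  fixes cs :: "nat list"
  assumes "sorted_wrt (<) cs" "i < length cs" "j < length cs"
  shows "cs ! i \<le> cs ! j \<longleftrightarrow> i \<le> j"
  using assms sorted_wrt_nth_less[of "(<)" cs i j] sorted_wrt_nth_less[of "(<)" cs j i]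
  by (cases i j rule: linorder_cases) auto

section \<open>Registers, memory and evaluation of costs\<close>

lemma address_of_nat [simp]: "address m (real i) = (if i < m then Some i else None)"
  by (simp add: address_def)

lemma address_sum [simp]:
  "address m 0 = (if 0 < m then Some 0 else None)"
  "address m (real i + 1) = (if Suc i < m then Some (Suc i) else None)"
  "address m (1 + real i) = (if Suc i < m then Some (Suc i) else None)"
  "address m (real i + real j) = (if i + j < m then Some (i + j) else None)"
  "address m (real i + real j + 1) = (if Suc (i + j) < m then Some (Suc (i + j)) else None)"
  "address m (1 + (real i + real j)) = (if Suc (i + j) < m then Some (Suc (i + j)) else None)"
  "address m (real i + real j + real k) = (if i + j + k < m then Some (i + j + k) else None)"
  "address m (real i + real j + 1 + real k) = (if Suc (i + j + k) < m then Some (Suc (i + j + k)) else None)"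
  using address_of_nat[of m 0] address_of_nat[of m "Suc i"] address_of_nat[of m "i + j"]
    address_of_nat[of m "Suc (i + j)"] address_of_nat[of m "i + j + k"] address_of_nat[of m "Suc (i + j + k)"]
  by (simp_all add: add_ac)

abbreviation agree_on :: "nat set \<Rightarrow> (nat \<Rightarrow> real) \<Rightarrow> (nat \<Rightarrow> real) \<Rightarrow> bool" where
  "agree_on S g h \<equiv> \<forall>i\<in>S. h i = g i"

definition stored :: "(nat \<Rightarrow> real) \<Rightarrow> nat \<Rightarrow> nat list \<Rightarrow> bool" where
  "stored M b cs \<longleftrightarrow> (\<forall>i<length cs. M (b + i) = real (cs ! i))"

lemma stored_nth: "stored M b cs \<Longrightarrow> i < length cs \<Longrightarrow> M (b + i) = real (cs ! i)"
  by (simp add: stored_def)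

lemma stored_prefix: "stored M b cs \<Longrightarrow> prefix ds cs \<Longrightarrow> stored M b ds"
  by (auto simp: stored_def prefix_def nth_append)

lemma stored_snoc: "stored M b (cs @ [c]) \<longleftrightarrow> stored M b cs \<and> M (b + length cs) = real c"
  by (auto simp: stored_def nth_append less_Suc_eq)

lemma stored_agree: "stored M b cs \<Longrightarrow> agree_on {b..<b + length cs} M M' \<Longrightarrow> stored M' b cs"
  by (auto simp: stored_def)

text \<open>
  Code that runs inside a loop only writes registers with higher numbers than those of the loop, so that
  \<^term>\<open>agree_on {..<r} R R'\<close> is the usual frame condition. Registers below 10 are constants, those
  below 22 describe the current piece, those below 30 the current split, and those below 40 the current
  stride of the search for row minima; registers from 50 on are used to evaluate costs.
\<close>

abbreviation (input) r_n :: reg where "r_n \<equiv> 0"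
abbreviation (input) r_k :: reg where "r_k \<equiv> 1"
abbreviation (input) r_one :: reg where "r_one \<equiv> 2"
abbreviation (input) r_zero :: reg where "r_zero \<equiv> 3"
abbreviation (input) r_width :: reg where "r_width \<equiv> 4"
abbreviation (input) r_squares :: reg where "r_squares \<equiv> 5"
abbreviation (input) r_layer :: reg where "r_layer \<equiv> 6"
abbreviation (input) r_cross :: reg where "r_cross \<equiv> 7"
abbreviation (input) r_minima :: reg where "r_minima \<equiv> 8"
abbreviation (input) r_columns :: reg where "r_columns \<equiv> 9"
abbreviation (input) r_sp :: reg where "r_sp \<equiv> 10"
abbreviation (input) r_stack :: reg where "r_stack \<equiv> 11"
abbreviation (input) r_used :: reg where "r_used \<equiv> 12"
abbreviation (input) r_start :: reg where "r_start \<equiv> 15"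
abbreviation (input) r_clusters :: reg where "r_clusters \<equiv> 16"
abbreviation (input) r_end :: reg where "r_end \<equiv> 17"
abbreviation (input) r_len :: reg where "r_len \<equiv> 18"
abbreviation (input) r_len1 :: reg where "r_len1 \<equiv> 19"
abbreviation (input) r_sums_at :: reg where "r_sums_at \<equiv> 20"
abbreviation (input) r_squares_at :: reg where "r_squares_at \<equiv> 21"
abbreviation (input) r_half :: reg where "r_half \<equiv> 22"
abbreviation (input) r_count :: reg where "r_count \<equiv> 23"
abbreviation (input) r_last :: reg where "r_last \<equiv> 24"
abbreviation (input) r_cut :: reg where "r_cut \<equiv> 25"
abbreviation (input) r_gap2 :: reg where "r_gap2 \<equiv> 30"
abbreviation (input) r_gap :: reg where "r_gap \<equiv> 31"
abbreviation (input) r_lo :: reg where "r_lo \<equiv> 32"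
abbreviation (input) r_hi :: reg where "r_hi \<equiv> 33"
abbreviation (input) r_ptr :: reg where "r_ptr \<equiv> 40"
abbreviation (input) r_top :: reg where "r_top \<equiv> 41"
abbreviation (input) r_top_row :: reg where "r_top_row \<equiv> 42"
abbreviation (input) r_col :: reg where "r_col \<equiv> 43"
abbreviation (input) r_row :: reg where "r_row \<equiv> 44"
abbreviation (input) r_limit :: reg where "r_limit \<equiv> 45"
abbreviation (input) r_best :: reg where "r_best \<equiv> 46"
abbreviation (input) r_best_val :: reg where "r_best_val \<equiv> 47"
abbreviation (input) r_tmp :: reg where "r_tmp \<equiv> 48"
abbreviation (input) r_tmp' :: reg where "r_tmp' \<equiv> 49"
abbreviation (input) r_val :: reg where "r_val \<equiv> 50"
abbreviation (input) r_eval1 :: reg where "r_eval1 \<equiv> 51"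
abbreviation (input) r_eval2 :: reg where "r_eval2 \<equiv> 52"
abbreviation (input) r_eval3 :: reg where "r_eval3 \<equiv> 53"

definition sse_code :: "reg \<Rightarrow> reg \<Rightarrow> com" where
  "sse_code r c = Cond r c
     (Block [Const r_val 0])
     (Block
       [Add r_eval1 r_sums_at r, Load r_eval1 r_eval1,
        Add r_eval2 r_sums_at c, Load r_eval2 r_eval2,
        Sub r_eval1 r_eval1 r_eval2, Mul r_eval1 r_eval1 r_eval1,
        Sub r_eval2 r c, Div r_eval1 r_eval1 r_eval2,
        Add r_eval2 r_squares_at r, Load r_eval2 r_eval2,
        Add r_eval3 r_squares_at c, Load r_eval3 r_eval3,
        Sub r_eval2 r_eval2 r_eval3, Sub r_val r_eval2 r_eval1])"

definition cost_code :: "reg \<Rightarrow> reg \<Rightarrow> com" where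
  "cost_code r c = sse_code r c ;;
    Block [Add r_eval1 r_layer c, Load r_eval1 r_eval1, Add r_val r_eval1 r_val]"

definition prefix_sum :: "(nat \<Rightarrow> real) \<Rightarrow> nat \<Rightarrow> real" where
  "prefix_sum x j = (\<Sum>i<j. x i)"

lemma prefix_sum_0 [simp]: "prefix_sum x 0 = 0"
  and prefix_sum_Suc: "prefix_sum x (Suc i) = prefix_sum x i + x i"
  by (simp_all add: prefix_sum_def)

lemma prefix_sum_diff: "a \<le> b \<Longrightarrow> prefix_sum x b - prefix_sum x a = (\<Sum>i=a..<b. x i)"
  unfolding prefix_sum_def by (simp add: lessThan_atLeast0 sum_diff_nat_ivl)

lemma sse_prefix_sum:
  assumes "a < b"
  shows "sse x a b = prefix_sum (\<lambda>i. (x i)\<^sup>2) b - prefix_sum (\<lambda>i. (x i)\<^sup>2) a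
    - (prefix_sum x b - prefix_sum x a)\<^sup>2 / (real b - real a)"
  using assms by (simp add: sse_eq prefix_sum_diff)

locale sorted_points =
  fixes x :: "nat \<Rightarrow> real" and n :: nat
  assumes sorted: "mono_on {..<n} x"
begin

text \<open>
  The points are followed by their prefix sums (from \<open>width\<close> on), the prefix sums of their squares, the
  current layer of the dynamic program, the crossings, the row minima, the stack of pending pieces
  (cluster numbers, then ends) and the column lists.
\<close>

definition width :: nat where "width = n + 1"
definition squares_base :: nat where "squares_base = 2 * width"
definition layer_base :: nat where "layer_base = 3 * width"
definition cross_base :: nat where "cross_base = 4 * width"
definition minima_base :: nat where "minima_base = 5 * width"
definition stack_base :: nat where "stack_base = 6 * width"
definition columns_base :: nat where "columns_base = 8 * width"
definition cells :: nat where "cells = 13 * width"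

lemmas layout_defs = width_def squares_base_def layer_base_def cross_base_def minima_base_def
  stack_base_def columns_base_def cells_def

lemma layout: "n < width" "width + width \<le> squares_base" "squares_base + width \<le> layer_base"
    "layer_base + width \<le> cross_base" "cross_base + width \<le> minima_base"
    "minima_base + width \<le> stack_base" "stack_base + 2 * width \<le> columns_base"
    "columns_base + 5 * width \<le> cells"
  by (simp_all add: layout_defs)

definition globals :: "(reg \<Rightarrow> real) \<Rightarrow> (nat \<Rightarrow> real) \<Rightarrow> bool" where
  "globals R M \<longleftrightarrow> R r_n = real n \<and> R r_one = 1 \<and> R r_zero = 0 \<and> R r_width = real width \<and>
    R r_squares = real squares_base \<and> R r_layer = real layer_base \<and> R r_cross = real cross_base \<and>
    R r_minima = real minima_base \<and> R r_columns = real columns_base \<and>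
    (\<forall>j<n. M j = x j) \<and> (\<forall>j\<le>n. M (width + j) = prefix_sum x j) \<and>
    (\<forall>j\<le>n. M (squares_base + j) = prefix_sum (\<lambda>i. (x i)\<^sup>2) j)"

definition piece :: "nat \<Rightarrow> nat \<Rightarrow> (reg \<Rightarrow> real) \<Rightarrow> bool" where
  "piece a N R \<longleftrightarrow> a + N \<le> n \<and> R r_len = real N \<and> R r_len1 = real N + 1 \<and>
    R r_sums_at = real width + real a \<and> R r_squares_at = real squares_base + real a"

definition layer_stored :: "nat \<Rightarrow> nat \<Rightarrow> nat \<Rightarrow> (nat \<Rightarrow> real) \<Rightarrow> bool" where
  "layer_stored q a N M \<longleftrightarrow> (\<forall>j\<le>N. M (layer_base + j) = opt x q a (a + j))"

abbreviation persistent :: "nat set" where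
  "persistent \<equiv> {..<layer_base} \<union> {stack_base..<columns_base}"

lemma globals_agree:
  assumes "globals R M" "agree_on {..<10} R R'" "agree_on {..<layer_base} M M'"
  shows "globals R' M'"
  using assms layout unfolding globals_def by auto

lemma piece_agree: "piece a N R \<Longrightarrow> agree_on {..<22} R R' \<Longrightarrow> piece a N R'"
  unfolding piece_def by auto

definition evaluates :: "com \<Rightarrow> real \<Rightarrow> nat \<Rightarrow> (reg \<Rightarrow> real) \<Rightarrow> (nat \<Rightarrow> real) \<Rightarrow> bool" where
  "evaluates c v T R M \<longleftrightarrow> (\<forall>Y f. wp cells c (\<lambda>R' M' Y' f'.
     M' = M \<and> Y' = Y \<and> agree_on {..<50} R R' \<and> R' r_val = v \<and> f - real T \<le> f') R M Y f)"

lemma wp_evaluates: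
  assumes "evaluates c v T R M"
    and "\<And>R' f'. agree_on {..<50} R R' \<Longrightarrow> R' r_val = v \<Longrightarrow> f - real T \<le> f' \<Longrightarrow> Q R' M Y f'"
  shows "wp cells c Q R M Y f"
  by (rule wp_mono[OF assms(1)[unfolded evaluates_def, rule_format]]) (simp add: assms(2))

lemma wp_evaluates_Seq:
  assumes "evaluates c v T R M"
    and "\<And>R' f'. agree_on {..<50} R R' \<Longrightarrow> R' r_val = v \<Longrightarrow> f - real T \<le> f' \<Longrightarrow> wp cells d Q R' M Y f'"
  shows "wp cells (c ;; d) Q R M Y f"
  by (rule wp_Seq[OF wp_evaluates[OF assms(1)]]) (auto intro: assms(2))

lemma evaluates_sse_code:
  assumes R: "globals R M" "piece a N R" "R i = real r" "R j = real c"
    and "r \<le> N" "c \<le> N" "i < 50" "j < 50"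
  shows "evaluates (sse_code i j) (sse x (a + c) (a + r)) 16 R M"
  unfolding evaluates_def
proof (intro allI, unfold sse_code_def, rule wp_Cond)
  fix Y f assume "R i \<le> R j"
  then show "wp cells (Block [Const r_val 0]) (\<lambda>R' M' Y' f'. M' = M \<and> Y' = Y \<and> agree_on {..<50} R R' \<and>
      R' r_val = sse x (a + c) (a + r) \<and> f - real 16 \<le> f') R M Y (f - 2)"
    using R(3,4) by (intro wp_Block) simp
next
  fix Y f assume "R j < R i"
  then have "c < r" using R(3,4) by simp
  have scratch: "i \<notin> {51, 52, 53}" "j \<notin> {51, 52, 53}" using assms(7,8) by auto
  have in_piece: "a + r \<le> n" "a + c \<le> n" using R(2) assms(5,6) by (auto simp: piece_def)
  have "width + a + r < cells" "width + a + c < cells" "squares_base + a + r < cells"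
      "squares_base + a + c < cells"
    using in_piece layout by linarith+
  moreover have "M (width + a + r) = prefix_sum x (a + r)" "M (width + a + c) = prefix_sum x (a + c)"
      "M (squares_base + a + r) = prefix_sum (\<lambda>i. (x i)\<^sup>2) (a + r)"
      "M (squares_base + a + c) = prefix_sum (\<lambda>i. (x i)\<^sup>2) (a + c)"
    using R(1) in_piece by (auto simp: globals_def add.assoc)
  ultimately show "wp cells (Block
       [Add r_eval1 r_sums_at i, Load r_eval1 r_eval1,
        Add r_eval2 r_sums_at j, Load r_eval2 r_eval2,
        Sub r_eval1 r_eval1 r_eval2, Mul r_eval1 r_eval1 r_eval1,
        Sub r_eval2 i j, Div r_eval1 r_eval1 r_eval2,
        Add r_eval2 r_squares_at i, Load r_eval2 r_eval2,
        Add r_eval3 r_squares_at j, Load r_eval3 r_eval3,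
        Sub r_eval2 r_eval2 r_eval3, Sub r_val r_eval2 r_eval1])
      (\<lambda>R' M' Y' f'. M' = M \<and> Y' = Y \<and> agree_on {..<50} R R' \<and>
        R' r_val = sse x (a + c) (a + r) \<and> f - real 16 \<le> f') R M Y (f - 2)"
    using \<open>c < r\<close> scratch R(2-4)
    by (intro wp_Block) (simp add: piece_def sse_prefix_sum power2_eq_square)
qed

lemma evaluates_cost_code:
  assumes R: "globals R M" "piece a N R" "R i = real r" "R j = real c"
    and rc: "r \<le> N" "c \<le> N" "i < 50" "j < 50" and layer: "M (layer_base + c) = opt x q a (a + c)"
  shows "evaluates (cost_code i j) (last_sep_cost x q a r c) 19 R M"
  unfolding evaluates_def
proof (intro allI, unfold cost_code_def, rule wp_evaluates_Seq[OF evaluates_sse_code[OF R rc]])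
  fix Y f R' f'
  assume R': "agree_on {..<50} R R'" "R' r_val = sse x (a + c) (a + r)" "f - real 16 \<le> f'"
  have "layer_base + c < cells" using R(2) rc layout by (simp add: piece_def)
  then show "wp cells (Block [Add r_eval1 r_layer j, Load r_eval1 r_eval1, Add r_val r_eval1 r_val])
      (\<lambda>R' M' Y' f'. M' = M \<and> Y' = Y \<and> agree_on {..<50} R R' \<and>
        R' r_val = last_sep_cost x q a r c \<and> f - real 19 \<le> f') R' M Y f'"
    using R R' rc layer by (intro wp_Block) (simp add: globals_def last_sep_cost_def)
qed

end

locale pieces = sorted_points +
  fixes q a N :: nat
  assumes piece_bound: "a + N \<le> n"
begin

abbreviation A :: "nat \<Rightarrow> nat \<Rightarrow> real" where
  "A \<equiv> last_sep_cost x q a"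

sublocale totally_monotone A N
proof
  fix r r' c c' :: nat
  assume "r \<le> r'" "r' \<le> N" "c \<le> c'"
  then have "A r c + A r' c' \<le> A r c' + A r' c"
    using last_sep_cost_monge[OF sorted, of r r' c c' a q] piece_bound by simp
  then show "A r c' \<le> A r c \<Longrightarrow> A r' c' \<le> A r' c" "A r' c \<le> A r' c' \<Longrightarrow> A r c \<le> A r c'"
    by linarith+
next
  show "A 0 0 \<le> A 0 c" for c by (simp add: last_sep_cost_def opt_nonneg)
qed

definition ready :: "(reg \<Rightarrow> real) \<Rightarrow> (nat \<Rightarrow> real) \<Rightarrow> bool" where
  "ready R M \<longleftrightarrow> globals R M \<and> piece a N R \<and> layer_stored q a N M"

lemma length_less_width: "N < width"
  using piece_bound layout(1) by simp

lemma ready_agree: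
  assumes "ready R M" "agree_on {..<22} R R'" "agree_on {..<cross_base} M M'"
  shows "ready R' M'"
proof -
  have "layer_base + j < cross_base" if "j \<le> N" for j
    using that length_less_width layout(4) by linarith
  then have "layer_stored q a N M'" using assms(1,3) by (auto simp: ready_def layer_stored_def)
  moreover have "agree_on {..<10} R R'" "agree_on {..<layer_base} M M'"
    using assms(2,3) layout(4) by auto
  ultimately show ?thesis
    using assms(1,2) globals_agree piece_agree unfolding ready_def by blast
qed

lemma ready_regs:
  assumes "ready R M"
  shows "R r_one = 1" "R r_zero = 0" "R r_cross = real cross_base" "R r_minima = real minima_base"
    "R r_layer = real layer_base" "R r_columns = real columns_base" "R r_len = real N" "R r_len1 = real N + 1"
  using assms by (simp_all add: ready_def globals_def piece_def)

lemma evaluates_cost_code_ready: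
  assumes "ready R M" "R i = real r" "R j = real c" "r \<le> N" "c \<le> N" "i < 50" "j < 50"
  shows "evaluates (cost_code i j) (A r c) 19 R M"
  using assms by (intro evaluates_cost_code) (auto simp: ready_def layer_stored_def)

end

section \<open>Reducing the columns\<close>

definition comparison_code :: com where
  "comparison_code =
    Block [Load r_tmp r_top] ;; cost_code r_top_row r_tmp ;;
    Block [Move r_best_val r_val] ;; cost_code r_top_row r_col"

definition pop_step_code :: com where
  "pop_step_code = Block [Sub r_top r_top r_one, Sub r_top_row r_top_row r_gap]"

definition pop_code :: com where
  "pop_code = Loop comparison_code r_best_val r_val pop_step_code"

definition push_code :: com where
  "push_code =
    Block [Add r_tmp r_top_row r_gap] ;;
    Cond r_tmp r_len
      (Block [Move r_top_row r_tmp, Add r_top r_top r_one, Store r_top r_col])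
      (Block [])"

definition absorb_code :: com where
  "absorb_code = pop_code ;; push_code"

definition reduce_step_code :: com where
  "reduce_step_code = Block [Load r_col r_ptr] ;; absorb_code ;; Block [Add r_ptr r_ptr r_one]"

definition reduce_finish_code :: com where
  "reduce_finish_code = Block [Move r_lo r_hi, Add r_hi r_top r_one, Add r_gap r_gap r_gap]"

definition reduce_code :: com where
  "reduce_code =
    Block [Move r_top r_hi, Store r_top r_zero, Const r_top_row 0, Add r_ptr r_lo r_one] ;;
    Until r_hi r_ptr reduce_step_code ;; reduce_finish_code"

context pieces begin

definition stack_regs :: "nat \<Rightarrow> nat \<Rightarrow> nat list \<Rightarrow> (reg \<Rightarrow> real) \<Rightarrow> bool" where
  "stack_regs b \<sigma> st R \<longleftrightarrow> st \<noteq> [] \<and> R r_top = real (b + (length st - 1)) \<and> R r_top_row = real (top_row \<sigma> st)"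

lemma wp_comparison:
  assumes "ready R M" and cand: "candidate \<sigma> C st c" "c \<le> N"
    and mem: "stored M b st" "b + length st \<le> cells"
    and R: "stack_regs b \<sigma> st R" "R r_col = real c"
  shows "wp cells comparison_code (\<lambda>R' M' Y' f'. M' = M \<and> Y' = Y \<and> agree_on {..<47} R R' \<and>
    R' r_best_val = A (top_row \<sigma> st) (last st) \<and> R' r_val = A (top_row \<sigma> st) c \<and> f - 40 \<le> f') R M Y f"
    (is "wp _ _ ?Q _ _ _ _")
proof -
  obtain st' s where st: "st = st' @ [s]" using R(1) by (cases st rule: rev_cases) (auto simp: stack_regs_def)
  define r where "r = top_row \<sigma> st"
  have bounds: "r \<le> N" "s \<le> N" using cand by (auto simp: candidate_def reduction_stack_def r_def st)
  define R1 where "R1 = R(r_tmp := real s)"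
  have "wp cells (cost_code r_top_row r_tmp ;; Block [Move r_best_val r_val] ;; cost_code r_top_row r_col)
      ?Q R1 M Y (f - 1)"
  proof (rule wp_evaluates_Seq)
    show "evaluates (cost_code r_top_row r_tmp) (A r s) 19 R1 M"
      using R bounds ready_agree[OF \<open>ready R M\<close>]
      by (intro evaluates_cost_code_ready) (auto simp: R1_def stack_regs_def r_def)
    fix R2 f2 assume R2: "agree_on {..<50} R1 R2" "R2 r_val = A r s" "f - 1 - real 19 \<le> f2"
    have "wp cells (cost_code r_top_row r_col) ?Q (R2(r_best_val := A r s)) M Y (f2 - 1)"
    proof (rule wp_evaluates)
      show "evaluates (cost_code r_top_row r_col) (A r c) 19 (R2(r_best_val := A r s)) M"
        using R R2 bounds cand(2) ready_agree[OF \<open>ready R M\<close>]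
        by (intro evaluates_cost_code_ready) (auto simp: R1_def stack_regs_def r_def)
    qed (use R2 R st in \<open>auto simp: R1_def r_def\<close>)
    then show "wp cells (Block [Move r_best_val r_val] ;; cost_code r_top_row r_col) ?Q R2 M Y f2"
      using R2(2) by (intro wp_Block_Seq) simp
  qed
  then show ?thesis unfolding comparison_code_def
    using R(1) mem st by (intro wp_Block_Seq) (simp add: R1_def stack_regs_def stored_snoc)
qed

definition pop_inv :: "nat \<Rightarrow> nat \<Rightarrow> nat set \<Rightarrow> nat \<Rightarrow> nat list \<Rightarrow> (reg \<Rightarrow> real) \<Rightarrow> real \<Rightarrow>
    nat list \<Rightarrow> (reg \<Rightarrow> real) \<Rightarrow> real \<Rightarrow> bool" where
  "pop_inv b \<sigma> C c st R f st' R' f' \<longleftrightarrow> agree_on {..<41} R R' \<and> R' r_col = real c \<and> prefix st' st \<and>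
    candidate \<sigma> C st' c \<and> stack_regs b \<sigma> st' R' \<and> f - 44 * (real (length st) - real (length st')) \<le> f'"

lemma wp_pop_comparison:
  assumes "ready R M" "c \<le> N" and mem: "stored M b st" "b + length st \<le> cells"
    and inv: "pop_inv b \<sigma> C c st R f st1 R1 f1"
  shows "wp cells comparison_code (\<lambda>R' M' Y' f'. M' = M \<and> Y' = Y \<and> pop_inv b \<sigma> C c st R f st1 R' (f' + 40) \<and>
    R' r_best_val = A (top_row \<sigma> st1) (last st1) \<and> R' r_val = A (top_row \<sigma> st1) c) R1 M Y f1"
proof -
  have "ready R1 M" by (rule ready_agree[OF \<open>ready R M\<close>]) (use inv in \<open>auto simp: pop_inv_def\<close>)
  moreover have "stored M b st1" "b + length st1 \<le> cells"
    using inv mem stored_prefix prefix_length_le[of st1 st] by (auto simp: pop_inv_def)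
  ultimately have "wp cells comparison_code (\<lambda>R' M' Y' f'. M' = M \<and> Y' = Y \<and> agree_on {..<47} R1 R' \<and>
      R' r_best_val = A (top_row \<sigma> st1) (last st1) \<and> R' r_val = A (top_row \<sigma> st1) c \<and> f1 - 40 \<le> f') R1 M Y f1"
    using inv \<open>c \<le> N\<close> by (intro wp_comparison) (auto simp: pop_inv_def)
  then show ?thesis by (rule wp_mono) (use inv in \<open>auto simp: pop_inv_def stack_regs_def\<close>)
qed

lemma wp_pop_step:
  assumes "ready R M" "R r_gap = real \<sigma>" and inv: "pop_inv b \<sigma> C c st R f st1 R1 (f1 + 40)"
    and less: "A (top_row \<sigma> st1) c < A (top_row \<sigma> st1) (last st1)"
  shows "wp cells pop_step_code (\<lambda>R' M' Y' f'. M' = M \<and> Y' = Y \<and> (\<exists>st'. pop_inv b \<sigma> C c st R f st' R' f'))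
    R1 M Y (f1 - 2)"
proof -
  obtain st' s where st': "st1 = st' @ [s]"
    using inv by (cases st1 rule: rev_cases) (auto simp: pop_inv_def stack_regs_def)
  have pop: "st' \<noteq> []" "candidate \<sigma> C st' c"
    using candidate_pop[of \<sigma> C st' s c] inv less by (auto simp: pop_inv_def st' top_row_def)
  then obtain h where "length st' = Suc h" by (cases st') auto
  then show ?thesis
    unfolding pop_step_code_def using inv pop assms(2) ready_regs[OF \<open>ready R M\<close>]
    by (intro wp_Block) (auto simp: pop_inv_def st' stack_regs_def top_row_def algebra_simps
      intro!: exI[of _ st'] dest: append_prefixD)
qed

lemma wp_pop:
  assumes "ready R M" and cand: "candidate \<sigma> C st c" "c \<le> N"
    and mem: "stored M b st" "b + length st \<le> cells"
    and R: "stack_regs b \<sigma> st R" "R r_col = real c" "R r_gap = real \<sigma>"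
  shows "wp cells pop_code (\<lambda>R' M' Y' f'. M' = M \<and> Y' = Y \<and> (\<exists>st'. pop_inv b \<sigma> C c st R f st' R' (f' + 41) \<and>
    A (top_row \<sigma> st') (last st') \<le> A (top_row \<sigma> st') c)) R M Y f"
    (is "wp _ _ ?Q _ _ _ _")
proof -
  define I where "I = (\<lambda>R' M' Y' f'. M' = M \<and> Y' = Y \<and> (\<exists>st'. pop_inv b \<sigma> C c st R f st' R' f'))"
  define J where "J = (\<lambda>R' M' Y' f'. M' = M \<and> Y' = Y \<and> (\<exists>st'. pop_inv b \<sigma> C c st R f st' R' (f' + 40) \<and>
    R' r_best_val = A (top_row \<sigma> st') (last st') \<and> R' r_val = A (top_row \<sigma> st') c))"
  show ?thesis unfolding pop_code_def
  proof (rule wp_Loop[where I = I and J = J and B = "f - 44 * real (length st)"])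
    show "I R M Y f" using cand R by (auto simp: I_def pop_inv_def)
  next
    fix R1 M1 Y1 f1 assume "I R1 M1 Y1 f1"
    then obtain st1 where MY: "M1 = M" "Y1 = Y" and inv: "pop_inv b \<sigma> C c st R f st1 R1 f1"
      unfolding I_def by blast
    then show "f - 44 * real (length st) \<le> f1" by (simp add: pop_inv_def)
    from wp_pop_comparison[OF \<open>ready R M\<close> \<open>c \<le> N\<close> mem inv] show "wp cells comparison_code J R1 M1 Y1 f1"
      unfolding MY by (rule wp_mono) (auto simp: J_def)
  next
    fix R1 M1 Y1 f1 assume "J R1 M1 Y1 f1" "R1 r_best_val \<le> R1 r_val"
    then show "?Q R1 M1 Y1 (f1 - 1)" by (auto simp: J_def add.commute)
  next
    fix R1 M1 Y1 f1 assume "J R1 M1 Y1 f1" "R1 r_val < R1 r_best_val"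
    then obtain st1 where "M1 = M" "Y1 = Y" "pop_inv b \<sigma> C c st R f st1 R1 (f1 + 40)"
        "A (top_row \<sigma> st1) c < A (top_row \<sigma> st1) (last st1)"
      unfolding J_def by auto
    then show "wp cells pop_step_code I R1 M1 Y1 (f1 - 2)"
      unfolding I_def using wp_pop_step[OF \<open>ready R M\<close> R(3)] by blast
  qed
qed

definition absorbed :: "nat \<Rightarrow> nat set \<Rightarrow> nat \<Rightarrow> nat \<Rightarrow> nat list \<Rightarrow> (reg \<Rightarrow> real) \<Rightarrow> (nat \<Rightarrow> real) \<Rightarrow> nat list \<Rightarrow>
    bool" where
  "absorbed \<sigma> C c b st R' M' st' \<longleftrightarrow> reduction_stack \<sigma> st' \<and> covers \<sigma> (set st') (insert c C) \<and>
    set st' \<subseteq> insert c (set st) \<and> length st' \<le> Suc (length st) \<and> stored M' b st' \<and> stack_regs b \<sigma> st' R'"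

lemma wp_push:
  assumes "ready R M" and cand: "candidate \<sigma> C st c" "A (top_row \<sigma> st) (last st) \<le> A (top_row \<sigma> st) c"
    and mem: "stored M b st" "length st * \<sigma> \<le> N \<Longrightarrow> b + length st < cells"
    and R: "stack_regs b \<sigma> st R" "R r_col = real c" "R r_gap = real \<sigma>"
  shows "wp cells push_code (\<lambda>R' M' Y' f'. Y' = Y \<and> agree_on {..<41} R R' \<and> agree_on {..<b} M M' \<and>
    (\<exists>st'. absorbed \<sigma> C c b st R' M' st') \<and> f - 6 \<le> f') R M Y f"
    (is "wp _ _ ?Q _ _ _ _")
proof -
  obtain h where h: "length st = Suc h" "st \<noteq> []" using R(1) by (cases st) (auto simp: stack_regs_def)
  have next_row: "R r_top_row + real \<sigma> = real (length st * \<sigma>)"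
    using R(1) h by (simp add: stack_regs_def top_row_def algebra_simps)
  define R1 where "R1 = R(r_tmp := real (length st * \<sigma>))"
  note regs = R ready_regs[OF \<open>ready R M\<close>]
  have "wp cells (Cond r_tmp r_len (Block [Move r_top_row r_tmp, Add r_top r_top r_one, Store r_top r_col])
      (Block [])) ?Q R1 M Y (f - 1)"
  proof (rule wp_Cond)
    assume "R1 r_tmp \<le> R1 r_len"
    then have "length st * \<sigma> \<le> N" using regs by (simp add: R1_def flip: of_nat_mult)
    note candidate_push[OF cand this] and mem(2)[OF this]
    moreover have "stack_regs b \<sigma> (st @ [c]) (R1(r_top_row := real (length st * \<sigma>),
      r_top := real (b + Suc h)))"
      by (simp add: stack_regs_def top_row_def h)
    moreover have "stored (M(b + Suc h := real c)) b (st @ [c])"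
      using stored_agree[OF mem(1)] h by (auto simp: stored_snoc)
    ultimately show "wp cells (Block [Move r_top_row r_tmp, Add r_top r_top r_one, Store r_top r_col])
        ?Q R1 M Y (f - 1 - 2)"
      using regs h
      by (intro wp_Block) (auto simp: absorbed_def R1_def stack_regs_def intro!: exI[of _ "st @ [c]"])
  next
    assume "R1 r_len < R1 r_tmp"
    then have "N < length st * \<sigma>" using regs by (simp add: R1_def flip: of_nat_mult)
    from candidate_skip[OF cand this] show "wp cells (Block []) ?Q R1 M Y (f - 1 - 2)"
      using cand(1) mem(1) R(1)
      by (intro wp_Block) (auto simp: absorbed_def R1_def stack_regs_def candidate_def intro!: exI[of _ st])
  qed
  then show ?thesis unfolding push_code_def
    using R(3) next_row by (intro wp_Block_Seq) (simp add: R1_def)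
qed

lemma reduction_stack_length:
  assumes "reduction_stack \<sigma> st" "0 < \<sigma>"
  shows "length st \<le> Suc (N div \<sigma>)"
proof -
  have "(length st - 1) * \<sigma> \<le> N" using assms(1) by (simp add: reduction_stack_def top_row_def)
  then show ?thesis using assms(2) by (simp add: less_eq_div_iff_mult_less_eq[symmetric])
qed

lemma wp_absorb:
  assumes "ready R M" and cand: "candidate \<sigma> C st c" "c \<le> N"
    and mem: "stored M b st" "0 < \<sigma>" "b + N div \<sigma> < cells"
    and R: "stack_regs b \<sigma> st R" "R r_col = real c" "R r_gap = real \<sigma>"
  shows "wp cells absorb_code (\<lambda>R' M' Y' f'. Y' = Y \<and> agree_on {..<41} R R' \<and> agree_on {..<b} M M' \<and>
    (\<exists>st'. absorbed \<sigma> C c b st R' M' st' \<and> f - 50 - 44 * (real (length st) + 1 - real (length st')) \<le> f'))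
      R M Y f"
    (is "wp _ _ ?Q _ _ _ _")
proof -
  have "b + length st \<le> cells"
    using reduction_stack_length[of \<sigma> st] cand(1) mem(2,3) by (simp add: candidate_def)
  from wp_pop[OF \<open>ready R M\<close> cand mem(1) this R] show ?thesis
    unfolding absorb_code_def
  proof (rule wp_Seq, elim conjE exE, hypsubst)
    fix R1 f1 st1
    assume inv: "pop_inv b \<sigma> C c st R f st1 R1 (f1 + 41)"
      and le: "A (top_row \<sigma> st1) (last st1) \<le> A (top_row \<sigma> st1) c"
    have R1: "agree_on {..<41} R R1" "R1 r_col = real c" "stack_regs b \<sigma> st1 R1"
      and st1: "prefix st1 st" "candidate \<sigma> C st1 c"
      and f1: "f - 44 * (real (length st) - real (length st1)) \<le> f1 + 41"
      using inv by (simp_all add: pop_inv_def)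
    have "ready R1 M" by (rule ready_agree[OF \<open>ready R M\<close>]) (use R1 in auto)
    moreover have "b + length st1 < cells" if "length st1 * \<sigma> \<le> N"
      using that mem(2,3) less_eq_div_iff_mult_less_eq[of \<sigma> "length st1" N] by simp
    moreover have "R1 r_gap = real \<sigma>" using R1(1) R(3) by simp
    ultimately have "wp cells push_code (\<lambda>R' M' Y' f'. Y' = Y \<and> agree_on {..<41} R1 R' \<and>
      agree_on {..<b} M M' \<and> (\<exists>st'. absorbed \<sigma> C c b st1 R' M' st') \<and> f1 - 6 \<le> f') R1 M Y f1"
      using wp_push[OF _ st1(2) le stored_prefix[OF mem(1) st1(1)] _ R1(3,2)] by blast
    then show "wp cells push_code ?Q R1 M Y f1"
      by (rule wp_mono)
        (use R1(1) f1 set_mono_prefix[OF st1(1)] prefix_length_le[OF st1(1)] in \<open>fastforce simp: absorbed_def\<close>)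
  qed
qed

definition reduced :: "nat \<Rightarrow> nat \<Rightarrow> nat list \<Rightarrow> (reg \<Rightarrow> real) \<Rightarrow> (nat \<Rightarrow> real) \<Rightarrow> (reg \<Rightarrow> real) \<Rightarrow> (nat \<Rightarrow> real) \<Rightarrow>
    bool" where
  "reduced \<sigma> hi cs R M R' M' \<longleftrightarrow> agree_on {..<31} R R' \<and> agree_on {..<hi} M M' \<and>
    (\<exists>st. sufficient \<sigma> st \<and> set st \<subseteq> set cs \<and> length st \<le> Suc (N div \<sigma>) \<and> stored M' hi st \<and>
      R' r_gap = 2 * real \<sigma> \<and> R' r_lo = real hi \<and> R' r_hi = real (hi + length st))"

context
  fixes R :: "reg \<Rightarrow> real" and M :: "nat \<Rightarrow> real" and Y :: "real list" and f :: real
    and \<sigma> lo hi :: nat and cs :: "nat list"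
  assumes ready: "ready R M" and cs: "sufficient \<sigma> cs" "stored M lo cs"
    and bounds: "0 < \<sigma>" "columns_base \<le> lo" "hi = lo + length cs" "hi + N div \<sigma> < cells"
    and regs: "R r_gap = real \<sigma>" "R r_lo = real lo" "R r_hi = real hi"
begin

definition reduce_inv :: "nat \<Rightarrow> nat list \<Rightarrow> (reg \<Rightarrow> real) \<Rightarrow> (nat \<Rightarrow> real) \<Rightarrow> real \<Rightarrow> bool" where
  "reduce_inv i st R' M' f' \<longleftrightarrow> i \<le> length cs \<and> reduction_stack \<sigma> st \<and> set st \<subseteq> set (take i cs) \<and>
    covers \<sigma> (set st) (set (take i cs)) \<and> stored M' hi st \<and> stack_regs hi \<sigma> st R' \<and>
    agree_on {..<40} R R' \<and> agree_on {..<hi} M M' \<and> R' r_ptr = real (lo + i) \<and>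
    f + 44 * real (length st) \<le> f' + 98 * real i"

lemma reduce_candidate:
  assumes "reduce_inv i st R1 M1 f1" and "i < length cs"
  shows "candidate \<sigma> (set (take i cs)) st (cs ! i)"
proof -
  have "s < cs ! i" if "s \<in> set st" for s
  proof -
    have "s \<in> set (take i cs)" using that assms(1) by (auto simp: reduce_inv_def)
    then obtain j where "j < i" "s = cs ! j" using assms(2) by (auto simp: in_set_conv_nth)
    then show ?thesis
      using sorted_wrt_nth_less[of "(<)" cs j i] cs(1) assms(2) by (simp add: sufficient_def)
  qed
  then show ?thesis
    using assms(1) by (auto simp: reduce_inv_def candidate_def intro: covers_superset)
qed

lemma wp_reduce_step:
  assumes inv: "reduce_inv i st R1 M1 f1" and i: "i < length cs"
  shows "wp cells reduce_step_code
    (\<lambda>R' M' Y' f'. Y' = Y \<and> (\<exists>st'. reduce_inv (Suc i) st' R' M' f')) R1 M1 Y (f1 - 2)"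
    (is "wp _ _ ?Q _ _ _ _")
proof -
  define c where "c = cs ! i"
  define R2 where "R2 = R1(r_col := real c)"
  have R1: "stack_regs hi \<sigma> st R1" "agree_on {..<40} R R1" "agree_on {..<hi} M M1" "R1 r_ptr = real (lo + i)"
    using inv by (simp_all add: reduce_inv_def)
  have "stored M1 lo cs" using cs(2) by (rule stored_agree) (use R1(3) bounds(3) in auto)
  then have load: "M1 (lo + i) = real c" "lo + i < cells"
    using i bounds(3,4) by (simp_all add: stored_nth c_def)
  have "ready R2 M1"
    by (rule ready_agree[OF ready]) (use R1 layout bounds(2,3) in \<open>auto simp: R2_def\<close>)
  moreover have "c \<le> N" using cs(1) nth_mem[OF i] by (auto simp: sufficient_def c_def)
  moreover have "stored M1 hi st" using inv by (simp add: reduce_inv_def)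
  moreover have "stack_regs hi \<sigma> st R2" "R2 r_col = real c" "R2 r_gap = real \<sigma>"
    using R1 regs by (auto simp: R2_def stack_regs_def)
  ultimately have "wp cells (absorb_code ;; Block [Add r_ptr r_ptr r_one]) ?Q R2 M1 Y (f1 - 3)"
  proof (rule wp_Seq[OF wp_absorb[OF _ reduce_candidate[OF inv i, folded c_def] _ _ bounds(1,4)]],
    elim conjE exE)
    fix R3 M3 Y3 f3 st'
    assume post: "Y3 = Y" "agree_on {..<41} R2 R3" "agree_on {..<hi} M1 M3"
      "absorbed \<sigma> (set (take i cs)) c hi st R3 M3 st'"
      "f1 - 3 - 50 - 44 * (real (length st) + 1 - real (length st')) \<le> f3"
    have "set (take (Suc i) cs) = insert c (set (take i cs))"
      using i by (simp add: take_Suc_conv_app_nth c_def)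
    then have "reduce_inv (Suc i) st' (R3(r_ptr := real (lo + Suc i))) M3 (f3 - 1)"
      using inv post i R1 unfolding reduce_inv_def absorbed_def by (auto simp: R2_def stack_regs_def)
    moreover have "R3 r_one = 1" "R3 r_ptr = real lo + real i"
      using R1 post(2) ready_regs[OF ready] by (auto simp: R2_def)
    ultimately show "wp cells (Block [Add r_ptr r_ptr r_one]) ?Q R3 M3 Y3 f3"
      using post(1) by (intro wp_Block) (auto simp: add_ac)
  qed
  then show ?thesis unfolding reduce_step_code_def
    using R1(4) load by (intro wp_Block_Seq) (simp add: R2_def)
qed

lemma wp_reduce_finish:
  assumes "reduce_inv i st R1 M1 f1" and "length cs \<le> i"
  shows "wp cells reduce_finish_code (\<lambda>R' M' Y' f'. Y' = Y \<and> reduced \<sigma> hi cs R M R' M' \<and>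
    f - 98 * real (length cs) \<le> f') R1 M1 Y (f1 - 1)"
proof -
  have inv: "i = length cs" "reduction_stack \<sigma> st" "set st \<subseteq> set cs" "covers \<sigma> (set st) (set cs)"
      "stored M1 hi st" "stack_regs hi \<sigma> st R1" "agree_on {..<40} R R1" "agree_on {..<hi} M M1"
      "f + 44 * real (length st) \<le> f1 + 98 * real i"
    using assms by (auto simp: reduce_inv_def)
  obtain h where "length st = Suc h" using inv(6) by (cases st) (auto simp: stack_regs_def)
  then show ?thesis unfolding reduce_finish_code_def
    using inv sufficient_reduction_stack[OF cs(1) inv(2-4)] reduction_stack_length[OF inv(2) bounds(1)]
      regs ready_regs[OF ready]
    by (intro wp_Block) (auto simp: reduced_def stack_regs_def intro!: exI[of _ st])
qed

lemma wp_reduce: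
  "wp cells reduce_code (\<lambda>R' M' Y' f'. Y' = Y \<and> reduced \<sigma> hi cs R M R' M' \<and>
    f - 98 * real (length cs) \<le> f') R M Y f"
    (is "wp _ _ ?Q _ _ _ _")
proof -
  define I where "I = (\<lambda>R' M' Y' f'. Y' = Y \<and> (\<exists>i st. reduce_inv i st R' M' f'))"
  have cs0: "1 \<le> length cs" "take 1 cs = [0]" using cs(1) by (cases cs; auto simp: sufficient_def)+
  have ptr: "R' r_hi \<le> R' r_ptr \<longleftrightarrow> length cs \<le> i" if "reduce_inv i st R' M' f'" for i st R' M' f'
  proof -
    have "R' r_hi = real hi" "R' r_ptr = real (lo + i)" using that regs by (auto simp: reduce_inv_def)
    then show ?thesis by (simp add: bounds(3))
  qed
  define R1 where "R1 = R(r_top := real hi, r_top_row := 0, r_ptr := real lo + 1)"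
  have "wp cells (Until r_hi r_ptr reduce_step_code ;;
      reduce_finish_code) ?Q R1 (M(hi := 0)) Y (f - 4)"
  proof (rule wp_Seq_nested, rule wp_Until[where I = I and B = "f - 98 * real (length cs)"])
    have "reduction_stack \<sigma> [0]" by (simp add: reduction_stack_def top_row_def)
    then have "reduce_inv 1 [0] R1 (M(hi := 0)) (f - 4)"
      using cs0 unfolding reduce_inv_def cs0(2)
      by (auto simp: R1_def stack_regs_def top_row_def stored_def intro!: covers_refl)
    then show "I R1 (M(hi := 0)) Y (f - 4)" unfolding I_def by blast
  next
    fix R2 M2 Y2 f2 assume "I R2 M2 Y2 f2"
    then show "f - 98 * real (length cs) \<le> f2" by (auto simp: I_def reduce_inv_def)
  next
    fix R2 M2 Y2 f2 assume "I R2 M2 Y2 f2" "R2 r_ptr < R2 r_hi"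
    then show "wp cells reduce_step_code I R2 M2 Y2 (f2 - 2)"
      unfolding I_def using ptr by (auto simp flip: not_le intro!: wp_mono[OF wp_reduce_step])
  next
    fix R2 M2 Y2 f2 assume "I R2 M2 Y2 f2" "R2 r_hi \<le> R2 r_ptr"
    then obtain i st where "Y2 = Y" "reduce_inv i st R2 M2 f2" "length cs \<le> i"
      using ptr unfolding I_def by blast
    then show "wp cells reduce_finish_code ?Q R2 M2 Y2 (f2 - 1)"
      using wp_reduce_finish by blast
  qed
  then show ?thesis unfolding reduce_code_def
    using regs ready_regs[OF ready] bounds(4) by (intro wp_Block_Seq) (simp add: R1_def)
qed

end

end

section \<open>Row minima in linear time\<close>

definition store_column_code :: com where
  "store_column_code = Block [Add r_top r_columns r_ptr, Store r_top r_ptr, Add r_ptr r_ptr r_one]"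

definition all_columns_code :: com where
  "all_columns_code =
    Block [Const r_gap 1, Move r_lo r_columns, Add r_hi r_columns r_len1, Const r_ptr 0] ;;
    Until r_len1 r_ptr store_column_code"

definition descend_code :: com where
  "descend_code = all_columns_code ;; Until r_len1 r_gap reduce_code"

context pieces begin

lemma wp_all_columns:
  assumes "ready R M"
  shows "wp cells all_columns_code (\<lambda>R' M' Y' f'. Y' = Y \<and> agree_on {..<31} R R' \<and>
    agree_on {..<columns_base} M M' \<and> stored M' columns_base [0..<N + 1] \<and> R' r_gap = 1 \<and>
    R' r_lo = real columns_base \<and> R' r_hi = real (columns_base + (N + 1)) \<and> f - 5 * real N - 10 \<le> f') R M Y f"
    (is "wp _ _ ?Q _ _ _ _")
proof -
  note regs = ready_regs[OF assms]
  define P where "P i R' M' Y' \<longleftrightarrow> Y' = Y \<and> agree_on {..<31} R R' \<and> agree_on {..<columns_base} M M' \<and>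
    stored M' columns_base [0..<i] \<and> R' r_gap = 1 \<and> R' r_lo = real columns_base \<and>
    R' r_hi = real (columns_base + (N + 1)) \<and> R' r_ptr = real i" for i R' M' Y'
  define R1 where "R1 = R(r_gap := 1, r_lo := real columns_base, r_hi := real columns_base + (real N + 1),
    r_ptr := 0)"
  have "wp cells (Until r_len1 r_ptr store_column_code)
      (\<lambda>R' M' Y' f'. P (N + 1) R' M' Y' \<and> f - 4 - (3 + 2) * real (N + 1) - 1 \<le> f') R1 M Y (f - 4)"
  proof (rule wp_Until_count)
    show "P 0 R1 M Y" by (simp add: P_def R1_def stored_def)
    show "R' r_len1 \<le> R' r_ptr \<longleftrightarrow> i = N + 1" if "i \<le> N + 1" "P i R' M' Y'" for i R' M' Y'
      using that regs by (auto simp: P_def)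
    fix i R' M' Y' f' assume "i < N + 1" "P i R' M' Y'"
    moreover from this have "columns_base + i < cells" using length_less_width layout(8) by linarith
    ultimately show "wp cells store_column_code
        (\<lambda>R' M' Y' f''. P (Suc i) R' M' Y' \<and> f' - 3 \<le> f'') R' M' Y' f'"
      using regs unfolding store_column_code_def
      by (intro wp_Block) (auto simp: P_def stored_snoc elim: stored_agree)
  qed simp
  then have "wp cells (Until r_len1 r_ptr store_column_code) ?Q R1 M Y (f - 4)"
    by (rule wp_mono) (auto simp: P_def)
  then show ?thesis unfolding all_columns_code_def
    using regs by (intro wp_Block_Seq) (simp add: R1_def)
qed

text \<open>The column lists of all strides are stored consecutively and end at \<open>e\<close>; the list of the largest
  stride comes first in \<open>css\<close> and last in memory.\<close>

fun column_lists :: "(nat \<Rightarrow> real) \<Rightarrow> nat list list \<Rightarrow> nat \<Rightarrow> bool" where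
  "column_lists M [] e \<longleftrightarrow> columns_base \<le> e"
| "column_lists M (cs # css) e \<longleftrightarrow> (\<exists>b. e = b + length cs \<and> stored M b cs \<and>
    sufficient (2 ^ length css) cs \<and> 2 ^ length css \<le> N \<and> length cs \<le> Suc (N div 2 ^ length css) \<and>
    (css \<noteq> [] \<longrightarrow> set cs \<subseteq> set (hd css)) \<and> column_lists M css b)"

lemma column_lists_ge: "column_lists M css e \<Longrightarrow> columns_base \<le> e"
proof (induction css arbitrary: e)
  case (Cons cs css)
  then obtain b where "e = b + length cs" "column_lists M css b" by auto
  then show ?case using Cons.IH[of b] by simp
qed simp

lemma column_lists_agree:
  "column_lists M css e \<Longrightarrow> agree_on {columns_base..<e} M M' \<Longrightarrow> column_lists M' css e"
proof (induction css arbitrary: e)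
  case (Cons cs css)
  then obtain b where b: "e = b + length cs" "stored M b cs" "column_lists M css b" by auto
  have "column_lists M' css b" using b(3) by (rule Cons.IH) (use Cons.prems(2) b(1) in auto)
  moreover have "stored M' b cs"
    using b(2) by (rule stored_agree) (use Cons.prems(2) b(1) column_lists_ge[OF b(3)] in auto)
  ultimately show ?case using Cons.prems(1) b(1) by auto
qed simp

context
  fixes R :: "reg \<Rightarrow> real" and M :: "nat \<Rightarrow> real" and Y :: "real list" and f :: real
  assumes ready: "ready R M"
begin

text \<open>Halving \<open>real N / 2 ^ k\<close> is the potential that pays for the time and the space of one stride.\<close>

definition descend_inv :: "nat list list \<Rightarrow> nat list \<Rightarrow> nat \<Rightarrow> (reg \<Rightarrow> real) \<Rightarrow> (nat \<Rightarrow> real) \<Rightarrow> real \<Rightarrow> bool" where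
  "descend_inv css cs lo R' M' f' \<longleftrightarrow> (let k = length css; hi = lo + length cs; w = real N / 2 ^ k in
    sufficient (2 ^ k) cs \<and> real (length cs) \<le> 2 * w + 1 \<and> stored M' lo cs \<and> columns_base \<le> lo \<and>
    column_lists M' css hi \<and> (css \<noteq> [] \<longrightarrow> cs = hd css) \<and>
    agree_on {..<31} R R' \<and> agree_on {..<columns_base} M M' \<and>
    R' r_gap = 2 ^ k \<and> R' r_lo = real lo \<and> R' r_hi = real hi \<and>
    real hi \<le> real columns_base + 5 * real N + 1 - 4 * w \<and>
    f - 605 * real N - 10 + 600 * w \<le> f')"

lemma descend_inv_bounds:
  assumes "descend_inv css cs lo R1 M1 f1" and "R1 r_gap < R1 r_len1"
  shows "2 ^ length css \<le> N" "lo + length cs + N div 2 ^ length css < cells"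
proof -
  have "real (2 ^ length css) < real (N + 1)"
    using assms ready_regs[OF ready] by (simp add: descend_inv_def Let_def)
  then show "2 ^ length css \<le> N" by linarith
  then have "1 \<le> real N / real (2 ^ length css)" by simp
  moreover have "real (N div 2 ^ length css) \<le> real N / real (2 ^ length css)" by (rule of_nat_div_le_of_nat)
  moreover have "real (lo + length cs) \<le>
    real columns_base + 5 * real N + 1 - 4 * (real N / real (2 ^ length css))"
    using assms(1) by (simp add: descend_inv_def Let_def)
  ultimately have "real (lo + length cs + N div 2 ^ length css) \<le>
    real columns_base + 5 * real N + 1" by linarith
  also have "\<dots> < real cells" using length_less_width layout(8) by linarith
  finally show "lo + length cs + N div 2 ^ length css < cells" by linarith
qed

lemma descend_inv_reduced:
  assumes inv: "descend_inv css cs lo R1 M1 f1" and "2 ^ length css \<le> N"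
    and reduced: "reduced (2 ^ length css) (lo + length cs) cs R1 M1 R2 M2"
    and fuel: "f1 - 2 - 98 * real (length cs) \<le> f2"
  obtains st where "descend_inv (st # css) st (lo + length cs) R2 M2 f2"
proof -
  define \<sigma> :: nat where "\<sigma> = 2 ^ length css"
  define hi where "hi = lo + length cs"
  define w where "w = real N / real \<sigma>"
  have \<sigma>: "real \<sigma> = 2 ^ length css" "0 < \<sigma>" by (simp_all add: \<sigma>_def)
  note inv_facts = inv[unfolded descend_inv_def Let_def, folded \<sigma>(1) \<sigma>_def hi_def, folded w_def]
  have "1 \<le> w" using assms(2) \<sigma>(2) by (simp add: w_def flip: \<sigma>_def)
  obtain st where R2: "agree_on {..<31} R1 R2" "agree_on {..<hi} M1 M2" "R2 r_gap = 2 * real \<sigma>"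
      "R2 r_lo = real hi" "R2 r_hi = real (hi + length st)"
    and st: "sufficient \<sigma> st" "set st \<subseteq> set cs" "length st \<le> Suc (N div \<sigma>)" "stored M2 hi st"
    using reduced[folded \<sigma>_def hi_def] unfolding reduced_def by blast
  have "real (N div \<sigma>) \<le> w" unfolding w_def by (rule of_nat_div_le_of_nat)
  then have st_w: "real (length st) \<le> w + 1" using st(3) by linarith
  have "column_lists M2 css hi"
    by (rule column_lists_agree[of M1]) (use inv_facts R2(2) in auto)
  then have "column_lists M2 (st # css) (hi + length st)"
    using st inv_facts assms(2) by (auto simp: \<sigma>_def)
  moreover have "agree_on {..<columns_base} M M2" using inv_facts R2(2) by (auto simp: hi_def)
  moreover have "real (2 ^ length (st # css)) = 2 * real \<sigma>" "real N / 2 ^ length (st # css) = w / 2"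
    by (simp_all add: \<sigma> w_def)
  ultimately have "descend_inv (st # css) st hi R2 M2 f2"
    unfolding descend_inv_def Let_def
    using inv_facts R2 st st_w fuel \<open>1 \<le> w\<close> sufficient_double[of \<sigma> st] by (auto simp: \<sigma>_def hi_def)
  then show thesis using that by (simp add: hi_def)
qed

lemma wp_descend_step:
  assumes inv: "descend_inv css cs lo R1 M1 f1" and gap: "R1 r_gap < R1 r_len1"
  shows "wp cells reduce_code (\<lambda>R' M' Y' f'. Y' = Y \<and> (\<exists>css cs lo. descend_inv css cs lo R' M' f'))
    R1 M1 Y (f1 - 2)"
proof -
  note bounds = descend_inv_bounds[OF inv gap]
  have "ready R1 M1" by (rule ready_agree[OF ready]) (use inv layout in \<open>auto simp: descend_inv_def Let_def\<close>)
  then have "wp cells reduce_code (\<lambda>R' M' Y' f'. Y' = Y \<and>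
    reduced (2 ^ length css) (lo + length cs) cs R1 M1 R' M' \<and>
      f1 - 2 - 98 * real (length cs) \<le> f') R1 M1 Y (f1 - 2)"
    using inv bounds(2) by (intro wp_reduce) (simp_all add: descend_inv_def Let_def)
  then show ?thesis
    by (rule wp_mono) (use descend_inv_reduced[OF inv bounds(1)] in blast)
qed

lemma descend_inv_limits:
  assumes "descend_inv css cs lo R' M' f'"
  shows "f - 605 * real N - 10 \<le> f'" "lo + length cs \<le> cells"
proof -
  have nonneg: "0 \<le> real N / 2 ^ length css" by simp
  then show "f - 605 * real N - 10 \<le> f'" using assms unfolding descend_inv_def Let_def by linarith
  have "real (lo + length cs) \<le> real columns_base + 5 * real N + 1"
    using assms nonneg unfolding descend_inv_def Let_def by linarith
  then show "lo + length cs \<le> cells" using length_less_width layout(8) by linarith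
qed

lemma wp_descend:
  "wp cells descend_code (\<lambda>R' M' Y' f'. Y' = Y \<and> agree_on {..<31} R R' \<and> agree_on {..<columns_base} M M' \<and>
    (\<exists>css e. column_lists M' css e \<and> e \<le> cells \<and> N < 2 ^ length css \<and>
      R' r_gap = 2 ^ length css \<and> R' r_hi = real e) \<and> f - 620 * real (N + 1) \<le> f') R M Y f"
    (is "wp _ _ ?Q _ _ _ _")
proof -
  define I where "I = (\<lambda>R' M' Y' f'. Y' = Y \<and> (\<exists>css cs lo. descend_inv css cs lo R' M' f'))"
  show ?thesis
    unfolding descend_code_def
  proof (rule wp_Seq[OF wp_all_columns[OF ready]],
      rule wp_Until[where I = I and B = "f - 605 * real N - 10"], goal_cases start)
    case (start R1 M1 Y1 f1)
    then have "descend_inv [] [0..<N + 1] columns_base R1 M1 f1"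
      using sufficient_all[of 1] by (simp add: descend_inv_def Let_def del: upt_Suc)
    then show ?case using start by (auto simp: I_def)
  next
    fix R1 M1 Y1 f1 assume "I R1 M1 Y1 f1"
    then show "f - 605 * real N - 10 \<le> f1" using descend_inv_limits(1) by (auto simp: I_def)
  next
    fix R1 M1 Y1 f1 assume "I R1 M1 Y1 f1" and exit: "R1 r_len1 \<le> R1 r_gap"
    then obtain css cs lo where "Y1 = Y" and inv: "descend_inv css cs lo R1 M1 f1"
      unfolding I_def by blast
    have "real (N + 1) \<le> real (2 ^ length css)"
      using exit inv ready_regs[OF ready] by (simp add: descend_inv_def Let_def)
    then have "N < 2 ^ length css" by linarith
    moreover have "column_lists M1 css (lo + length cs)" "R1 r_gap = 2 ^ length css"
        "R1 r_hi = real (lo + length cs)" "agree_on {..<31} R R1" "agree_on {..<columns_base} M M1"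
      using inv by (simp_all add: descend_inv_def Let_def)
    ultimately show "?Q R1 M1 Y1 (f1 - 1)"
      using descend_inv_limits[OF inv] \<open>Y1 = Y\<close> by (intro conjI exI[of _ css] exI[of _ "lo + length cs"]) auto
  next
    fix R1 M1 Y1 f1 assume "I R1 M1 Y1 f1" "R1 r_gap < R1 r_len1"
    then show "wp cells reduce_code I R1 M1 Y1 (f1 - 2)"
      unfolding I_def using wp_descend_step by blast
  qed
qed

end

end

definition next_column_code :: com where
  "next_column_code =
    Block [Add r_tmp r_ptr r_one] ;;
    Cond r_hi r_tmp (Block [Move r_col r_len1]) (Block [Load r_col r_tmp])"

definition improve_code :: com where
  "improve_code =
    Block [Add r_ptr r_ptr r_one] ;; cost_code r_row r_col ;;
    Cond r_best_val r_val (Block []) (Block [Move r_best_val r_val, Move r_best r_col])"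

definition scan_code :: com where
  "scan_code = Loop next_column_code r_limit r_col improve_code"

definition limit_code :: com where
  "limit_code =
    Block [Add r_tmp r_row r_gap] ;;
    Cond r_len1 r_tmp (Block [Move r_limit r_len1])
      (Block [Add r_tmp r_minima r_tmp, Load r_limit r_tmp, Add r_limit r_limit r_one])"

definition first_column_code :: com where
  "first_column_code =
    Block [Load r_best r_ptr] ;; cost_code r_row r_best ;; Block [Move r_best_val r_val]"

definition store_minimum_code :: com where
  "store_minimum_code = Block [Add r_tmp r_minima r_row, Store r_tmp r_best, Add r_row r_row r_gap2]"

definition fill_row_code :: com where
  "fill_row_code =
    limit_code ;; first_column_code ;; scan_code ;;
    store_minimum_code"

context pieces begin

context
  fixes R :: "reg \<Rightarrow> real" and M :: "nat \<Rightarrow> real" and Y :: "real list" and f :: real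
    and \<sigma> lo r limit p0 :: nat and cs :: "nat list"
  assumes ready: "ready R M" and cs: "sufficient \<sigma> cs" "stored M lo cs" "lo + length cs \<le> cells"
    and bounds: "r \<le> N" "limit \<le> N" "p0 < length cs" "cs ! p0 \<le> limit"
    and regs: "R r_hi = real (lo + length cs)" "R r_ptr = real (lo + p0)" "R r_row = real r"
      "R r_limit = real limit + 1" "R r_best = real (cs ! p0)" "R r_best_val = A r (cs ! p0)"
begin

definition scan_inv :: "nat \<Rightarrow> nat \<Rightarrow> (reg \<Rightarrow> real) \<Rightarrow> real \<Rightarrow> bool" where
  "scan_inv p b R' f' \<longleftrightarrow> p0 \<le> b \<and> b \<le> p \<and> p < length cs \<and> cs ! p \<le> limit \<and>
    (\<forall>j. p0 \<le> j \<and> j \<le> p \<longrightarrow> A r (cs ! b) \<le> A r (cs ! j)) \<and> agree_on {..<40} R R' \<and>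
    R' r_ptr = real (lo + p) \<and> R' r_row = real r \<and> R' r_limit = real limit + 1 \<and>
    R' r_best = real (cs ! b) \<and> R' r_best_val = A r (cs ! b) \<and> f - 30 * (real p - real p0) \<le> f'"

definition next_column :: "nat \<Rightarrow> nat" where
  "next_column p = (if Suc p < length cs then cs ! Suc p else N + 1)"

lemma column_le: "i < length cs \<Longrightarrow> cs ! i \<le> N"
  using cs(1) nth_mem[of i cs] unfolding sufficient_def by (meson atMost_iff subsetD)

lemma nth_le_iff: "i < length cs \<Longrightarrow> j < length cs \<Longrightarrow> cs ! i \<le> cs ! j \<longleftrightarrow> i \<le> j"
  using cs(1) by (intro sorted_wrt_less_nth_le_iff) (simp add: sufficient_def)

lemma wp_next_column:
  assumes inv: "scan_inv p b R1 f1"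
  shows "wp cells next_column_code (\<lambda>R' M' Y' f'. M' = M \<and> Y' = Y \<and> scan_inv p b R' (f' + 4) \<and>
    R' r_col = real (next_column p)) R1 M Y f1"
    (is "wp _ _ ?Q _ _ _ _")
proof -
  define R2 where "R2 = R1(r_tmp := real (lo + Suc p))"
  have R2: "scan_inv p b R2 f1" "R2 r_hi = real (lo + length cs)" "R2 r_len1 = real N + 1"
    using inv regs ready_regs[OF ready] by (auto simp: scan_inv_def R2_def)
  have "wp cells (Cond r_hi r_tmp (Block [Move r_col r_len1]) (Block [Load r_col r_tmp])) ?Q R2 M Y (f1 - 1)"
  proof (rule wp_Cond)
    assume "R2 r_hi \<le> R2 r_tmp"
    then have "length cs \<le> Suc p" using R2(2) by (simp add: R2_def)
    then show "wp cells (Block [Move r_col r_len1]) ?Q R2 M Y (f1 - 1 - 2)"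
      using R2 by (intro wp_Block) (simp add: scan_inv_def next_column_def)
  next
    assume "R2 r_tmp < R2 r_hi"
    then have p: "Suc p < length cs" using R2(2) by (simp add: R2_def)
    then have "M (lo + Suc p) = real (cs ! Suc p)" "lo + Suc p < cells"
      using stored_nth[OF cs(2) p] cs(3) by simp_all
    moreover have "R2 r_tmp = real (lo + Suc p)" by (simp add: R2_def)
    ultimately show "wp cells (Block [Load r_col r_tmp]) ?Q R2 M Y (f1 - 1 - 2)"
      using R2(1) p by (intro wp_Block) (simp add: scan_inv_def next_column_def del: of_nat_add)
  qed
  then show ?thesis unfolding next_column_code_def
    using inv ready_regs[OF ready] by (intro wp_Block_Seq) (simp add: scan_inv_def R2_def add_ac)
qed

lemma wp_improve:
  assumes inv: "scan_inv p b R1 (f1 + 4)" and col: "R1 r_col = real (next_column p)" "next_column p \<le> limit"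
  shows "wp cells improve_code (\<lambda>R' M' Y' f'. M' = M \<and> Y' = Y \<and> (\<exists>p b. scan_inv p b R' f')) R1 M Y (f1 - 2)"
    (is "wp _ _ ?Q _ _ _ _")
proof -
  define c where "c = cs ! Suc p"
  have p: "Suc p < length cs" "next_column p = c" "c \<le> limit"
    using col(2) bounds(2) by (auto simp: next_column_def c_def split: if_splits)
  define R2 where "R2 = R1(r_ptr := real (lo + Suc p))"
  have "wp cells (cost_code r_row r_col ;;
      Cond r_best_val r_val (Block []) (Block [Move r_best_val r_val, Move r_best r_col])) ?Q R2 M Y (f1 - 3)"
  proof (rule wp_evaluates_Seq)
    have "ready R2 M" by (rule ready_agree[OF ready]) (use inv in \<open>auto simp: scan_inv_def R2_def\<close>)
    then show "evaluates (cost_code r_row r_col) (A r c) 19 R2 M"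
      using inv col p bounds(1) column_le[OF p(1)]
      by (intro evaluates_cost_code_ready) (auto simp: scan_inv_def R2_def c_def)
    fix R3 f3 assume R3: "agree_on {..<50} R2 R3" "R3 r_val = A r c" "f1 - 3 - real 19 \<le> f3"
    have agree: "agree_on {..<40} R R3" "R3 r_ptr = real (lo + Suc p)" "R3 r_row = real r"
        "R3 r_limit = real limit + 1" "R3 r_best = real (cs ! b)" "R3 r_best_val = A r (cs ! b)"
        "R3 r_col = real c"
      using inv R3(1) col p(2) by (auto simp: scan_inv_def R2_def)
    note inv_facts = inv[unfolded scan_inv_def]
    show "wp cells (Cond r_best_val r_val (Block []) (Block [Move r_best_val r_val, Move r_best r_col]))
        ?Q R3 M Y f3"
    proof (rule wp_Cond)
      assume "R3 r_best_val \<le> R3 r_val"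
      then have "scan_inv (Suc p) b R3 (f3 - 2)"
        unfolding scan_inv_def using inv_facts agree R3 p by (auto simp: le_Suc_eq c_def)
      then show "wp cells (Block []) ?Q R3 M Y (f3 - 2)" by (intro wp_Block) auto
    next
      assume "R3 r_val < R3 r_best_val"
      then have "scan_inv (Suc p) (Suc p) (R3(r_best_val := A r c, r_best := real c)) (f3 - 4)"
        unfolding scan_inv_def using inv_facts agree R3 p by (force simp: le_Suc_eq c_def)
      then show "wp cells (Block [Move r_best_val r_val, Move r_best r_col]) ?Q R3 M Y (f3 - 2)"
        using R3(2) agree by (intro wp_Block) auto
    qed
  qed
  then show ?thesis unfolding improve_code_def
    using inv ready_regs[OF ready] by (intro wp_Block_Seq) (simp add: scan_inv_def R2_def add_ac)
qed

lemma scan_exit: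
  assumes inv: "scan_inv p b R1 f1" and "limit < next_column p"
  shows "last_upto cs limit p" "range_min cs r (cs ! p0) limit (cs ! b)"
proof -
  have p: "p0 \<le> b" "b \<le> p" "p < length cs" "cs ! p \<le> limit" using inv by (simp_all add: scan_inv_def)
  have last: "j \<le> p" if "j < length cs" "cs ! j \<le> limit" for j
  proof (rule ccontr)
    assume "\<not> j \<le> p"
    then have "next_column p \<le> cs ! j" using that nth_le_iff[of "Suc p" j] by (simp add: next_column_def)
    then show False using that(2) assms(2) by simp
  qed
  then show "last_upto cs limit p"
    using p nth_le_iff by (auto simp: last_upto_def in_set_conv_nth)
  have "A r (cs ! b) \<le> A r s" if s: "s \<in> set cs" "cs ! p0 \<le> s" "s \<le> limit" for s
  proof -
    obtain j where j: "j < length cs" "s = cs ! j" using s(1) by (auto simp: in_set_conv_nth)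
    then show ?thesis using s last nth_le_iff[of p0 j] bounds(3) inv by (simp add: scan_inv_def)
  qed
  moreover have "cs ! p0 \<le> cs ! b" "cs ! b \<le> limit" using nth_le_iff[of p0 b] nth_le_iff[of b p] p by auto
  ultimately show "range_min cs r (cs ! p0) limit (cs ! b)" using p by (simp add: range_min_def)
qed

lemma wp_scan:
  "wp cells scan_code (\<lambda>R' M' Y' f'. M' = M \<and> Y' = Y \<and> agree_on {..<40} R R' \<and> R' r_row = real r \<and>
    (\<exists>p b. p0 \<le> p \<and> last_upto cs limit p \<and> range_min cs r (cs ! p0) limit b \<and>
      R' r_ptr = real (lo + p) \<and> R' r_best = real b \<and> f - 30 * (real p - real p0) - 5 \<le> f')) R M Y f"
    (is "wp _ _ ?Q _ _ _ _")
proof -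
  define I where "I = (\<lambda>R' M' Y' f'. M' = M \<and> Y' = Y \<and> (\<exists>p b. scan_inv p b R' f'))"
  define J where "J = (\<lambda>R' M' Y' f'. M' = M \<and> Y' = Y \<and>
    (\<exists>p b. scan_inv p b R' (f' + 4) \<and> R' r_col = real (next_column p)))"
  show ?thesis unfolding scan_code_def
  proof (rule wp_Loop[where I = I and J = J and B = "f - 30 * real (length cs)"])
    have "scan_inv p0 p0 R f" using regs bounds by (auto simp: scan_inv_def)
    then show "I R M Y f" unfolding I_def by blast
  next
    fix R1 M1 Y1 f1 assume "I R1 M1 Y1 f1"
    then show "f - 30 * real (length cs) \<le> f1" by (auto simp: I_def scan_inv_def)
  next
    fix R1 M1 Y1 f1 assume "I R1 M1 Y1 f1"
    then show "wp cells next_column_code J R1 M1 Y1 f1"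
      unfolding I_def J_def using wp_next_column by (blast intro: wp_mono)
  next
    fix R1 M1 Y1 f1 assume "J R1 M1 Y1 f1" "R1 r_col < R1 r_limit"
    then obtain p b where inv: "M1 = M" "Y1 = Y" "scan_inv p b R1 (f1 + 4)" "R1 r_col = real (next_column p)"
        and "real (next_column p) < real (limit + 1)"
      unfolding J_def by (auto simp: scan_inv_def)
    then have "next_column p \<le> limit" by linarith
    from wp_improve[OF inv(3,4) this] show "wp cells improve_code I R1 M1 Y1 (f1 - 2)"
      unfolding I_def inv(1,2) .
  next
    fix R1 M1 Y1 f1 assume "J R1 M1 Y1 f1" "R1 r_limit \<le> R1 r_col"
    then obtain p b where inv: "M1 = M" "Y1 = Y" "scan_inv p b R1 (f1 + 4)"
        and "real (limit + 1) \<le> real (next_column p)"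
      unfolding J_def by (auto simp: scan_inv_def)
    then have "limit < next_column p" by linarith
    from scan_exit[OF inv(3) this] show "?Q R1 M1 Y1 (f1 - 1)"
      using inv unfolding scan_inv_def by (intro conjI exI[of _ p] exI[of _ "cs ! b"]) simp_all
  qed
qed

end

definition minima_stored :: "nat set \<Rightarrow> (nat \<Rightarrow> nat) \<Rightarrow> (nat \<Rightarrow> real) \<Rightarrow> bool" where
  "minima_stored S t M \<longleftrightarrow> (\<forall>r\<in>S. M (minima_base + r) = real (t r))"

definition row_filled :: "nat \<Rightarrow> nat \<Rightarrow> nat \<Rightarrow> nat \<Rightarrow> nat list \<Rightarrow> (reg \<Rightarrow> real) \<Rightarrow> (nat \<Rightarrow> real) \<Rightarrow> real \<Rightarrow>
    (reg \<Rightarrow> real) \<Rightarrow> (nat \<Rightarrow> real) \<Rightarrow> real \<Rightarrow> bool" where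
  "row_filled \<sigma> k lo p cs R M f R' M' f' \<longleftrightarrow> agree_on {..<40} R R' \<and> R' r_row = real (k + 2 * \<sigma>) \<and>
    agree_on (- {minima_base..<stack_base}) M M' \<and>
    (\<exists>p' t'. p \<le> p' \<and> p' < length cs \<and> (k + \<sigma> \<le> N \<longrightarrow> cs ! p' = t' (k + \<sigma>)) \<and>
      row_mins (solved_rows \<sigma> (k + 2 * \<sigma>)) cs t' \<and> minima_stored (solved_rows \<sigma> (k + 2 * \<sigma>)) t' M' \<and>
      R' r_ptr = real (lo + p') \<and> f - 30 * (real p' - real p) - 35 \<le> f')"

context
  fixes R :: "reg \<Rightarrow> real" and M :: "nat \<Rightarrow> real" and Y :: "real list" and f :: real
    and \<sigma> lo k u p :: nat and cs :: "nat list" and t :: "nat \<Rightarrow> nat"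
  assumes ready: "ready R M" and cs: "sufficient \<sigma> cs" "stored M lo cs" "lo + length cs \<le> cells"
    and mins: "row_mins (solved_rows \<sigma> k) cs t" "minima_stored (solved_rows \<sigma> k) t M"
    and k: "k = Suc (2 * u) * \<sigma>" "k \<le> N" "0 < \<sigma>" and p: "p < length cs" "cs ! p = t (2 * u * \<sigma>)"
    and regs: "R r_hi = real (lo + length cs)" "R r_ptr = real (lo + p)" "R r_row = real k"
      "R r_gap = real \<sigma>" "R r_gap2 = 2 * real \<sigma>"
begin

definition next_min :: nat where
  "next_min = (if k + \<sigma> \<le> N then t (k + \<sigma>) else N)"

lemma neighbours_solved:
  shows "2 * u * \<sigma> \<in> solved_rows \<sigma> k" "k + \<sigma> \<le> N \<Longrightarrow> k + \<sigma> \<in> solved_rows \<sigma> k"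
proof -
  show "2 * u * \<sigma> \<in> solved_rows \<sigma> k" using k by (auto simp: solved_rows_def rows_def)
  have "k + \<sigma> = 2 * \<sigma> * Suc u" using k(1) by simp
  then show "k + \<sigma> \<in> solved_rows \<sigma> k" if "k + \<sigma> \<le> N"
    using that unfolding solved_rows_def rows_def by (metis (mono_tags) Un_iff dvd_triv_left mem_Collect_eq)
qed

lemma next_min_limit:
  shows "upper_limit cs (k + \<sigma>) next_min" "cs ! p \<le> next_min" "next_min \<le> N"
proof -
  have lower: "cs ! p \<le> N" using row_minsD(1)[OF mins(1) neighbours_solved(1)] p(2) by (simp add: row_min_def)
  show "upper_limit cs (k + \<sigma>) next_min"
    using row_minsD[OF mins(1) neighbours_solved(2)] by (simp add: upper_limit_def next_min_def)
  then show "next_min \<le> N" by (auto simp: upper_limit_def row_min_def split: if_splits)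
  have "t (2 * u * \<sigma>) \<le> t (k + \<sigma>)" if "k + \<sigma> \<le> N"
    using mins(1) neighbours_solved that k(1) by (auto simp: row_mins_def
      intro!: mono_onD[of "solved_rows \<sigma> k" t])
  then show "cs ! p \<le> next_min" using lower p(2) by (simp add: next_min_def)
qed

lemma wp_limit:
  "wp cells limit_code (\<lambda>R' M' Y' f'. M' = M \<and> Y' = Y \<and> agree_on {..<45} R R' \<and>
    R' r_limit = real next_min + 1 \<and> f - 6 \<le> f') R M Y f"
    (is "wp _ _ ?Q _ _ _ _")
proof -
  define R1 where "R1 = R(r_tmp := real (k + \<sigma>))"
  note reg_values = regs ready_regs[OF ready]
  have "wp cells (Cond r_len1 r_tmp (Block [Move r_limit r_len1])
      (Block [Add r_tmp r_minima r_tmp, Load r_limit r_tmp, Add r_limit r_limit r_one])) ?Q R1 M Y (f - 1)"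
  proof (rule wp_Cond)
    assume "R1 r_len1 \<le> R1 r_tmp"
    then have "\<not> k + \<sigma> \<le> N" using reg_values by (simp add: R1_def)
    then show "wp cells (Block [Move r_limit r_len1]) ?Q R1 M Y (f - 1 - 2)"
      using reg_values by (intro wp_Block) (simp add: R1_def next_min_def)
  next
    assume "R1 r_tmp < R1 r_len1"
    then have next_row: "k + \<sigma> \<le> N" using reg_values by (simp add: R1_def)
    then have "M (minima_base + (k + \<sigma>)) = real (t (k + \<sigma>))"
      using mins(2) neighbours_solved(2) by (simp add: minima_stored_def)
    moreover have "minima_base + (k + \<sigma>) < cells" using next_row length_less_width layout by linarith
    moreover have "R1 r_tmp = real (k + \<sigma>)" by (simp add: R1_def)
    ultimately show "wp cells (Block [Add r_tmp r_minima r_tmp, Load r_limit r_tmp,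
      Add r_limit r_limit r_one])
        ?Q R1 M Y (f - 1 - 2)"
      using reg_values next_row by (intro wp_Block) (simp add: R1_def next_min_def del: of_nat_add)
  qed
  then show ?thesis unfolding limit_code_def
    using regs by (intro wp_Block_Seq) (simp add: R1_def)
qed

lemma row_mins_fill:
  assumes b: "range_min cs k (cs ! p) next_min b"
  shows "row_mins (insert k (solved_rows \<sigma> k)) cs (t(k := b))"
proof (rule row_mins_insert[OF mins(1)])
  have b_range: "b \<in> set cs" "cs ! p \<le> b" "b \<le> next_min" using b by (simp_all add: range_min_def)
  then show "b \<in> set cs" by simp
  show "0 < k" using k by simp
  have "k \<in> rows \<sigma>" using k by (simp add: rows_def)
  moreover have "row_min (2 * u * \<sigma>) (cs ! p)" "cs ! p \<in> set cs"
    using row_minsD[OF mins(1) neighbours_solved(1)] p by simp_all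
  ultimately show "row_min k b"
    by (rule row_min_between[OF cs(1) _ _ _ _ _ next_min_limit(1) b, rotated 2]) (use k(1) in auto)
  have mono: "mono_on (solved_rows \<sigma> k) t" using mins(1) by (simp add: row_mins_def)
  show "t s \<le> b" if s: "s \<in> solved_rows \<sigma> k" "s < k" for s
  proof -
    have "t s \<le> t (2 * u * \<sigma>)"
      using s solved_rows_neighbours(1)[OF s(1) k(1)] neighbours_solved(1) by (intro mono_onD[OF mono]) auto
    then show ?thesis using b_range(2) p(2) by simp
  qed
  show "b \<le> t s" if s: "s \<in> solved_rows \<sigma> k" "k < s" for s
  proof -
    have "k + \<sigma> \<le> s" using solved_rows_neighbours(2)[OF s(1) k(1)] s(2) k(1) by simp
    moreover have "s \<le> N" using s(1) by (auto simp: solved_rows_def rows_def)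
    ultimately have "t (k + \<sigma>) \<le> t s" "k + \<sigma> \<le> N"
      using s(1) neighbours_solved(2) by (auto intro!: mono_onD[OF mono])
    then show ?thesis using b_range(3) by (simp add: next_min_def)
  qed
qed

lemma wp_first_column:
  assumes "ready R1 M" "R1 r_ptr = real (lo + p)" "R1 r_row = real k"
  shows "wp cells first_column_code (\<lambda>R' M' Y' f'. M' = M \<and> Y' = Y \<and> agree_on {..<46} R1 R' \<and>
    R' r_best = real (cs ! p) \<and> R' r_best_val = A k (cs ! p) \<and> f1 - 21 \<le> f') R1 M Y f1"
    (is "wp _ _ ?Q _ _ _ _")
proof -
  define R2 where "R2 = R1(r_best := real (cs ! p))"
  have "wp cells (cost_code r_row r_best ;; Block [Move r_best_val r_val]) ?Q R2 M Y (f1 - 1)"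
  proof (rule wp_evaluates_Seq)
    have "ready R2 M" by (rule ready_agree[OF assms(1)]) (auto simp: R2_def)
    then show "evaluates (cost_code r_row r_best) (A k (cs ! p)) 19 R2 M"
      using assms k(2) next_min_limit by (intro evaluates_cost_code_ready) (auto simp: R2_def)
  qed (intro wp_Block, simp add: R2_def)
  moreover have "M (lo + p) = real (cs ! p)" "lo + p < cells"
    using stored_nth[OF cs(2) p(1)] cs(3) p(1) by simp_all
  ultimately show ?thesis unfolding first_column_code_def
    using assms(2) by (intro wp_Block_Seq) (simp add: R2_def del: of_nat_add)
qed

lemma wp_store_minimum:
  assumes R1: "agree_on {..<40} R R1" "R1 r_row = real k" "R1 r_ptr = real (lo + p')" "R1 r_best = real b"
    and p': "p \<le> p'" "last_upto cs next_min p'" and b: "range_min cs k (cs ! p) next_min b"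
    and fuel: "f - 30 * (real p' - real p) - 32 \<le> f1"
  shows "wp cells store_minimum_code
    (\<lambda>R' M' Y' f'. Y' = Y \<and> row_filled \<sigma> k lo p cs R M f R' M' f') R1 M Y f1"
proof -
  define t' where "t' = t(k := b)"
  have "row_mins (solved_rows \<sigma> (k + 2 * \<sigma>)) cs t'"
    unfolding solved_rows_step[OF k(1,2)] t'_def by (rule row_mins_fill[OF b])
  moreover have "minima_stored (solved_rows \<sigma> (k + 2 * \<sigma>)) t' (M(minima_base + k := real b))"
    using mins(2) unfolding solved_rows_step[OF k(1,2)] by (auto simp: minima_stored_def t'_def)
  moreover have "cs ! p' = t' (k + \<sigma>)" if "k + \<sigma> \<le> N"
  proof -
    have "next_min = t (k + \<sigma>)" "next_min \<in> set cs"
      using that next_min_limit(1) by (auto simp: next_min_def upper_limit_def)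
    then show ?thesis using p'(2) k(3) by (simp add: t'_def antisym last_upto_def)
  qed
  moreover have "minima_base + k < stack_base" "minima_base + k < cells"
    using k(2) length_less_width layout by linarith+
  ultimately show ?thesis unfolding store_minimum_code_def
    using R1 p' fuel regs ready_regs[OF ready]
    by (intro wp_Block) (auto simp: row_filled_def last_upto_def intro!: exI[of _ p'] exI[of _ t'])
qed

lemma wp_fill_row:
  "wp cells fill_row_code (\<lambda>R' M' Y' f'. Y' = Y \<and> row_filled \<sigma> k lo p cs R M f R' M' f') R M Y f"
    (is "wp _ _ ?Q _ _ _ _")
  unfolding fill_row_code_def
proof (rule wp_Seq[OF wp_limit], elim conjE, hypsubst)
  fix R1 f1
  assume R1: "agree_on {..<45} R R1" "R1 r_limit = real next_min + 1" "f - 6 \<le> f1"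
  have "ready R1 M" "R1 r_ptr = real (lo + p)" "R1 r_row = real k"
    using R1(1) regs ready_agree[OF ready] by auto
  from wp_first_column[OF this] show "wp cells (first_column_code ;; scan_code ;;
    store_minimum_code) ?Q R1 M Y f1"
  proof (rule wp_Seq, elim conjE, hypsubst)
    fix R2 f2
    assume R2: "agree_on {..<46} R1 R2" "R2 r_best = real (cs ! p)" "R2 r_best_val = A k (cs ! p)"
      "f1 - 21 \<le> f2"
    have "ready R2 M" by (rule ready_agree[OF ready]) (use R1 R2 in auto)
    moreover have "R2 r_hi = real (lo + length cs)" "R2 r_ptr = real (lo + p)" "R2 r_row = real k"
        "R2 r_limit = real next_min + 1"
      using R1 R2 regs by auto
    ultimately have "wp cells scan_code (\<lambda>R' M' Y' f'. M' = M \<and> Y' = Y \<and> agree_on {..<40} R2 R' \<and>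
      R' r_row = real k \<and> (\<exists>p' b. p \<le> p' \<and> last_upto cs next_min p' \<and> range_min cs k (cs ! p) next_min b \<and>
        R' r_ptr = real (lo + p') \<and> R' r_best = real b \<and> f2 - 30 * (real p' - real p) - 5 \<le> f')) R2 M Y f2"
      using next_min_limit p(1) R2 k(2) cs by (intro wp_scan)
    then show "wp cells (scan_code ;; store_minimum_code) ?Q R2 M Y f2"
      by (rule wp_Seq, elim conjE exE) (use R1 R2 in \<open>auto intro!: wp_store_minimum\<close>)
  qed
qed

end

end

definition retreat_code :: com where
  "retreat_code = Block [Sub r_lo r_lo r_one, Load r_tmp r_lo]"

definition find_start_code :: com where
  "find_start_code =
    Block [Sub r_lo r_hi r_one, Load r_tmp r_lo] ;;
    Until r_tmp r_zero retreat_code"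

definition interpolate_finish_code :: com where
  "interpolate_finish_code = Block [Move r_hi r_lo, Move r_gap2 r_gap]"

definition interpolate_code :: com where
  "interpolate_code =
    find_start_code ;;
    Block [Const r_tmp 2, Div r_gap r_gap2 r_tmp, Move r_ptr r_lo, Move r_row r_gap] ;;
    Until r_len1 r_row fill_row_code ;;
    interpolate_finish_code"

definition smawk_code :: com where
  "smawk_code =
    descend_code ;; Block [Move r_gap2 r_gap, Store r_minima r_zero] ;; Until r_gap2 r_one interpolate_code"

context pieces begin

text \<open>The start of a column list is recognised by its entry 0, which occurs nowhere else in the list.\<close>

lemma wp_find_start:
  assumes "ready R M" and cs: "sufficient \<sigma> cs" "stored M lo cs" "lo + length cs \<le> cells"
    and "R r_hi = real (lo + length cs)"
  shows "wp cells find_start_code (\<lambda>R' M' Y' f'. M' = M \<and> Y' = Y \<and> agree_on {..<32} R R' \<and> R' r_hi = R r_hi \<and>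
    R' r_lo = real lo \<and> f - 4 * real (length cs) \<le> f') R M Y f"
    (is "wp _ _ ?Q _ _ _ _")
proof -
  define l where "l = length cs - 1"
  have l: "length cs = Suc l" "cs ! 0 = 0" using cs(1) by (cases cs; simp add: sufficient_def l_def)+
  have zero: "cs ! j = 0 \<longleftrightarrow> j = 0" if "j \<le> l" for j
    using cs(1) l that sorted_wrt_less_nth_le_iff[of cs j 0] by (auto simp: sufficient_def)
  have load: "M (lo + j) = real (cs ! j)" "lo + j < cells" if "j \<le> l" for j
    using stored_nth[OF cs(2), of j] cs(3) that l(1) by simp_all
  define P where "P i R' M' Y' \<longleftrightarrow> M' = M \<and> Y' = Y \<and> agree_on {..<32} R R' \<and> R' r_hi = R r_hi \<and>
    R' r_lo = real (lo + (l - i)) \<and> R' r_tmp = real (cs ! (l - i))" for i R' M' Y'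
  define R1 where "R1 = R(r_lo := real (lo + l), r_tmp := real (cs ! l))"
  have "wp cells (Until r_tmp r_zero retreat_code)
      (\<lambda>R' M' Y' f'. P l R' M' Y' \<and> f - 2 - (2 + 2) * real l - 1 \<le> f') R1 M Y (f - 2)"
  proof (rule wp_Until_count)
    show "P 0 R1 M Y" by (simp add: P_def R1_def)
    show "R' r_tmp \<le> R' r_zero \<longleftrightarrow> i = l" if "i \<le> l" "P i R' M' Y'" for i R' M' Y'
      using that zero[of "l - i"] ready_regs[OF assms(1)] by (simp add: P_def) auto
    fix i R' M' Y' f' assume "i < l" and P: "P i R' M' Y'"
    then obtain j where j: "l - i = Suc j" "l - Suc i = j" "j \<le> l" by (cases "l - i") auto
    show "wp cells retreat_code
        (\<lambda>R' M' Y' f''. P (Suc i) R' M' Y' \<and> f' - 2 \<le> f'') R' M' Y' f'"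
      using P load[OF j(3)] ready_regs[OF assms(1)] unfolding retreat_code_def P_def j(1,2)
      by (intro wp_Block) simp
  qed simp
  then have "wp cells (Until r_tmp r_zero retreat_code) ?Q R1 M Y (f - 2)"
    by (rule wp_mono) (auto simp: P_def l(1))
  moreover have "R r_hi - 1 = real (lo + l)" using assms(5) l(1) by simp
  ultimately show ?thesis unfolding find_start_code_def
    using load[of l] ready_regs[OF assms(1)] by (intro wp_Block_Seq) (simp add: R1_def del: of_nat_add)
qed

definition interpolated :: "nat \<Rightarrow> nat \<Rightarrow> nat list \<Rightarrow> (reg \<Rightarrow> real) \<Rightarrow> (nat \<Rightarrow> real) \<Rightarrow> bool" where
  "interpolated \<sigma> lo cs R M \<longleftrightarrow> R r_gap2 = real \<sigma> \<and> R r_hi = real lo \<and>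
    (\<exists>t. row_mins (rows \<sigma>) cs t \<and> minima_stored (rows \<sigma>) t M)"

context
  fixes R :: "reg \<Rightarrow> real" and M :: "nat \<Rightarrow> real" and Y :: "real list" and f :: real
    and \<sigma> lo :: nat and cs :: "nat list" and t :: "nat \<Rightarrow> nat"
  assumes ready: "ready R M" and \<sigma>: "0 < \<sigma>" "\<sigma> \<le> N"
    and cs: "sufficient \<sigma> cs" "length cs \<le> Suc (N div \<sigma>)" "stored M lo cs" "columns_base \<le> lo"
      "lo + length cs \<le> cells"
    and mins: "row_mins (rows (2 * \<sigma>)) cs t" "minima_stored (rows (2 * \<sigma>)) t M"
    and regs: "R r_gap2 = 2 * real \<sigma>" "R r_hi = real (lo + length cs)"
begin

definition interpolate_inv :: "nat \<Rightarrow> nat \<Rightarrow> (nat \<Rightarrow> nat) \<Rightarrow> (reg \<Rightarrow> real) \<Rightarrow> (nat \<Rightarrow> real) \<Rightarrow> real \<Rightarrow> bool" where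
  "interpolate_inv u p t' R' M' f' \<longleftrightarrow> (let k = Suc (2 * u) * \<sigma> in
    p < length cs \<and> (2 * u * \<sigma> \<le> N \<longrightarrow> cs ! p = t' (2 * u * \<sigma>)) \<and> 2 * u * \<sigma> \<le> N + \<sigma> \<and>
    row_mins (solved_rows \<sigma> k) cs t' \<and> minima_stored (solved_rows \<sigma> k) t' M' \<and>
    agree_on {..<30} R R' \<and> agree_on (- {minima_base..<stack_base}) M M' \<and>
    R' r_gap2 = 2 * real \<sigma> \<and> R' r_gap = real \<sigma> \<and> R' r_lo = real lo \<and> R' r_hi = real (lo + length cs) \<and>
    R' r_ptr = real (lo + p) \<and> R' r_row = real k \<and>
    f - 4 * real (length cs) - 4 - 30 * real p - 37 * real u \<le> f')"

lemma interpolate_fuel: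
  assumes "interpolate_inv u p t' R' M' f'"
  shows "f - 120 * (real N / real \<sigma>) \<le> f' - 3"
proof -
  define w where "w = real N / real \<sigma>"
  have w: "1 \<le> w" "real (N div \<sigma>) \<le> w" using \<sigma> by (auto simp: w_def of_nat_div_le_of_nat)
  then have len: "real (length cs) \<le> 2 * w" using cs(2) by linarith
  have "2 * real u * real \<sigma> \<le> real (N + \<sigma>)"
    using assms unfolding interpolate_inv_def Let_def by (metis of_nat_le_iff of_nat_mult of_nat_numeral)
  then have "2 * real u \<le> w + 1" using \<sigma>(1) by (simp add: w_def field_simps)
  moreover have "p < length cs" "f - 4 * real (length cs) - 4 - 30 * real p - 37 * real u \<le> f'"
    using assms by (simp_all add: interpolate_inv_def Let_def)
  ultimately show ?thesis using w len unfolding w_def[symmetric] by linarith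
qed

lemma wp_interpolate_step:
  assumes inv: "interpolate_inv u p t' R1 M1 f1" and "R1 r_row < R1 r_len1"
  shows "wp cells fill_row_code (\<lambda>R' M' Y' f'. Y' = Y \<and> (\<exists>u p t'. interpolate_inv u p t' R' M' f'))
    R1 M1 Y (f1 - 2)"
proof -
  define k where "k = Suc (2 * u) * \<sigma>"
  note inv_facts = inv[unfolded interpolate_inv_def Let_def, folded k_def]
  have "real k < real (N + 1)" using assms(2) inv_facts ready_regs[OF ready] by simp
  then have kN: "k \<le> N" by linarith
  have "ready R1 M1" by (rule ready_agree[OF ready]) (use inv_facts layout in auto)
  moreover have "stored M1 lo cs" using cs(3) by (rule stored_agree) (use inv_facts cs(4) layout in auto)
  moreover have "cs ! p = t' (2 * u * \<sigma>)" using inv_facts kN by (simp add: k_def)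
  ultimately have "wp cells fill_row_code (\<lambda>R' M' Y' f'. Y' = Y \<and>
      row_filled \<sigma> k lo p cs R1 M1 (f1 - 2) R' M' f') R1 M1 Y (f1 - 2)"
    using inv_facts kN cs \<sigma> by (intro wp_fill_row) (auto simp: k_def)
  then show ?thesis
  proof (rule wp_mono, elim conjE)
    fix R2 M2 Y2 f2 assume "Y2 = Y" and "row_filled \<sigma> k lo p cs R1 M1 (f1 - 2) R2 M2 f2"
    then obtain p' t'' where R2: "agree_on {..<40} R1 R2" "R2 r_row = real (k + 2 * \<sigma>)"
        "agree_on (- {minima_base..<stack_base}) M1 M2" "R2 r_ptr = real (lo + p')"
        and p': "p' < length cs" "k + \<sigma> \<le> N \<longrightarrow> cs ! p' = t'' (k + \<sigma>)"
        and t'': "row_mins (solved_rows \<sigma> (k + 2 * \<sigma>)) cs t''"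
          "minima_stored (solved_rows \<sigma> (k + 2 * \<sigma>)) t'' M2"
        and f2: "f1 - 2 - 30 * (real p' - real p) - 35 \<le> f2"
      unfolding row_filled_def by blast
    have rows: "Suc (2 * Suc u) * \<sigma> = k + 2 * \<sigma>" "2 * Suc u * \<sigma> = k + \<sigma>" by (simp_all add: k_def)
    have "interpolate_inv (Suc u) p' t'' R2 M2 f2"
      unfolding interpolate_inv_def Let_def rows
      using inv_facts R2 p' t'' f2 kN by auto
    then show "Y2 = Y \<and> (\<exists>u p t'. interpolate_inv u p t' R2 M2 f2)" using \<open>Y2 = Y\<close> by blast
  qed
qed

lemma wp_interpolate_finish:
  assumes inv: "interpolate_inv u p t' R1 M1 f1" and "R1 r_len1 \<le> R1 r_row"
  shows "wp cells interpolate_finish_code (\<lambda>R' M' Y' f'. Y' = Y \<and> agree_on {..<30} R R' \<and>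
    agree_on (- {minima_base..<stack_base}) M M' \<and> interpolated \<sigma> lo cs R' M' \<and>
    f - 120 * (real N / real \<sigma>) \<le> f') R1 M1 Y (f1 - 1)"
proof -
  define k where "k = Suc (2 * u) * \<sigma>"
  note inv_facts = inv[unfolded interpolate_inv_def Let_def, folded k_def]
  have "real (N + 1) \<le> real k" using assms(2) inv_facts ready_regs[OF ready] by simp
  then have "solved_rows \<sigma> k = rows \<sigma>" by (intro solved_rows_end) linarith
  then show ?thesis unfolding interpolate_finish_code_def using inv_facts interpolate_fuel[OF inv]
    by (intro wp_Block) (auto simp: interpolated_def)
qed

lemma wp_interpolate:
  "wp cells interpolate_code (\<lambda>R' M' Y' f'. Y' = Y \<and> agree_on {..<30} R R' \<and>
    agree_on (- {minima_base..<stack_base}) M M' \<and> interpolated \<sigma> lo cs R' M' \<and>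
    f - 120 * (real N / real \<sigma>) \<le> f') R M Y f"
    (is "wp _ _ ?Q _ _ _ _")
  unfolding interpolate_code_def
proof (rule wp_Seq[OF wp_find_start[OF ready cs(1,3,5) regs(2)]], elim conjE, hypsubst)
  fix R1 f1
  assume R1: "agree_on {..<32} R R1" "R1 r_hi = R r_hi" "R1 r_lo = real lo" "f - 4 * real (length cs) \<le> f1"
  define R2 where "R2 = R1(r_tmp := 2, r_gap := real \<sigma>, r_ptr := real lo, r_row := real \<sigma>)"
  define I where "I = (\<lambda>R' M' Y' f'. Y' = Y \<and> (\<exists>u p t'. interpolate_inv u p t' R' M' f'))"
  have "wp cells (Until r_len1 r_row fill_row_code ;; interpolate_finish_code) ?Q R2 M Y (f1 - 4)"
  proof (rule wp_Seq_nested, rule wp_Until[where I = I and B = "f - 120 * (real N / real \<sigma>)"])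
    have "cs ! 0 = 0" "0 < length cs" using cs(1) by (auto simp: sufficient_def hd_conv_nth)
    moreover have "t 0 = 0" using mins(1) by (simp add: row_mins_def)
    ultimately have "interpolate_inv 0 0 t R2 M (f1 - 4)"
      using R1 mins regs by (auto simp: interpolate_inv_def Let_def R2_def)
    then show "I R2 M Y (f1 - 4)" unfolding I_def by blast
  next
    fix R3 M3 Y3 f3 assume "I R3 M3 Y3 f3"
    then show "f - 120 * (real N / real \<sigma>) \<le> f3" unfolding I_def using interpolate_fuel by fastforce
  next
    fix R3 M3 Y3 f3 assume "I R3 M3 Y3 f3" "R3 r_row < R3 r_len1"
    then show "wp cells fill_row_code I R3 M3 Y3 (f3 - 2)" unfolding I_def using wp_interpolate_step by blast
  next
    fix R3 M3 Y3 f3 assume "I R3 M3 Y3 f3" "R3 r_len1 \<le> R3 r_row"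
    then show "wp cells interpolate_finish_code ?Q R3 M3 Y3 (f3 - 1)"
      unfolding I_def using wp_interpolate_finish by blast
  qed
  then show "wp cells (Block [Const r_tmp 2, Div r_gap r_gap2 r_tmp, Move r_ptr r_lo, Move r_row r_gap] ;;
      Until r_len1 r_row fill_row_code ;; interpolate_finish_code) ?Q R1 M Y f1"
    using R1 regs by (intro wp_Block_Seq) (simp add: R2_def)
qed

end

text \<open>\<open>css\<close> holds the lists of the strides still to come, \<open>cs\<close> the columns of the minima found so far.\<close>

definition smawk_inv :: "nat list list \<Rightarrow> nat list \<Rightarrow> (reg \<Rightarrow> real) \<Rightarrow> (nat \<Rightarrow> real) \<Rightarrow> real \<Rightarrow>
    (reg \<Rightarrow> real) \<Rightarrow> (nat \<Rightarrow> real) \<Rightarrow> real \<Rightarrow> bool" where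
  "smawk_inv css cs R M f R' M' f' \<longleftrightarrow> (\<exists>e. column_lists M' css e \<and> e \<le> cells \<and>
    interpolated (2 ^ length css) e cs R' M' \<and> (css \<noteq> [] \<longrightarrow> set cs \<subseteq> set (hd css)) \<and>
    agree_on {..<30} R R' \<and> agree_on {..<minima_base} M M' \<and> agree_on {stack_base..<columns_base} M M' \<and>
    f - 622 * real (N + 1) - 244 * (real N / 2 ^ length css) \<le> f')"

lemma wp_smawk_step:
  assumes "ready R M" and inv: "smawk_inv css0 cs0 R M f R1 M1 f1" and "R1 r_one < R1 r_gap2"
  shows "wp cells interpolate_code (\<lambda>R' M' Y' f'. Y' = Y \<and>
    (\<exists>css cs. smawk_inv css cs R M f R' M' f')) R1 M1 Y (f1 - 2)"
proof -
  obtain cs css where css0: "css0 = cs # css"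
    using assms(3) inv ready_regs[OF assms(1)] by (cases css0) (auto simp: smawk_inv_def interpolated_def)
  define \<sigma> :: nat where "\<sigma> = 2 ^ length css"
  note inv_facts = inv[unfolded smawk_inv_def css0]
  obtain b where lists: "column_lists M1 css b" "stored M1 b cs" "b + length cs \<le> cells"
      and cs: "sufficient \<sigma> cs" "\<sigma> \<le> N" "length cs \<le> Suc (N div \<sigma>)" "css \<noteq> [] \<longrightarrow> set cs \<subseteq> set (hd css)"
      and solved: "interpolated (2 * \<sigma>) (b + length cs) cs0 R1 M1"
      and fuel: "f - 622 * real (N + 1) - 122 * (real N / real \<sigma>) \<le> f1"
    using inv_facts by (auto simp: \<sigma>_def)
  then obtain t where "row_mins (rows (2 * \<sigma>)) cs0 t" "minima_stored (rows (2 * \<sigma>)) t M1"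
    unfolding interpolated_def by blast
  moreover have "set cs0 \<subseteq> set cs" using inv_facts by auto
  ultimately have mins: "row_mins (rows (2 * \<sigma>)) cs t" "minima_stored (rows (2 * \<sigma>)) t M1"
    by (simp_all add: row_mins_columns_mono)
  have "0 < \<sigma>" by (simp add: \<sigma>_def)
  have "ready R1 M1" by (rule ready_agree[OF assms(1)]) (use inv_facts layout in auto)
  then have "wp cells interpolate_code (\<lambda>R' M' Y' f'. Y' = Y \<and> agree_on {..<30} R1 R' \<and>
      agree_on (- {minima_base..<stack_base}) M1 M' \<and> interpolated \<sigma> b cs R' M' \<and>
      f1 - 2 - 120 * (real N / real \<sigma>) \<le> f') R1 M1 Y (f1 - 2)"
    using \<open>0 < \<sigma>\<close> lists cs mins solved column_lists_ge[OF lists(1)]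
    by (intro wp_interpolate) (auto simp: interpolated_def)
  then show ?thesis
  proof (rule wp_mono, elim conjE)
    fix R2 M2 Y2 f2
    assume post: "agree_on {..<30} R1 R2" "agree_on (- {minima_base..<stack_base}) M1 M2"
      "interpolated \<sigma> b cs R2 M2" "f1 - 2 - 120 * (real N / real \<sigma>) \<le> f2" and "Y2 = Y"
    have "column_lists M2 css b"
      by (rule column_lists_agree[OF lists(1)]) (use post(2) layout in auto)
    moreover have "1 \<le> real N / real \<sigma>" using cs(2) \<open>0 < \<sigma>\<close> by simp
    then have "f - 622 * real (N + 1) - 244 * (real N / real \<sigma>) \<le> f2"
      using fuel post(4) by linarith
    ultimately have "smawk_inv css cs R M f R2 M2 f2"
      using inv_facts lists(3) cs(4) post(1-3) layout by (auto simp: smawk_inv_def \<sigma>_def intro!: exI[of _ b])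
    then show "Y2 = Y \<and> (\<exists>css cs. smawk_inv css cs R M f R2 M2 f2)" using \<open>Y2 = Y\<close> by blast
  qed
qed

lemma smawk_inv_start:
  assumes "column_lists M1 css e" "e \<le> cells" "N < 2 ^ length css" "R1 r_gap2 = 2 ^ length css"
    and "R1 r_hi = real e" "agree_on {..<30} R R1" "agree_on {..<columns_base} M M1"
    and "f - 620 * real (N + 1) - 2 \<le> f1"
  shows "smawk_inv css [0] R M f R1 (M1(minima_base := 0)) f1"
proof -
  have "minima_base < stack_base" "minima_base < columns_base" using layout length_less_width by linarith+
  then have "column_lists (M1(minima_base := 0)) css e"
    by (intro column_lists_agree[OF assms(1)]) auto
  moreover have "rows (2 ^ length css) = {0}" using assms(3) by (auto simp: rows_def dest: dvd_imp_le)
  then have "row_mins (rows (2 ^ length css)) [0] (\<lambda>_. 0)"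
    using first_row by (simp add: row_mins_def row_min_def monotone_on_def)
  moreover have "minima_stored (rows (2 ^ length css)) (\<lambda>_. 0) (M1(minima_base := 0))"
    using \<open>rows (2 ^ length css) = {0}\<close> by (simp add: minima_stored_def)
  moreover have "0 \<in> set (hd css)" if "css \<noteq> []"
  proof -
    have "hd css \<noteq> []" "hd (hd css) = 0" using assms(1) that by (cases css; auto simp: sufficient_def)+
    then show ?thesis by (metis hd_in_set)
  qed
  moreover define z where "z = real N / 2 ^ length css"
  have "0 \<le> z" by (simp add: z_def)
  then have "f - 622 * real (N + 1) - 244 * z \<le> f1" using assms(8) by simp
  ultimately show ?thesis
    using assms \<open>minima_base < stack_base\<close> \<open>minima_base < columns_base\<close>
    by (auto simp: smawk_inv_def interpolated_def simp flip: z_def)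
qed

lemma smawk_inv_fuel:
  assumes "smawk_inv css cs R M f R' M' f'"
  shows "f - 870 * real (N + 1) + 1 \<le> f'"
proof -
  have "real N / 2 ^ length css \<le> real N" by (simp add: divide_le_eq mult_le_cancel_left1)
  moreover have "f - 622 * real (N + 1) - 244 * (real N / 2 ^ length css) \<le> f'"
    using assms unfolding smawk_inv_def by blast
  ultimately show ?thesis by simp
qed

lemma smawk_inv_end:
  assumes "smawk_inv [] cs R M f R' M' f'"
  shows "\<exists>t. \<forall>r\<le>N. row_min r (t r) \<and> M' (minima_base + r) = real (t r)"
proof -
  have "rows 1 = {..N}" by (auto simp: rows_def)
  then show ?thesis
    using assms by (fastforce simp: smawk_inv_def interpolated_def row_mins_def minima_stored_def)
qed

lemma wp_smawk:
  assumes "ready R M"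
  shows "wp cells smawk_code (\<lambda>R' M' Y' f'. Y' = Y \<and> agree_on {..<30} R R' \<and>
    agree_on {..<minima_base} M M' \<and> agree_on {stack_base..<columns_base} M M' \<and>
    (\<exists>t. \<forall>r\<le>N. row_min r (t r) \<and> M' (minima_base + r) = real (t r)) \<and> f - 870 * real (N + 1) \<le> f') R M Y f"
    (is "wp _ _ ?Q _ _ _ _")
  unfolding smawk_code_def
proof (rule wp_Seq[OF wp_descend[OF assms]], elim conjE exE)
  fix R1 M1 Y1 f1 css e
  assume R1: "column_lists M1 css e" "e \<le> cells" "N < 2 ^ length css" "R1 r_gap = 2 ^ length css"
    "R1 r_hi = real e" "agree_on {..<31} R R1" "agree_on {..<columns_base} M M1"
    "f - 620 * real (N + 1) \<le> f1" "Y1 = Y"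
  define I where "I = (\<lambda>R' M' Y' f'. Y' = Y \<and> (\<exists>css cs. smawk_inv css cs R M f R' M' f'))"
  have "wp cells (Until r_gap2 r_one interpolate_code) ?Q
      (R1(r_gap2 := 2 ^ length css)) (M1(minima_base := 0)) Y (f1 - 2)"
  proof (rule wp_Until[where I = I and B = "f - 870 * real (N + 1) + 1"])
    have "smawk_inv css [0] R M f (R1(r_gap2 := 2 ^ length css)) (M1(minima_base := 0)) (f1 - 2)"
      by (rule smawk_inv_start) (use R1 in auto)
    then show "I (R1(r_gap2 := 2 ^ length css)) (M1(minima_base := 0)) Y (f1 - 2)" unfolding I_def by blast
  next
    fix R2 M2 Y2 f2 assume "I R2 M2 Y2 f2"
    then show "f - 870 * real (N + 1) + 1 \<le> f2" unfolding I_def using smawk_inv_fuel by blast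
  next
    fix R2 M2 Y2 f2 assume "I R2 M2 Y2 f2" and exit: "R2 r_gap2 \<le> R2 r_one"
    then obtain css cs where inv: "Y2 = Y" "smawk_inv css cs R M f R2 M2 f2" unfolding I_def by blast
    then have "(2::real) ^ length css \<le> 1"
      using exit ready_regs[OF assms] by (auto simp: smawk_inv_def interpolated_def)
    then have "css = []" using one_less_power[of "2::real" "length css"] by fastforce
    then show "?Q R2 M2 Y2 (f2 - 1)"
      using inv smawk_inv_end smawk_inv_fuel[OF inv(2)] by (auto simp: smawk_inv_def)
  next
    fix R2 M2 Y2 f2 assume "I R2 M2 Y2 f2" "R2 r_one < R2 r_gap2"
    then show "wp cells interpolate_code I R2 M2 Y2 (f2 - 2)"
      unfolding I_def using wp_smawk_step[OF assms] by blast
  qed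
  moreover have "R1 r_minima = real minima_base" "R1 r_zero = 0" "minima_base < cells"
    using R1(6) ready_regs[OF assms] layout by auto
  ultimately show "wp cells (Block [Move r_gap2 r_gap, Store r_minima r_zero] ;;
      Until r_gap2 r_one interpolate_code) ?Q R1 M1 Y1 f1"
    using R1(4,9) by (intro wp_Block_Seq) simp
qed

end

section \<open>Layers of the dynamic program\<close>

definition separator_code :: com where
  "separator_code =
    Block [Sub r_ptr r_ptr r_one, Add r_tmp r_minima r_ptr, Load r_col r_tmp] ;;
    Cond r_col r_ptr (Block []) (Block [Move r_col r_ptr])"

definition cross_code :: com where
  "cross_code =
    Cond r_count r_half (Block [])
      (Block [Add r_tmp r_cross r_col, Load r_tmp' r_tmp, Add r_tmp r_cross r_ptr, Store r_tmp r_tmp'])"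

definition update_code :: com where
  "update_code =
    separator_code ;; cost_code r_ptr r_col ;; Block [Add r_tmp r_layer r_ptr, Store r_tmp r_val] ;;
      cross_code"

definition layer_code :: com where
  "layer_code = smawk_code ;; Block [Move r_ptr r_len1] ;; Until r_ptr r_zero update_code"

context sorted_points begin

definition crossings_stored :: "nat \<Rightarrow> nat \<Rightarrow> nat \<Rightarrow> nat \<Rightarrow> (nat \<Rightarrow> real) \<Rightarrow> bool" where
  "crossings_stored h k a N M \<longleftrightarrow> (\<exists>c. \<forall>j\<le>N. M (cross_base + j) = real (c j) \<and> crossing x h k a j (c j))"

lemma layer_cross_write:
  assumes "k < width" "j < width"
  shows "(M(layer_base + k := u, cross_base + k := v)) (layer_base + j) =
      (if j = k then u else M (layer_base + j))"
    and "(M(layer_base + k := u, cross_base + k := v)) (cross_base + j) =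
      (if j = k then v else M (cross_base + j))"
    and "(M(layer_base + k := u, cross_base + k := v)) (minima_base + j) = M (minima_base + j)"
  using assms layout(4,5) by auto

lemma layer_cross_write_agree:
  assumes "k < width"
  shows "agree_on persistent M (M(layer_base + k := u, cross_base + k := v))"
  using assms layout(4-6) by auto

end

context pieces begin

context
  fixes R :: "reg \<Rightarrow> real" and M :: "nat \<Rightarrow> real" and Y :: "real list"
    and h :: nat and old :: "nat \<Rightarrow> nat" and t :: "nat \<Rightarrow> nat"
  assumes ready: "ready R M" and regs: "R r_half = real h" "R r_count = real (q + 2)"
    and old: "\<forall>j\<le>N. M (cross_base + j) = real (old j)" and t: "\<forall>r\<le>N. row_min r (t r)"
begin

text \<open>
  Beyond the diagonal a column costs as much as the diagonal one or more, so that clamping a row minimum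
  to the diagonal preserves it.
\<close>

definition separator :: "nat \<Rightarrow> nat" where
  "separator j = min (t j) j"

definition new_cross :: "nat \<Rightarrow> nat" where
  "new_cross j = (if q + 2 \<le> h then old j else old (separator j))"

definition update_inv :: "nat \<Rightarrow> (reg \<Rightarrow> real) \<Rightarrow> (nat \<Rightarrow> real) \<Rightarrow> bool" where
  "update_inv k R' M' \<longleftrightarrow> agree_on {..<30} R R' \<and> R' r_ptr = real k \<and>
    agree_on persistent M M' \<and>
    (\<forall>j\<le>N. M' (layer_base + j) = opt x (if j < k then q else Suc q) a (a + j) \<and>
      M' (cross_base + j) = real (if j < k then old j else new_cross j) \<and> M' (minima_base + j) = real (t j))"

lemma separator_optimal:
  assumes "j \<le> N"
  shows "separator j \<le> j" "opt x (Suc q) a (a + j) = A j (separator j)"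
proof -
  show "separator j \<le> j" by (simp add: separator_def)
  show "opt x (Suc q) a (a + j) = A j (separator j)"
    unfolding separator_def using t assms by (intro opt_Suc_row_min) (auto simp: row_min_def)
qed

lemma wp_separator:
  assumes inv: "update_inv (Suc k) R1 M1" and k: "k \<le> N"
  shows "wp cells separator_code (\<lambda>R' M' Y' f'. M' = M1 \<and> Y' = Y \<and> agree_on {..<40} R1 R' \<and>
    R' r_ptr = real k \<and> R' r_col = real (separator k) \<and> f - 6 \<le> f') R1 M1 Y f"
    (is "wp _ _ ?Q _ _ _ _")
proof -
  define R2 where "R2 = R1(r_ptr := real k, r_tmp := real minima_base + real k, r_col := real (t k))"
  have "wp cells (Cond r_col r_ptr (Block []) (Block [Move r_col r_ptr])) ?Q R2 M1 Y (f - 3)"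
    by (intro wp_Cond wp_Block) (auto simp: R2_def separator_def)
  moreover have "R1 r_ptr = real (Suc k)" "R1 r_one = 1" "R1 r_minima = real minima_base"
    "M1 (minima_base + k) = real (t k)"
    using inv k ready_regs[OF ready] by (auto simp: update_inv_def)
  moreover have "minima_base + k < cells" using k length_less_width layout by linarith
  ultimately show ?thesis unfolding separator_code_def by (intro wp_Block_Seq) (simp add: R2_def)
qed

lemma wp_cross:
  assumes R1: "agree_on {..<30} R R1" "R1 r_ptr = real k" "R1 r_col = real (separator k)" and k: "k \<le> N"
    and M1: "M1 (cross_base + k) = real (old k)" "M1 (cross_base + separator k) = real (old (separator k))"
  shows "wp cells cross_code (\<lambda>R' M' Y' f'. M' = M1(cross_base + k := real (new_cross k)) \<and> Y' = Y \<and>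
    agree_on {..<48} R1 R' \<and> f - 6 \<le> f') R1 M1 Y f"
    (is "wp _ _ ?Q _ _ _ _")
  unfolding cross_code_def
proof (rule wp_Cond)
  assume "R1 r_count \<le> R1 r_half"
  then have "q + 2 \<le> h" using R1(1) regs by simp
  then have "M1(cross_base + k := real (new_cross k)) = M1" using M1(1) by (simp add: new_cross_def fun_upd_idem)
  then show "wp cells (Block []) ?Q R1 M1 Y (f - 2)" by (intro wp_Block) simp
next
  assume "R1 r_half < R1 r_count"
  then have "new_cross k = old (separator k)" using R1(1) regs by (simp add: new_cross_def)
  moreover have "cross_base + k < cells" "cross_base + separator k < cells"
    using separator_optimal(1)[OF k] k length_less_width layout by linarith+
  ultimately show "wp cells (Block [Add r_tmp r_cross r_col, Load r_tmp' r_tmp, Add r_tmp r_cross r_ptr,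
      Store r_tmp r_tmp']) ?Q R1 M1 Y (f - 2)"
    using R1 M1(2) ready_regs[OF ready] by (intro wp_Block) simp
qed

lemma update_inv_write:
  assumes inv: "update_inv (Suc k) R1 M1" and k: "k \<le> N"
    and R2: "agree_on {..<30} R1 R2" "R2 r_ptr = real k"
  shows "update_inv k R2 (M1(layer_base + k := opt x (Suc q) a (a + k), cross_base + k := real (new_cross k)))"
    (is "update_inv k R2 ?M")
proof -
  note inv_facts = inv[unfolded update_inv_def]
  have width: "j < width" if "j \<le> N" for j using that length_less_width by simp
  have "?M (layer_base + j) = opt x (if j < k then q else Suc q) a (a + j) \<and>
      ?M (cross_base + j) = real (if j < k then old j else new_cross j) \<and> ?M (minima_base + j) = real (t j)"
        if "j \<le> N" for j
    unfolding layer_cross_write[OF width[OF k] width[OF that]] using inv_facts that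
    by (auto simp: less_Suc_eq)
  moreover have "agree_on persistent M1 ?M"
    by (rule layer_cross_write_agree[OF width[OF k]])
  ultimately show ?thesis using inv_facts R2 by (simp add: update_inv_def)
qed

lemma wp_update:
  assumes inv: "update_inv (Suc k) R1 M1" and k: "k \<le> N"
  shows "wp cells update_code (\<lambda>R' M' Y' f'. Y' = Y \<and> update_inv k R' M' \<and> f - 33 \<le> f') R1 M1 Y f"
    (is "wp _ _ ?Q _ _ _ _")
  unfolding update_code_def
proof (rule wp_Seq[OF wp_separator[OF inv k]], elim conjE, hypsubst)
  fix R2 f2
  assume R2: "agree_on {..<40} R1 R2" "R2 r_ptr = real k" "R2 r_col = real (separator k)" "f - 6 \<le> f2"
  note inv_facts = inv[unfolded update_inv_def]
  have sep: "separator k \<le> k" by (rule separator_optimal(1)[OF k])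
  show "wp cells (cost_code r_ptr r_col ;; Block [Add r_tmp r_layer r_ptr, Store r_tmp r_val] ;;
    cross_code) ?Q R2 M1 Y f2"
  proof (rule wp_evaluates_Seq)
    have "globals R2 M1" "piece a N R2"
      using ready inv_facts R2(1) by (auto simp: ready_def intro: globals_agree piece_agree)
    moreover have "M1 (layer_base + separator k) = opt x q a (a + separator k)" using inv_facts sep k by simp
    ultimately show "evaluates (cost_code r_ptr r_col) (A k (separator k)) 19 R2 M1"
      using R2 k sep by (intro evaluates_cost_code[where N = N]) auto
    fix R3 f3 assume R3: "agree_on {..<50} R2 R3" "R3 r_val = A k (separator k)" "f2 - real 19 \<le> f3"
    define M2 where "M2 = M1(layer_base + k := opt x (Suc q) a (a + k))"
    define R4 where "R4 = R3(r_tmp := real layer_base + real k)"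
    have disj: "layer_base + k < cross_base" "layer_base + k < cells"
      using k length_less_width layout by linarith+
    have "wp cells cross_code (\<lambda>R' M' Y' f'. M' = M2(cross_base + k := real (new_cross k)) \<and> Y' = Y \<and>
        agree_on {..<48} R4 R' \<and> f3 - 2 - 6 \<le> f') R4 M2 Y (f3 - 2)"
      using inv_facts R2 R3 k sep disj by (intro wp_cross) (auto simp: R4_def M2_def)
    then have "wp cells cross_code ?Q R4 M2 Y (f3 - 2)"
      by (rule wp_mono) (use R2 R3 update_inv_write[OF inv k] in \<open>auto simp: R4_def M2_def\<close>)
    moreover have "R3 r_layer = real layer_base" "R3 r_ptr = real k"
      using inv_facts R2 R3(1) ready_regs[OF ready] by auto
    ultimately show "wp cells (Block [Add r_tmp r_layer r_ptr, Store r_tmp r_val] ;;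
      cross_code) ?Q R3 M1 Y f3"
      using R3(2) separator_optimal(2)[OF k] disj(2) by (intro wp_Block_Seq) (simp add: R4_def M2_def)
  qed
qed

lemma wp_updates:
  assumes "update_inv (N + 1) R1 M1"
  shows "wp cells (Until r_ptr r_zero update_code) (\<lambda>R' M' Y' f'. Y' = Y \<and> update_inv 0 R' M' \<and>
    f - 35 * real (N + 1) - 1 \<le> f') R1 M1 Y f"
proof -
  define P where "P i R' M' Y' \<longleftrightarrow> Y' = Y \<and> update_inv (N + 1 - i) R' M'" for i R' M' Y'
  have "wp cells (Until r_ptr r_zero update_code)
      (\<lambda>R' M' Y' f'. P (N + 1) R' M' Y' \<and> f - (33 + 2) * real (N + 1) - 1 \<le> f') R1 M1 Y f"
  proof (rule wp_Until_count)
    show "P 0 R1 M1 Y" using assms by (simp add: P_def)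
    show "R' r_ptr \<le> R' r_zero \<longleftrightarrow> i = N + 1" if "i \<le> N + 1" "P i R' M' Y'" for i R' M' Y'
      using that ready_regs[OF ready] by (auto simp: P_def update_inv_def)
    fix i R' M' Y' f' assume "i < N + 1" "P i R' M' Y'"
    moreover from this have "N + 1 - i = Suc (N - i)" "N + 1 - Suc i = N - i" by auto
    ultimately show "wp cells update_code (\<lambda>R' M' Y' f''. P (Suc i) R' M' Y' \<and> f' - 33 \<le> f'') R' M' Y' f'"
      using wp_update[of "N - i" R' M' f'] by (simp add: P_def)
  qed simp
  then show ?thesis by (rule wp_mono) (simp add: P_def)
qed

lemma update_inv_start:
  assumes "agree_on {..<30} R R1" "R1 r_ptr = real (N + 1)" "agree_on {..<minima_base} M M1"
    and "agree_on {stack_base..<columns_base} M M1" "\<And>r. r \<le> N \<Longrightarrow> M1 (minima_base + r) = real (t r)"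
  shows "update_inv (N + 1) R1 M1"
proof -
  have "layer_base + j < minima_base" "cross_base + j < minima_base" if "j \<le> N" for j
    using that length_less_width layout by linarith+
  then show ?thesis
    using assms ready old layout by (auto simp: update_inv_def ready_def layer_stored_def)
qed

lemma update_inv_end:
  assumes "update_inv 0 R' M'" and cross: "\<And>j. j \<le> N \<Longrightarrow> crossing x h q a j (old j)" and "0 < h"
  shows "layer_stored (Suc q) a N M'" "crossings_stored h (Suc q) a N M'"
proof -
  show "layer_stored (Suc q) a N M'" using assms(1) by (simp add: update_inv_def layer_stored_def)
  have "crossing x h (Suc q) a j (new_cross j)" if j: "j \<le> N" for j
  proof (cases "q + 2 \<le> h")
    case True
    then show ?thesis using cross[OF j] by (simp add: new_cross_def crossing_def)
  next
    case False
    have "crossing x h q a (separator j) (old (separator j))" using cross separator_optimal(1)[OF j] j by simp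
    then have "crossing x h (Suc q) a j (old (separator j))"
      using separator_optimal[OF j] False \<open>0 < h\<close> by (intro crossing_Suc) (auto simp: last_sep_cost_def)
    then show ?thesis using False by (simp add: new_cross_def)
  qed
  then show "crossings_stored h (Suc q) a N M'"
    using assms(1) by (auto simp: crossings_stored_def update_inv_def)
qed

end

lemma wp_layer:
  assumes "ready R M" "crossings_stored h q a N M" "0 < h" "R r_half = real h" "R r_count = real (q + 2)"
  shows "wp cells layer_code (\<lambda>R' M' Y' f'. Y' = Y \<and> agree_on {..<30} R R' \<and>
    agree_on persistent M M' \<and>
    layer_stored (Suc q) a N M' \<and> crossings_stored h (Suc q) a N M' \<and> f - 910 * real (N + 1) \<le> f') R M Y f"
    (is "wp _ _ ?Q _ _ _ _")
  unfolding layer_code_def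
proof (rule wp_Seq[OF wp_smawk[OF assms(1)]], elim conjE exE)
  fix R1 M1 Y1 f1 t
  assume R1: "Y1 = Y" "agree_on {..<30} R R1" "agree_on {..<minima_base} M M1"
      "agree_on {stack_base..<columns_base} M M1" "f - 870 * real (N + 1) \<le> f1"
    and t: "\<forall>r\<le>N. row_min r (t r) \<and> M1 (minima_base + r) = real (t r)"
  obtain old where old: "\<forall>j\<le>N. M (cross_base + j) = real (old j)"
      "\<And>j. j \<le> N \<Longrightarrow> crossing x h q a j (old j)"
    using assms(2) unfolding crossings_stored_def by blast
  have mins: "\<forall>r\<le>N. row_min r (t r)" using t by blast
  note updates = assms(1,4,5) old(1) mins
  have "update_inv R M h old t (N + 1) (R1(r_ptr := real (N + 1))) M1"
    by (rule update_inv_start[OF updates]) (use R1 t in auto)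
  then have "wp cells (Until r_ptr r_zero update_code) (\<lambda>R' M' Y' f'. Y' = Y \<and>
      update_inv R M h old t 0 R' M' \<and> f1 - 1 - 35 * real (N + 1) - 1 \<le> f')
      (R1(r_ptr := real (N + 1))) M1 Y (f1 - 1)"
    by (rule wp_updates[OF updates])
  then have "wp cells (Until r_ptr r_zero update_code) ?Q (R1(r_ptr := real (N + 1))) M1 Y (f1 - 1)"
  proof (rule wp_mono, elim conjE, intro conjI)
    fix R2 M2 Y2 f2
    assume inv: "update_inv R M h old t 0 R2 M2" and f2: "f1 - 1 - 35 * real (N + 1) - 1 \<le> f2"
    show "layer_stored (Suc q) a N M2" "crossings_stored h (Suc q) a N M2"
      using update_inv_end[OF updates inv old(2) \<open>0 < h\<close>] by simp_all
    show "agree_on {..<30} R R2" "agree_on persistent M M2"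
      using inv by (simp_all add: update_inv_def[OF updates])
    show "f - 910 * real (N + 1) \<le> f2" using f2 R1(5) by simp
  qed
  moreover have "R1 r_len1 = real (N + 1)" using R1(2) ready_regs[OF assms(1)] by simp
  ultimately show "wp cells (Block [Move r_ptr r_len1] ;; Until r_ptr r_zero update_code) ?Q R1 M1 Y1 f1"
    using R1(1) by (intro wp_Block_Seq) simp
qed

end

section \<open>Splitting a clustering in the middle\<close>

definition half_step_code :: com where
  "half_step_code = Block [Add r_half r_half r_one, Add r_tmp r_tmp r_one, Add r_tmp r_tmp r_one]"

definition half_code :: com where
  "half_code =
    Block [Const r_half 1, Const r_tmp 3] ;;
    Until r_clusters r_tmp half_step_code"

definition first_layer_step_code :: com where
  "first_layer_step_code =
    sse_code r_ptr r_zero ;;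
    Block
      [Add r_tmp r_layer r_ptr, Store r_tmp r_val, Add r_tmp r_cross r_ptr, Store r_tmp r_ptr,
       Add r_ptr r_ptr r_one]"

definition first_layer_code :: com where
  "first_layer_code =
    Block [Const r_ptr 0] ;;
    Until r_len1 r_ptr
      first_layer_step_code"

definition next_layer_code :: com where
  "next_layer_code = layer_code ;; Block [Add r_count r_count r_one]"

definition next_layers_code :: com where
  "next_layers_code =
    Block [Const r_count 2] ;;
    Until r_last r_count next_layer_code"

definition layers_code :: com where
  "layers_code = first_layer_code ;; next_layers_code"

definition find_cut_code :: com where
  "find_cut_code = half_code ;; layers_code ;; Block [Add r_tmp r_cross r_len, Load r_cut r_tmp]"

definition split_code :: com where
  "split_code =
    Block
      [Sub r_len r_end r_start, Add r_len1 r_len r_one, Add r_sums_at r_width r_start,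
       Add r_squares_at r_squares r_start, Add r_last r_clusters r_one] ;;
    find_cut_code"

context sorted_points begin

lemma wp_half:
  assumes "globals R M" "R r_clusters = real q" "2 \<le> q"
  shows "wp cells half_code (\<lambda>R' M' Y' f'. M' = M \<and> Y' = Y \<and> agree_on ({..<22} \<union> {r_last}) R R' \<and>
    R' r_half = real (q div 2) \<and> f - 5 * real q \<le> f') R M Y f"
    (is "wp _ _ ?Q _ _ _ _")
proof -
  define P where "P i R' M' Y' \<longleftrightarrow> M' = M \<and> Y' = Y \<and> agree_on ({..<22} \<union> {r_last}) R R' \<and>
    R' r_half = real (Suc i) \<and> R' r_tmp = real (2 * i + 3)" for i R' M' Y'
  have "wp cells (Until r_clusters r_tmp half_step_code)
      (\<lambda>R' M' Y' f'. P (q div 2 - 1) R' M' Y' \<and> f - 2 - (3 + 2) * real (q div 2 - 1) - 1 \<le> f')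
      (R(r_half := 1, r_tmp := 3)) M Y (f - 2)"
  proof (rule wp_Until_count)
    show "P 0 (R(r_half := 1, r_tmp := 3)) M Y" by (simp add: P_def)
    fix i R' M' Y' assume "i \<le> q div 2 - 1" "P i R' M' Y'"
    moreover have "real q \<le> real (2 * i + 3) \<longleftrightarrow> q \<le> 2 * i + 3" by (rule of_nat_le_iff)
    moreover have "q \<le> 2 * i + 3 \<longleftrightarrow> q div 2 - 1 \<le> i" using assms(3) by linarith
    ultimately show "R' r_clusters \<le> R' r_tmp \<longleftrightarrow> i = q div 2 - 1"
      using assms(2) by (auto simp: P_def)
  next
    fix i R' M' Y' f' assume "P i R' M' Y'"
    then show "wp cells half_step_code
        (\<lambda>R' M' Y' f''. P (Suc i) R' M' Y' \<and> f' - 3 \<le> f'') R' M' Y' f'"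
      using assms(1) unfolding half_step_code_def by (intro wp_Block) (auto simp: P_def globals_def)
  qed simp
  then have "wp cells (Until r_clusters r_tmp half_step_code) ?Q (R(r_half := 1, r_tmp := 3)) M Y (f - 2)"
  proof (rule wp_mono, elim conjE)
    fix R' M' Y' f' assume "P (q div 2 - 1) R' M' Y'" "f - 2 - (3 + 2) * real (q div 2 - 1) - 1 \<le> f'"
    moreover have "real (q div 2 - 1) + 1 \<le> real q" "Suc (q div 2 - 1) = q div 2" using assms(3) by linarith+
    ultimately show "?Q R' M' Y' f'" by (simp add: P_def)
  qed
  then show ?thesis unfolding half_code_def by (intro wp_Block_Seq) simp
qed

definition first_layer_inv :: "nat \<Rightarrow> nat \<Rightarrow> (reg \<Rightarrow> real) \<Rightarrow> (nat \<Rightarrow> real) \<Rightarrow> (reg \<Rightarrow> real) \<Rightarrow> (nat \<Rightarrow> real) \<Rightarrow>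
    bool" where
  "first_layer_inv a i R M R' M' \<longleftrightarrow> agree_on {..<30} R R' \<and> agree_on persistent M M' \<and> R' r_ptr = real i \<and>
    (\<forall>j<i. M' (layer_base + j) = sse x a (a + j) \<and> M' (cross_base + j) = real j)"

lemma first_layer_inv_write:
  assumes inv: "first_layer_inv a i R M R1 M1" and "i < width"
    and "agree_on {..<40} R1 R2" "R2 r_ptr = real (Suc i)"
  shows "first_layer_inv a (Suc i) R M R2 (M1(layer_base + i := sse x a (a + i), cross_base + i := real i))"
    (is "first_layer_inv _ _ _ _ _ ?M")
proof -
  have "?M (layer_base + j) = sse x a (a + j) \<and> ?M (cross_base + j) = real j" if "j < Suc i" for j
  proof -
    have "j < width" using that \<open>i < width\<close> by simp
    then show ?thesis
      unfolding layer_cross_write(1,2)[OF \<open>i < width\<close> \<open>j < width\<close>]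
      using inv that by (auto simp: first_layer_inv_def less_Suc_eq)
  qed
  moreover have "agree_on persistent M1 ?M"
    by (rule layer_cross_write_agree[OF \<open>i < width\<close>])
  ultimately show ?thesis using assms by (simp add: first_layer_inv_def)
qed

lemma wp_first_layer_step:
  assumes start: "globals R M" "piece a N R" and inv: "first_layer_inv a i R M R1 M1" and "i \<le> N"
  shows "wp cells first_layer_step_code
    (\<lambda>R' M' Y' f'. Y' = Y \<and> first_layer_inv a (Suc i) R M R' M' \<and> f - 21 \<le> f') R1 M1 Y f"
    (is "wp _ _ ?Q _ _ _ _")
  unfolding first_layer_step_code_def
proof (rule wp_evaluates_Seq)
  have R1: "globals R1 M1" "piece a N R1" "R1 r_ptr = real i"
    using start inv by (auto simp: first_layer_inv_def intro: globals_agree piece_agree)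
  note globals_R1 = R1(1)[unfolded globals_def]
  show "evaluates (sse_code r_ptr r_zero) (sse x (a + 0) (a + i)) 16 R1 M1"
    using R1 \<open>i \<le> N\<close> globals_R1 by (intro evaluates_sse_code) auto
  fix R2 f2 assume R2: "agree_on {..<50} R1 R2" "R2 r_val = sse x (a + 0) (a + i)" "f - real 16 \<le> f2"
  define R3 where "R3 = R2(r_tmp := real cross_base + real i, r_ptr := real i + 1)"
  have bounds: "i < width" "layer_base + i < cells" "cross_base + i < cells"
    using \<open>i \<le> N\<close> start(2) layout by (auto simp: piece_def)
  have "first_layer_inv a (Suc i) R M R3 (M1(layer_base + i := sse x a (a + i), cross_base + i := real i))"
    using inv bounds(1) by (rule first_layer_inv_write) (use R2 in \<open>auto simp: R3_def\<close>)
  then show "wp cells (Block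
      [Add r_tmp r_layer r_ptr, Store r_tmp r_val, Add r_tmp r_cross r_ptr, Store r_tmp r_ptr,
       Add r_ptr r_ptr r_one]) ?Q R2 M1 Y f2"
    using R2 R1(3) globals_R1 bounds by (intro wp_Block) (simp add: R3_def)
qed

lemma wp_first_layer:
  assumes start: "globals R M" "piece a N R" and "0 < h"
  shows "wp cells first_layer_code (\<lambda>R' M' Y' f'. Y' = Y \<and> agree_on {..<30} R R' \<and> agree_on persistent M M' \<and>
    layer_stored 0 a N M' \<and> crossings_stored h 0 a N M' \<and> f - 25 * real (N + 1) \<le> f') R M Y f"
    (is "wp _ _ ?Q _ _ _ _")
proof -
  define P where "P i R' M' Y' \<longleftrightarrow> Y' = Y \<and> first_layer_inv a i R M R' M'" for i R' M' Y'
  have "wp cells (Until r_len1 r_ptr first_layer_step_code)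
      (\<lambda>R' M' Y' f'. P (N + 1) R' M' Y' \<and> f - 1 - (21 + 2) * real (N + 1) - 1 \<le> f')
      (R(r_ptr := 0)) M Y (f - 1)"
  proof (rule wp_Until_count)
    show "P 0 (R(r_ptr := 0)) M Y" by (simp add: P_def first_layer_inv_def)
    show "R' r_len1 \<le> R' r_ptr \<longleftrightarrow> i = N + 1" if "i \<le> N + 1" "P i R' M' Y'" for i R' M' Y'
      using that start(2) by (auto simp: P_def first_layer_inv_def piece_def)
    fix i R' M' Y' f' assume "i < N + 1" "P i R' M' Y'"
    then show "wp cells first_layer_step_code (\<lambda>R' M' Y' f''. P (Suc i) R' M' Y' \<and> f' - 21 \<le> f'') R' M' Y' f'"
      using wp_first_layer_step[OF start, of i R' M' Y'] by (simp add: P_def)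
  qed simp
  then have "wp cells (Until r_len1 r_ptr first_layer_step_code) ?Q (R(r_ptr := 0)) M Y (f - 1)"
    by (rule wp_mono) (use \<open>0 < h\<close> in \<open>auto simp: P_def first_layer_inv_def layer_stored_def crossings_stored_def
      crossing_def intro!: exI[of _ "\<lambda>j. j"]\<close>)
  then show ?thesis unfolding first_layer_code_def by (intro wp_Block_Seq) simp
qed

lemma wp_next_layer:
  assumes start: "globals R M" "piece a N R" "layer_stored k a N M" "crossings_stored h k a N M"
    and "0 < h" "R r_half = real h" "R r_count = real (k + 2)"
  shows "wp cells next_layer_code (\<lambda>R' M' Y' f'. Y' = Y \<and> agree_on ({..<30} - {r_count}) R R' \<and>
    R' r_count = real (Suc k + 2) \<and> agree_on persistent M M' \<and> layer_stored (Suc k) a N M' \<and>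
    crossings_stored h (Suc k) a N M' \<and> f - (910 * real (N + 1) + 1) \<le> f') R M Y f"
proof -
  interpret pieces x n k a N by unfold_locales (use start(2) in \<open>simp add: piece_def\<close>)
  have "ready R M" using start by (simp add: ready_def)
  from wp_layer[OF this assms(4-7)] show ?thesis
    unfolding next_layer_code_def
    by (rule wp_Seq) (intro wp_Block, use assms(7) ready_regs[OF \<open>ready R M\<close>] in auto)
qed

lemma wp_next_layers:
  assumes start: "globals R M" "piece a N R" "layer_stored 0 a N M" "crossings_stored h 0 a N M"
    and h: "0 < h" "R r_half = real h" and q: "0 < q" "R r_last = real (q + 1)"
  shows "wp cells next_layers_code (\<lambda>R' M' Y' f'. Y' = Y \<and> agree_on {..<23} R R' \<and>
    agree_on persistent M M' \<and> crossings_stored h (q - 1) a N M' \<and>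
    f - 913 * (real q * real (N + 1)) \<le> f') R M Y f"
    (is "wp _ _ ?Q _ _ _ _")
proof -
  define P where "P k R' M' Y' \<longleftrightarrow> Y' = Y \<and> agree_on ({..<30} - {r_count}) R R' \<and> R' r_count = real (k + 2) \<and>
    agree_on persistent M M' \<and> layer_stored k a N M' \<and> crossings_stored h k a N M'" for k R' M' Y'
  have "wp cells (Until r_last r_count next_layer_code)
      (\<lambda>R' M' Y' f'. P (q - 1) R' M' Y' \<and> f - 1 - (910 * real (N + 1) + 1 + 2) * real (q - 1) - 1 \<le> f')
      (R(r_count := 2)) M Y (f - 1)"
  proof (rule wp_Until_count)
    show "P 0 (R(r_count := 2)) M Y" using start by (simp add: P_def)
    show "R' r_last \<le> R' r_count \<longleftrightarrow> k = q - 1" if "k \<le> q - 1" "P k R' M' Y'" for k R' M' Y'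
      using that q by (auto simp: P_def)
    fix k R' M' Y' f' assume P: "P k R' M' Y'"
    have "globals R' M'" "piece a N R'"
      using start P by (auto simp: P_def intro: globals_agree piece_agree)
    moreover have "layer_stored k a N M'" "crossings_stored h k a N M'" "R' r_half = real h"
      "R' r_count = real (k + 2)"
      using P h(2) by (simp_all add: P_def)
    ultimately show "wp cells next_layer_code
        (\<lambda>R' M' Y' f''. P (Suc k) R' M' Y' \<and> f' - (910 * real (N + 1) + 1) \<le> f'') R' M' Y' f'"
      using P h(1) by (intro wp_mono[OF wp_next_layer[of R' M' a N k h]]) (auto simp: P_def)
  qed simp
  moreover have "(910 * real (N + 1) + 1 + 2) * real (q - 1) \<le> 913 * real (N + 1) * (real q - 1)"
    using q(1) by (simp add: of_nat_diff mult_right_mono)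
  then have "f - 913 * (real q * real (N + 1)) \<le> f - 1 - (910 * real (N + 1) + 1 + 2) * real (q - 1) - 1"
    by (simp add: algebra_simps)
  ultimately have "wp cells (Until r_last r_count next_layer_code) ?Q (R(r_count := 2)) M Y (f - 1)"
    by (elim wp_mono) (auto simp: P_def)
  then show ?thesis unfolding next_layers_code_def by (intro wp_Block_Seq) simp
qed

lemma wp_layers:
  assumes "globals R M" "piece a N R" and h: "0 < h" "R r_half = real h"
    and q: "2 \<le> q" "R r_last = real (q + 1)"
  shows "wp cells layers_code (\<lambda>R' M' Y' f'. Y' = Y \<and> agree_on {..<23} R R' \<and> agree_on persistent M M' \<and>
    crossings_stored h (q - 1) a N M' \<and>
    f - 930 * (real q * real (N + 1)) \<le> f') R M Y f"
    (is "wp _ _ ?Q _ _ _ _")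
  unfolding layers_code_def
proof (rule wp_Seq[OF wp_first_layer[OF assms(1,2) h(1)]], elim conjE, hypsubst)
  fix R1 M1 f1
  assume R1: "agree_on {..<30} R R1" "agree_on persistent M M1"
    and stored: "layer_stored 0 a N M1" "crossings_stored h 0 a N M1" and f1: "f - 25 * real (N + 1) \<le> f1"
  have "globals R1 M1" "piece a N R1"
    using globals_agree[OF assms(1)] piece_agree[OF assms(2)] R1 by auto
  from wp_next_layers[OF this stored h(1), of q] have "wp cells next_layers_code (\<lambda>R' M' Y' f'. Y' = Y \<and>
      agree_on {..<23} R1 R' \<and> agree_on persistent M1 M' \<and>
      crossings_stored h (q - 1) a N M' \<and> f1 - 913 * (real q * real (N + 1)) \<le> f') R1 M1 Y f1"
    using R1 h(2) q by simp
  moreover have "2 * real (N + 1) \<le> real q * real (N + 1)" using q(1) by (intro mult_right_mono) auto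
  then have "f - 930 * (real q * real (N + 1)) \<le> f1 - 913 * (real q * real (N + 1))" using f1 by linarith
  ultimately show "wp cells next_layers_code ?Q R1 M1 Y f1"
    using R1 by (elim wp_mono) auto
qed

lemma wp_find_cut:
  assumes start: "globals R M" "piece a N R" and q: "2 \<le> q" "R r_clusters = real q" "R r_last = real (q + 1)"
  shows "wp cells find_cut_code (\<lambda>R' M' Y' f'. Y' = Y \<and> agree_on {..<18} R R' \<and> agree_on persistent M M' \<and>
    R' r_half = real (q div 2) \<and> (\<exists>c. R' r_cut = real c \<and> crossing x (q div 2) (q - 1) a N c) \<and>
    f - 945 * (real q * real (N + 1)) \<le> f') R M Y f"
    (is "wp _ _ ?Q _ _ _ _")
  unfolding find_cut_code_def
proof (rule wp_Seq[OF wp_half[OF start(1) q(2,1)]], elim conjE, hypsubst)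
  fix R1 f1
  assume R1: "agree_on ({..<22} \<union> {r_last}) R R1" "R1 r_half = real (q div 2)" "f - 5 * real q \<le> f1"
  have "globals R1 M" "piece a N R1" "0 < q div 2" "R1 r_last = real (q + 1)"
    using globals_agree[OF start(1)] piece_agree[OF start(2)] R1(1) q by auto
  from wp_layers[OF this(1-3) R1(2) q(1) this(4)]
  show "wp cells (layers_code ;; Block [Add r_tmp r_cross r_len, Load r_cut r_tmp]) ?Q R1 M Y f1"
  proof (rule wp_Seq, elim conjE, hypsubst)
    fix R2 M2 f2
    assume R2: "agree_on {..<23} R1 R2" "agree_on persistent M M2"
      and cross: "crossings_stored (q div 2) (q - 1) a N M2"
      and f2: "f1 - 930 * (real q * real (N + 1)) \<le> f2"
    obtain c where c: "M2 (cross_base + N) = real c" "crossing x (q div 2) (q - 1) a N c"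
      using cross unfolding crossings_stored_def by blast
    have "agree_on {..<18} R R2" "R2 r_cross = real cross_base" "R2 r_len = real N" "R2 r_half = real (q div 2)"
      using R2(1) R1 start by (auto simp: globals_def piece_def)
    moreover have "cross_base + N < cells" using start(2) layout by (simp add: piece_def)
    moreover have "real q * 1 \<le> real q * real (N + 1)" "2 \<le> real q" using q(1) by (auto intro!: mult_left_mono)
    then have "f - 945 * (real q * real (N + 1)) \<le> f2 - 2" using f2 R1(3) by linarith
    ultimately show "wp cells (Block [Add r_tmp r_cross r_len, Load r_cut r_tmp]) ?Q R2 M2 Y f2"
      using R2(2) c by (intro wp_Block) auto
  qed
qed

lemma wp_split:
  assumes globals: "globals R M" and "a + N \<le> n" and q: "2 \<le> q"
    and R: "R r_start = real a" "R r_clusters = real q" "R r_end = real (a + N)"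
  shows "wp cells split_code (\<lambda>R' M' Y' f'. Y' = Y \<and> agree_on {..<18} R R' \<and> agree_on persistent M M' \<and>
    R' r_half = real (q div 2) \<and> (\<exists>c. R' r_cut = real c \<and> crossing x (q div 2) (q - 1) a N c) \<and>
    f - 950 * (real q * real (N + 1)) \<le> f') R M Y f"
    (is "wp _ _ ?Q _ _ _ _")
proof -
  define R1 where "R1 = R(r_len := real N, r_len1 := real N + 1, r_sums_at := real width + real a,
    r_squares_at := real squares_base + real a, r_last := real q + 1)"
  have "globals R1 M" "piece a N R1" "R1 r_clusters = real q" "R1 r_last = real (q + 1)"
    using globals_agree[OF globals] R \<open>a + N \<le> n\<close> by (auto simp: R1_def piece_def)
  from wp_find_cut[OF this(1,2) q this(3,4)] have "wp cells find_cut_code ?Q R1 M Y (f - 5)"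
  proof (rule wp_mono)
    have "2 * 1 \<le> real q * real (N + 1)" using q by (intro mult_mono) auto
    then show "?Q R' M' Y' f'" if "Y' = Y \<and> agree_on {..<18} R1 R' \<and> agree_on persistent M M' \<and>
        R' r_half = real (q div 2) \<and> (\<exists>c. R' r_cut = real c \<and> crossing x (q div 2) (q - 1) a N c) \<and>
        f - 5 - 945 * (real q * real (N + 1)) \<le> f'" for R' M' Y' f'
      using that by (auto simp: R1_def)
  qed
  then show ?thesis unfolding split_code_def
    using R globals[unfolded globals_def] by (intro wp_Block_Seq) (simp add: R1_def)
qed

end

section \<open>The stack of pending pieces\<close>

text \<open>
  A stack entry \<open>(q, e)\<close> asks for \<open>q\<close> clusters of the points from the end of the previous piece
  up to \<open>e\<close>.
\<close>

type_synonym task = "nat \<times> nat"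

fun consecutive :: "nat \<Rightarrow> nat \<Rightarrow> task list \<Rightarrow> bool" where
  "consecutive n a [] \<longleftrightarrow> a = n"
| "consecutive n a ((q, e) # st) \<longleftrightarrow> 1 \<le> q \<and> a \<le> e \<and> e \<le> n \<and> consecutive n e st"

fun pending_cost :: "(nat \<Rightarrow> real) \<Rightarrow> nat \<Rightarrow> task list \<Rightarrow> real" where
  "pending_cost x a [] = 0"
| "pending_cost x a ((q, e) # st) = opt x (q - 1) a e + pending_cost x e st"

fun potential :: "nat \<Rightarrow> task list \<Rightarrow> real" where
  "potential a [] = 0"
| "potential a ((q, e) # st) = 4 * real q * (real e - real a) + (real q)\<^sup>2 + potential e st"

lemma consecutive_length: "consecutive n a st \<Longrightarrow> length st \<le> sum_list (map fst st)"
  by (induction st arbitrary: a) force+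

lemma potential_nonneg: "consecutive n a st \<Longrightarrow> 0 \<le> potential a st"
  by (induction a st rule: potential.induct) auto

lemma potential_halves:
  fixes q h c N :: nat
  assumes "2 \<le> q" "h = q div 2" "c \<le> N"
  shows "4 * real h * real c + (real h)\<^sup>2 + (4 * (real q - real h) * (real N - real c) + (real q - real h)\<^sup>2)
    + real q * (real N + 1) \<le> 4 * real q * real N + (real q)\<^sup>2"
proof -
  define g where "g = q - h"
  have g: "real q = real h + real g" "h \<le> g" "1 \<le> h" "q \<le> 2 * g" "q \<le> 4 * h"
    using assms(1,2) by (auto simp: g_def)
  define d where "d = N - c"
  have N: "real N = real c + real d" using assms(3) by (simp add: d_def)
  have "real h * real c \<le> real g * real c" using g(2) by (intro mult_right_mono) auto
  moreover have "real q * (real c + real d) \<le> 4 * real h * (real c + real d)"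
    using g(5) by (intro mult_right_mono) auto
  moreover have "1 * real q \<le> real h * (2 * real g)" using g(3,4) by (intro mult_mono) auto
  ultimately show ?thesis unfolding N g(1) by (simp add: power2_eq_square algebra_simps)
qed

lemma potential_split:
  assumes "2 \<le> q" "h = q div 2" "c \<le> N"
  shows "potential a ((h, a + c) # (q - h, a + N) # st) + real q * real (N + 1) \<le>
    potential a ((q, a + N) # st)"
  using potential_halves[OF assms] assms by (simp add: of_nat_diff algebra_simps)

lemma sum_sq_dist_snoc:
  assumes "a \<le> b" "0 < a \<longrightarrow> ys \<noteq> []" and \<mu>: "sq_dev x a b \<mu> = sse x a b"
  shows "(\<Sum>i=0..<b. sq_dist (set (ys @ [\<mu>])) (x i)) \<le> (\<Sum>i=0..<a. sq_dist (set ys) (x i)) + sse x a b"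
proof -
  have "(\<Sum>i=0..<b. sq_dist (set (ys @ [\<mu>])) (x i)) =
      (\<Sum>i=0..<a. sq_dist (set (ys @ [\<mu>])) (x i)) + (\<Sum>i=a..<b. sq_dist (set (ys @ [\<mu>])) (x i))"
    using assms(1) by (intro sum.atLeastLessThan_concat[symmetric]) auto
  also have "(\<Sum>i=0..<a. sq_dist (set (ys @ [\<mu>])) (x i)) \<le> (\<Sum>i=0..<a. sq_dist (set ys) (x i))"
    using assms(2) by (intro sum_mono sq_dist_antimono) auto
  also have "(\<Sum>i=a..<b. sq_dist (set (ys @ [\<mu>])) (x i)) \<le> (\<Sum>i=a..<b. (x i - \<mu>)\<^sup>2)"
    by (intro sum_mono sq_dist_le) auto
  finally show ?thesis using \<mu> by (simp add: sq_dev_def)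
qed

definition output_mean_code :: com where
  "output_mean_code =
    Block
      [Add r_tmp r_width r_end, Load r_tmp r_tmp, Add r_tmp' r_width r_start, Load r_tmp' r_tmp',
       Sub r_tmp r_tmp r_tmp', Sub r_tmp' r_end r_start, Div r_tmp r_tmp r_tmp', Output r_tmp]"

definition finish_task_code :: com where
  "finish_task_code = Block [Move r_start r_end, Sub r_sp r_sp r_one]"

text \<open>An empty cluster still needs a centroid; the first point serves as one.\<close>

definition emit_code :: com where
  "emit_code =
    Cond r_end r_start
      (Block [Load r_tmp r_zero, Output r_tmp])
      output_mean_code ;;
    finish_task_code"

definition push_halves_code :: com where
  "push_halves_code =
    Block
      [Sub r_tmp r_sp r_one, Sub r_tmp' r_clusters r_half, Store r_tmp r_tmp', Store r_sp r_half,
       Add r_tmp r_sp r_width, Add r_tmp' r_start r_cut, Store r_tmp r_tmp', Add r_sp r_sp r_one]"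

definition bisect_code :: com where
  "bisect_code =
    split_code ;;
    push_halves_code"

definition task_code :: com where
  "task_code =
    Block [Sub r_tmp r_sp r_one, Load r_clusters r_tmp, Add r_tmp r_tmp r_width, Load r_end r_tmp] ;;
    Cond r_clusters r_one emit_code bisect_code"

context sorted_points begin

fun stack_stored :: "(nat \<Rightarrow> real) \<Rightarrow> task list \<Rightarrow> bool" where
  "stack_stored M [] \<longleftrightarrow> True"
| "stack_stored M ((q, e) # st) \<longleftrightarrow> M (stack_base + length st) = real q \<and>
    M (stack_base + width + length st) = real e \<and> stack_stored M st"

lemma stack_stored_agree:
  assumes "stack_stored M st" "\<And>i. i < length st \<Longrightarrow> M' (stack_base + i) = M (stack_base + i)"
    "\<And>i. i < length st \<Longrightarrow> M' (stack_base + width + i) = M (stack_base + width + i)"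
  shows "stack_stored M' st"
  using assms by (induction M st rule: stack_stored.induct) auto

lemma stack_stored_split:
  assumes "stack_stored M ((q, e) # st)" "agree_on {stack_base..<columns_base} M M'" "Suc (length st) < width"
  defines "l \<equiv> length st"
  shows "stack_stored (M'(stack_base + l := real (q - h), stack_base + Suc l := real h,
    stack_base + Suc l + width := real d)) ((h, d) # (q - h, e) # st)" (is "stack_stored ?M _")
proof -
  have bounds: "stack_base + width + l < columns_base" "l < width"
    using assms(3) layout(7) by (simp_all add: l_def)
  have "stack_stored ?M st"
    by (rule stack_stored_agree[of M]) (use assms(1-3) bounds in \<open>auto simp: l_def\<close>)
  moreover have "?M (stack_base + width + l) = real e" using assms(1-3) bounds by (simp add: l_def)
  ultimately show ?thesis using assms(3) by (simp add: l_def add_ac)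
qed

text \<open>\<open>R0\<close> are the initial registers and \<open>F\<close> is the fuel reserved for the rest of the program.\<close>

definition task_inv :: "nat \<Rightarrow> (reg \<Rightarrow> real) \<Rightarrow> real \<Rightarrow> task list \<Rightarrow> nat \<Rightarrow> assertion" where
  "task_inv K R0 F st a R M Y f \<longleftrightarrow> globals R M \<and> stack_stored M st \<and> consecutive n a st \<and>
    length Y + sum_list (map fst st) = K \<and> (0 < a \<longrightarrow> Y \<noteq> []) \<and>
    (\<Sum>i=0..<a. sq_dist (set Y) (x i)) + pending_cost x a st \<le> opt x (K - 1) 0 n \<and>
    R r_sp = real (stack_base + length st) \<and> R r_start = real a \<and> agree_on ({..<15} - {r_sp}) R0 R \<and>
    F + 960 * potential a st \<le> f"

lemma wp_emitted:
  assumes inv: "task_inv K R0 F ((1, e) # st) a R M Y (f + 8)" and "R r_end = real e"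
    and R1: "agree_on {..<18} R R1" and \<mu>: "sq_dev x a e \<mu> = sse x a e" and f1: "f - 10 \<le> f1"
  shows "wp cells finish_task_code
    (\<lambda>R' M' Y' f'. \<exists>a'. task_inv K R0 F st a' R' M' Y' f') R1 M (Y @ [\<mu>]) f1"
proof -
  note inv_facts = inv[unfolded task_inv_def]
  have ae: "a \<le> e" "e \<le> n" "consecutive n e st" using inv_facts by auto
  define R2 where "R2 = R1(r_start := real e, r_sp := real (stack_base + length st))"
  have "globals R2 M" by (rule globals_agree[of R M]) (use inv_facts R1 in \<open>auto simp: R2_def\<close>)
  moreover have "F + 960 * potential e st \<le> f1 - 2" using inv_facts f1 ae by (simp add: field_simps)
  ultimately have "task_inv K R0 F st e R2 M (Y @ [\<mu>]) (f1 - 2)"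
    using inv_facts R1 ae sum_sq_dist_snoc[OF ae(1) _ \<mu>, of Y] by (auto simp: task_inv_def R2_def)
  moreover have "R1 r_end = real e" "R1 r_sp - 1 = real (stack_base + length st)" "R1 r_one = 1"
    using inv_facts R1 assms(2) by (auto simp: globals_def)
  ultimately show ?thesis unfolding finish_task_code_def by (intro wp_Block) (auto simp: R2_def)
qed

lemma wp_emit:
  assumes inv: "task_inv K R0 F ((1, e) # st) a R M Y (f + 8)" and "R r_end = real e" "1 \<le> n"
  shows "wp cells emit_code (\<lambda>R' M' Y' f'. \<exists>a'. task_inv K R0 F st a' R' M' Y' f') R M Y f"
    (is "wp _ _ ?Q _ _ _ _")
proof -
  have R: "R r_start = real a" "a \<le> e" "e \<le> n" "R r_zero = 0" "R r_width = real width" "M 0 = x 0"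
      "M (width + e) = prefix_sum x e" "M (width + a) = prefix_sum x a"
    using inv \<open>1 \<le> n\<close> by (auto simp: task_inv_def globals_def)
  have cells: "width + e < cells" "width + a < cells" "0 < cells" using R(2,3) layout by linarith+
  note emitted = wp_emitted[OF inv assms(2)]
  show ?thesis unfolding emit_code_def
  proof (rule wp_Seq_nested, rule wp_Cond)
    assume "R r_end \<le> R r_start"
    then have "e = a" using R(1,2) assms(2) by simp
    then show "wp cells (Block [Load r_tmp r_zero, Output r_tmp])
        (wp cells finish_task_code ?Q) R M Y (f - 2)"
      using R cells by (intro wp_Block) (auto intro!: emitted)
  next
    assume "R r_start < R r_end"
    then have "a < e" using R(1) assms(2) by simp
    then have "(prefix_sum x e - prefix_sum x a) / (real e - real a) = mean x a e"
      by (simp add: mean_def prefix_sum_diff)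
    then show "wp cells output_mean_code
        (wp cells finish_task_code ?Q) R M Y (f - 2)"
      using R cells assms(2) \<open>a < e\<close> unfolding output_mean_code_def
      by (intro wp_Block) (auto intro!: emitted simp: sse_def)
  qed
qed

lemma task_inv_length:
  assumes "task_inv K R0 F st a R M Y f" "K \<le> n"
  shows "length st < width"
  using assms consecutive_length[of n a st] layout(1) by (simp add: task_inv_def)

lemma task_inv_split:
  assumes inv: "task_inv K R0 F ((q, a + N) # st) a R M Y f" and "2 \<le> q" "K \<le> n"
    and c: "crossing x (q div 2) (q - 1) a N c"
    and M1: "agree_on persistent M M1"
    and R1: "agree_on ({..<16} - {r_sp}) R R1" "R1 r_sp = real (stack_base + Suc (Suc (length st)))"
    and f1: "f - 960 * (real q * real (N + 1)) \<le> f1"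
  defines "h \<equiv> q div 2" and "l \<equiv> length st"
  shows "task_inv K R0 F ((h, a + c) # (q - h, a + N) # st) a R1
    (M1(stack_base + l := real (q - h), stack_base + Suc l := real h,
      stack_base + Suc l + width := real (a + c))) Y f1"
    (is "task_inv K R0 F ?st a R1 ?M Y f1")
proof -
  note inv_facts = inv[unfolded task_inv_def]
  have h: "1 \<le> h" "h < q" using \<open>2 \<le> q\<close> by (auto simp: h_def)
  have split: "opt x (q - 1) a (a + N) = opt x (h - 1) a (a + c) + opt x (q - h - 1) (a + c) (a + N)" "c \<le> N"
    using c h by (auto simp: crossing_def h_def)
  have "potential a ?st + real q * real (N + 1) \<le> potential a ((q, a + N) # st)"
    unfolding h_def by (rule potential_split[OF \<open>2 \<le> q\<close> refl split(2)])
  then have "F + 960 * potential a ?st \<le> f1" using inv_facts f1 by (auto simp: algebra_simps)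
  moreover have "stack_stored M ((q, a + N) # st)" using inv_facts by blast
  then have "stack_stored ?M ?st"
    unfolding l_def using M1 task_inv_length[OF inv \<open>K \<le> n\<close>] by (intro stack_stored_split) auto
  moreover have "globals R1 ?M" by (rule globals_agree[of R M]) (use inv_facts M1 R1(1) layout in auto)
  ultimately show ?thesis
    using inv_facts split h R1 by (auto simp: task_inv_def)
qed

lemma wp_bisect:
  assumes inv: "task_inv K R0 F ((q, e) # st) a R M Y (f + 8)"
    and R: "R r_clusters = real q" "R r_end = real e" and "2 \<le> q" "K \<le> n"
  shows "wp cells bisect_code (\<lambda>R' M' Y' f'. \<exists>st' a'. task_inv K R0 F st' a' R' M' Y' f') R M Y f"
    (is "wp _ _ ?Q _ _ _ _")
proof -
  define N where "N = e - a"
  define l where "l = length st"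
  have N: "e = a + N" "a + N \<le> n" "globals R M" "R r_start = real a" "R r_sp = real stack_base + real l + 1"
      "R r_one = 1" "R r_width = real width"
    using inv by (auto simp: N_def task_inv_def l_def globals_def)
  from wp_split[OF N(3,2) \<open>2 \<le> q\<close> N(4) R(1) R(2)[unfolded N(1)]] show ?thesis
    unfolding bisect_code_def
  proof (rule wp_Seq, elim conjE exE, hypsubst)
    fix R1 M1 f1 c
    assume R1: "agree_on {..<18} R R1" "R1 r_half = real (q div 2)" "R1 r_cut = real c"
      and M1: "agree_on persistent M M1"
      and c: "crossing x (q div 2) (q - 1) a N c" and f1: "f - 950 * (real q * real (N + 1)) \<le> f1"
    define R2 where "R2 = R1(r_tmp := real stack_base + real l + 1 + real width, r_tmp' := real a + real c,
      r_sp := real stack_base + real l + 1 + 1)"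
    have "2 * 1 \<le> real q * real (N + 1)" using \<open>2 \<le> q\<close> by (intro mult_mono) auto
    then have "task_inv K R0 F ((q div 2, a + c) # (q - q div 2, e) # st) a R2
      (M1(stack_base + l := real (q - q div 2), stack_base + Suc l := real (q div 2),
        stack_base + Suc l + width := real (a + c))) Y (f1 - 8)"
      using inv M1 c R1(1) f1 \<open>2 \<le> q\<close> \<open>K \<le> n\<close> unfolding l_def N(1)
      by (intro task_inv_split[where f = "f + 8"]) (auto simp: R2_def l_def)
    moreover have "Suc (stack_base + l) < cells" "Suc (stack_base + l + width) < cells"
      using task_inv_length[OF inv \<open>K \<le> n\<close>] layout by (auto simp: l_def)
    ultimately show "wp cells push_halves_code ?Q R1 M1 Y f1"
      using R1 R N unfolding push_halves_code_def by (intro wp_Block) (auto simp: R2_def of_nat_diff)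
  qed
qed

end

definition tasks_code :: com where
  "tasks_code = Until r_sp r_stack task_code"

context sorted_points begin

lemma wp_task:
  assumes inv: "task_inv K R0 F st a R M Y f" and "st \<noteq> []" and K: "1 \<le> n" "K \<le> n"
  shows "wp cells task_code (\<lambda>R' M' Y' f'. \<exists>st' a'. task_inv K R0 F st' a' R' M' Y' f') R M Y (f - 2)"
    (is "wp _ _ ?Q _ _ _ _")
proof -
  obtain q e st1 where st: "st = (q, e) # st1" using \<open>st \<noteq> []\<close> by (cases st) auto
  define l where "l = length st1"
  note inv_facts = inv[unfolded task_inv_def st]
  define R1 where "R1 = R(r_clusters := real q, r_tmp := real stack_base + real l + real width,
    r_end := real e)"
  have inv1: "task_inv K R0 F ((q, e) # st1) a R1 M Y (f - 8 + 8)"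
    using inv_facts globals_agree[of R M R1 M] by (auto simp: task_inv_def R1_def)
  have "wp cells (Cond r_clusters r_one emit_code bisect_code) ?Q R1 M Y (f - 6)"
  proof (rule wp_Cond)
    assume "R1 r_clusters \<le> R1 r_one"
    then have "q = 1" using inv_facts by (auto simp: R1_def globals_def)
    with inv1 have "wp cells emit_code (\<lambda>R' M' Y' f'. \<exists>a'. task_inv K R0 F st1 a' R' M' Y' f') R1 M Y (f - 8)"
      using K(1) by (intro wp_emit) (auto simp: R1_def)
    then have "wp cells emit_code ?Q R1 M Y (f - 8)" by (rule wp_mono) blast
    then show "wp cells emit_code ?Q R1 M Y (f - 6 - 2)" by simp
  next
    assume "R1 r_one < R1 r_clusters"
    then have "2 \<le> q" using inv_facts by (auto simp: R1_def globals_def)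
    with inv1 show "wp cells bisect_code ?Q R1 M Y (f - 6 - 2)"
      using K(2) wp_bisect[OF inv1] by (simp add: R1_def)
  qed
  moreover have "stack_base + l < cells" "stack_base + l + width < cells"
    using task_inv_length[OF inv K(2)] layout by (auto simp: st l_def)
  moreover have "R r_sp - 1 = real stack_base + real l" "R r_one = 1" "R r_width = real width"
      "M (stack_base + l) = real q" "M (stack_base + l + width) = real e"
    using inv_facts by (auto simp: l_def globals_def add_ac)
  ultimately show ?thesis unfolding task_code_def by (intro wp_Block_Seq) (simp add: R1_def fun_upd_twist)
qed

lemma wp_tasks:
  assumes start: "task_inv K R F [(K, n)] 0 R M [] f" and "R r_stack = real stack_base" and K: "1 \<le> n" "K \<le> n"
  shows "wp cells tasks_code (\<lambda>R' M' Y' f'. globals R' M' \<and> agree_on ({..<15} - {r_sp}) R R' \<and> length Y' = K \<and>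
    (\<Sum>i=0..<n. sq_dist (set Y') (x i)) \<le> opt x (K - 1) 0 n \<and> F - 1 \<le> f') R M [] f"
    (is "wp _ _ ?Q _ _ _ _")
proof -
  define I where "I = (\<lambda>R' M' Y' f'. \<exists>st a. task_inv K R F st a R' M' Y' f')"
  have fuel: "F \<le> f'" if "task_inv K R F st a R' M' Y' f'" for st a R' M' Y' f'
    using that potential_nonneg[of n a st] by (simp add: task_inv_def)
  have sp: "R' r_sp = real (stack_base + length st)" "R' r_stack = real stack_base"
    if "task_inv K R F st a R' M' Y' f'" for st a R' M' Y' f'
    using that assms(2) by (auto simp: task_inv_def)
  show ?thesis unfolding tasks_code_def
  proof (rule wp_Until[where I = I and B = F])
    show "I R M [] f" unfolding I_def using start by blast
    show "F \<le> f'" if "I R' M' Y' f'" for R' M' Y' f' using that fuel unfolding I_def by blast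
  next
    fix R' M' Y' f' assume "I R' M' Y' f'" and exit: "R' r_sp \<le> R' r_stack"
    then obtain st a where inv: "task_inv K R F st a R' M' Y' f'" unfolding I_def by blast
    then have "st = []" using exit sp[OF inv] by simp
    then show "?Q R' M' Y' (f' - 1)" using inv fuel[OF inv] by (auto simp: task_inv_def)
  next
    fix R' M' Y' f' assume "I R' M' Y' f'" and continue: "R' r_stack < R' r_sp"
    then obtain st a where inv: "task_inv K R F st a R' M' Y' f'" unfolding I_def by blast
    moreover have "st \<noteq> []" using continue sp[OF inv] by auto
    ultimately show "wp cells task_code I R' M' Y' (f' - 2)"
      unfolding I_def using K by (rule wp_task)
  qed
qed

end

section \<open>The complete program\<close>

definition layout_code :: com where
  "layout_code = Block
    [Const r_one 1, Const r_zero 0, Add r_width r_n r_one, Add r_squares r_width r_width,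
     Add r_layer r_squares r_width, Add r_cross r_layer r_width, Add r_minima r_cross r_width,
     Add r_stack r_minima r_width, Add r_columns r_stack r_width, Add r_columns r_columns r_width]"

definition prefix_sums_step_code :: com where
  "prefix_sums_step_code =
    Block
      [Load r_eval3 r_ptr, Add r_eval1 r_eval1 r_eval3, Mul r_eval3 r_eval3 r_eval3,
       Add r_eval2 r_eval2 r_eval3, Add r_ptr r_ptr r_one, Add r_tmp r_width r_ptr, Store r_tmp r_eval1,
       Add r_tmp r_squares r_ptr, Store r_tmp r_eval2]"

definition prefix_sums_code :: com where
  "prefix_sums_code =
    Block [Const r_ptr 0, Const r_eval1 0, Const r_eval2 0] ;;
    Until r_n r_ptr
      prefix_sums_step_code"

definition first_task_code :: com where
  "first_task_code =
    Block
      [Store r_stack r_used, Add r_tmp r_stack r_width, Store r_tmp r_n, Add r_sp r_stack r_one,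
       Const r_start 0]"

definition start_code :: com where
  "start_code =
    Cond r_k r_n (Block [Move r_used r_k]) (Block [Move r_used r_n]) ;;
    first_task_code"

definition pad_step_code :: com where
  "pad_step_code = Block [Load r_tmp r_zero, Output r_tmp, Add r_used r_used r_one]"

definition pad_code :: com where
  "pad_code = Until r_k r_used pad_step_code"

definition kmeans_code :: com where
  "kmeans_code = layout_code ;; prefix_sums_code ;; start_code ;; tasks_code ;; pad_code"

context sorted_points begin

definition layout_regs :: "(reg \<Rightarrow> real) \<Rightarrow> bool" where
  "layout_regs R \<longleftrightarrow> R r_n = real n \<and> R r_one = 1 \<and> R r_zero = 0 \<and> R r_width = real width \<and>
    R r_squares = real squares_base \<and> R r_layer = real layer_base \<and> R r_cross = real cross_base \<and>
    R r_minima = real minima_base \<and> R r_columns = real columns_base \<and> R r_stack = real stack_base"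

lemma wp_layout:
  assumes "R r_n = real n"
  shows "wp cells layout_code (\<lambda>R' M' Y' f'. M' = M \<and> Y' = Y \<and> layout_regs R' \<and> R' r_k = R r_k \<and>
    f - 10 \<le> f') R M Y f"
  unfolding layout_code_def
  using assms by (intro wp_Block) (simp add: layout_regs_def layout_defs)

lemma wp_prefix_sums:
  assumes regs: "layout_regs R" and M: "\<And>i. M i = (if i < n then x i else 0)"
  shows "wp cells prefix_sums_code (\<lambda>R' M' Y' f'. Y' = Y \<and> globals R' M' \<and> R' r_k = R r_k \<and>
    R' r_stack = real stack_base \<and> f - 11 * real n - 4 \<le> f') R M Y f"
    (is "wp _ _ ?Q _ _ _ _")
proof -
  note reg_values = regs[unfolded layout_regs_def]
  define P where "P i R' M' Y' \<longleftrightarrow> Y' = Y \<and> agree_on {..<40} R R' \<and> R' r_ptr = real i \<and>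
    R' r_eval1 = prefix_sum x i \<and> R' r_eval2 = prefix_sum (\<lambda>i. (x i)\<^sup>2) i \<and> (\<forall>j<n. M' j = x j) \<and>
    (\<forall>j\<le>i. M' (width + j) = prefix_sum x j \<and> M' (squares_base + j) = prefix_sum (\<lambda>i. (x i)\<^sup>2) j)"
      for i R' M' Y'
  define R1 where "R1 = R(r_ptr := 0, r_eval1 := 0, r_eval2 := 0)"
  have "wp cells (Until r_n r_ptr prefix_sums_step_code)
      (\<lambda>R' M' Y' f'. P n R' M' Y' \<and> f - 3 - (9 + 2) * real n - 1 \<le> f') R1 M Y (f - 3)"
  proof (rule wp_Until_count)
    show "P 0 R1 M Y" using M by (simp add: P_def R1_def layout_defs)
    show "R' r_n \<le> R' r_ptr \<longleftrightarrow> i = n" if "i \<le> n" "P i R' M' Y'" for i R' M' Y'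
      using that reg_values by (auto simp: P_def)
    fix i R' M' Y' f' assume i: "i < n" and P: "P i R' M' Y'"
    let ?M = "M'(Suc (width + i) := prefix_sum x (Suc i),
      Suc (squares_base + i) := prefix_sum (\<lambda>i. (x i)\<^sup>2) (Suc i))"
    have bounds: "i < cells" "Suc (width + i) < cells" "Suc (squares_base + i) < cells" "n < width"
      "width + n < squares_base"
      using i layout by auto
    have "?M (width + j) = prefix_sum x j \<and> ?M (squares_base + j) = prefix_sum (\<lambda>i. (x i)\<^sup>2) j"
      if "j \<le> Suc i" for j
      using P that i bounds by (auto simp: P_def le_Suc_eq)
    moreover have "?M j = x j" if "j < n" for j using P that bounds by (auto simp: P_def)
    moreover have "address cells (real width + (real i + 1)) = Some (Suc (width + i))"
        "address cells (real squares_base + (real i + 1)) = Some (Suc (squares_base + i))"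
      using address_of_nat[of cells "Suc (width + i)"] address_of_nat[of cells "Suc (squares_base + i)"] bounds
      by (simp_all add: add_ac)
    ultimately show "wp cells prefix_sums_step_code (\<lambda>R' M' Y' f''. P (Suc i) R' M' Y' \<and>
      f' - 9 \<le> f'') R' M' Y' f'"
      unfolding prefix_sums_step_code_def using P reg_values i bounds
      by (intro wp_Block) (simp add: P_def prefix_sum_Suc power2_eq_square add_ac)
  qed simp
  then have "wp cells (Until r_n r_ptr prefix_sums_step_code) ?Q R1 M Y (f - 3)"
    by (rule wp_mono) (use reg_values in \<open>auto simp: P_def globals_def\<close>)
  then show ?thesis unfolding prefix_sums_code_def by (intro wp_Block_Seq) (simp add: R1_def)
qed

lemma wp_start:
  assumes "globals R M" "R r_k = real k" "R r_stack = real stack_base" "1 \<le> k" "1 \<le> n"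
  defines "K \<equiv> min k n"
  shows "wp cells start_code (\<lambda>R' M' Y' f'. Y' = [] \<and>
    task_inv K R' (f - 8 - 4800 * (real K * real n)) [(K, n)] 0 R' M' [] f' \<and>
    R' r_k = real k \<and> R' r_stack = real stack_base \<and> R' r_used = real K) R M [] f"
    (is "wp _ _ ?Q _ _ _ _")
  unfolding start_code_def
proof (rule wp_Seq)
  note globals_R = assms(1)[unfolded globals_def]
  show "wp cells (Cond r_k r_n (Block [Move r_used r_k]) (Block [Move r_used r_n]))
      (\<lambda>R' M' Y' f'. M' = M \<and> Y' = [] \<and> agree_on {..<12} R R' \<and> R' r_used = real K \<and> f - 3 \<le> f') R M [] f"
    using assms(2) globals_R by (intro wp_Cond wp_Block) (auto simp: K_def)
  fix R1 M1 f1 and Y1 :: "real list"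
  assume R1: "M1 = M \<and> Y1 = [] \<and> agree_on {..<12} R R1 \<and> R1 r_used = real K \<and> f - 3 \<le> f1"
  define R2 where "R2 = R1(r_tmp := real stack_base + real width, r_sp := real stack_base + 1, r_start := 0)"
  define M2 where "M2 = M(stack_base := real K, stack_base + width := real n)"
  have "globals R2 M2"
    by (rule globals_agree[OF assms(1)]) (use R1 layout in \<open>auto simp: R2_def M2_def\<close>)
  moreover have "f - 8 - 4800 * (real K * real n) + 960 * potential 0 [(K, n)] \<le> f1 - 5"
  proof -
    have "real K * real K \<le> real K * real n" by (intro mult_left_mono) (auto simp: K_def)
    then show ?thesis using R1 by (simp add: power2_eq_square)
  qed
  moreover have "0 < width" using layout(1) by simp
  ultimately have "task_inv K R2 (f - 8 - 4800 * (real K * real n)) [(K, n)] 0 R2 M2 [] (f1 - 5)"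
    using R1 assms(4,5) by (auto simp: task_inv_def R2_def M2_def K_def)
  moreover have "stack_base < cells" "stack_base + width < cells" using layout by auto
  ultimately show "wp cells first_task_code ?Q R1 M1 Y1 f1"
    using R1 assms(2,3) globals_R unfolding first_task_code_def by (intro wp_Block) (simp add: R2_def M2_def)
qed

lemma wp_pad:
  assumes "globals R M" "1 \<le> n" "R r_k = real k" "R r_used = real K" "K \<le> k"
  shows "wp cells pad_code (\<lambda>R' M' Y' f'. Y' = Y @ replicate (k - K) (x 0) \<and> f - 5 * real k - 1 \<le> f') R M Y f"
proof -
  have M0: "M 0 = x 0" "0 < cells" "R r_one = 1" "R r_zero = 0"
    using assms(1,2) layout by (auto simp: globals_def)
  define P where "P i R' M' Y' \<longleftrightarrow> M' = M \<and> Y' = Y @ replicate i (x 0) \<and> agree_on {..<12} R R' \<and>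
    R' r_used = real (K + i)" for i and R' :: "reg \<Rightarrow> real" and M' Y'
  have "wp cells pad_code (\<lambda>R' M' Y' f'. P (k - K) R' M' Y' \<and> f - (3 + 2) * real (k - K) - 1 \<le> f') R M Y f"
    unfolding pad_code_def
  proof (rule wp_Until_count)
    show "P 0 R M Y" using assms(4) by (simp add: P_def)
    show "R' r_k \<le> R' r_used \<longleftrightarrow> i = k - K" if "i \<le> k - K" "P i R' M' Y'" for i R' M' Y'
      using that assms(3,5) by (auto simp: P_def)
    fix i R' M' Y' f' assume "P i R' M' Y'"
    then show "wp cells pad_step_code
        (\<lambda>R' M' Y' f''. P (Suc i) R' M' Y' \<and> f' - 3 \<le> f'') R' M' Y' f'"
      using M0 unfolding pad_step_code_def by (intro wp_Block) (auto simp: P_def replicate_append_same)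
  qed simp
  then show ?thesis by (rule wp_mono) (auto simp: P_def of_nat_diff assms(5))
qed

definition padded_clustering :: "nat \<Rightarrow> real list \<Rightarrow> bool" where
  "padded_clustering k ys \<longleftrightarrow> (\<exists>ms. ys = ms @ replicate (k - min k n) (x 0) \<and> length ms = min k n \<and>
    (\<Sum>i=0..<n. sq_dist (set ms) (x i)) \<le> opt x (min k n - 1) 0 n)"

lemma wp_cluster:
  assumes "globals R M" "R r_k = real k" "R r_stack = real stack_base" "1 \<le> k" "1 \<le> n"
  shows "wp cells (start_code ;; tasks_code ;; pad_code) (\<lambda>R' M' Y' f'. padded_clustering k Y' \<and>
    f - 4800 * (real (min k n) * real n) - 5 * real k - 10 \<le> f') R M [] f"
    (is "wp _ _ ?Q _ _ _ _")
proof -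
  define K where "K = min k n"
  have K: "K \<le> n" "K \<le> k" by (simp_all add: K_def)
  let ?F = "f - 8 - 4800 * (real K * real n)"
  from wp_start[OF assms, folded K_def] show ?thesis
  proof (rule wp_Seq, elim conjE, hypsubst)
    fix R1 M1 f1
    assume start: "task_inv K R1 ?F [(K, n)] 0 R1 M1 [] f1"
      and R1: "R1 r_k = real k" "R1 r_stack = real stack_base" "R1 r_used = real K"
    show "wp cells (tasks_code ;; pad_code) ?Q R1 M1 [] f1"
    proof (rule wp_Seq[OF wp_tasks[OF start R1(2) \<open>1 \<le> n\<close> K(1)]], elim conjE)
      fix R2 M2 Y f2
      assume R2: "globals R2 M2" "agree_on ({..<15} - {r_sp}) R1 R2" "?F - 1 \<le> f2"
        and Y: "length Y = K" "(\<Sum>i=0..<n. sq_dist (set Y) (x i)) \<le> opt x (K - 1) 0 n"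
      have "R2 r_k = real k" "R2 r_used = real K" using R1 R2(2) by auto
      from wp_pad[OF R2(1) \<open>1 \<le> n\<close> this K(2)] show "wp cells pad_code ?Q R2 M2 Y f2"
        by (rule wp_mono) (use Y R2(3) in \<open>auto simp: padded_clustering_def K_def\<close>)
    qed
  qed
qed

lemma wp_kmeans:
  assumes R: "R r_n = real n" "R r_k = real k" and M: "\<And>i. M i = (if i < n then x i else 0)"
    and "1 \<le> n" "1 \<le> k"
  shows "wp cells kmeans_code (\<lambda>R' M' Y' f'. 0 \<le> f' \<and> padded_clustering k Y') R M [] (real (4850 * (k * n)))"
    (is "wp _ _ ?Q _ _ _ ?f")
  unfolding kmeans_code_def
proof (rule wp_Seq[OF wp_layout[of R, OF R(1)]], elim conjE, hypsubst)
  fix R1 f1 assume R1: "layout_regs R1" "R1 r_k = R r_k" "?f - 10 \<le> f1"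
  show "wp cells (prefix_sums_code ;; start_code ;; tasks_code ;; pad_code) ?Q R1 M [] f1"
  proof (rule wp_Seq[OF wp_prefix_sums[OF R1(1) M]], elim conjE, hypsubst)
    fix R2 M2 f2
    assume R2: "globals R2 M2" "R2 r_k = R1 r_k" "R2 r_stack = real stack_base" "f1 - 11 * real n - 4 \<le> f2"
    have "R2 r_k = real k" using R(2) R1(2) R2(2) by simp
    from wp_cluster[OF R2(1) this R2(3) \<open>1 \<le> k\<close> \<open>1 \<le> n\<close>]
    show "wp cells (start_code ;; tasks_code ;; pad_code) ?Q R2 M2 [] f2"
    proof (rule wp_mono, elim conjE, intro conjI)
      fix f' assume "f2 - 4800 * (real (min k n) * real n) - 5 * real k - 10 \<le> f'"
      moreover have "4800 * (min k n * n) + 11 * n + 5 * k + 24 \<le> 4850 * (k * n)"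
        using \<open>1 \<le> n\<close> \<open>1 \<le> k\<close> mult_le_mono[of 1 k n n] mult_le_mono[of k k 1 n]
          mult_le_mono[of "min k n" k n n] by linarith
      then have "4800 * (real (min k n) * real n) + 11 * real n + 5 * real k + 24 \<le> ?f"
        by (simp only: flip: of_nat_mult)
      ultimately show "0 \<le> f'" using R1(3) R2(4) by linarith
    qed
  qed
qed

end

definition kmeans_program :: program where
  "kmeans_program = compile 0 kmeans_code @ [Halt]"

lemma kmeans_program_computes:
  assumes "sorted xs" "1 \<le> length xs" "1 \<le> k"
  obtains ms t where "optimal_kmeans xs k ms" "t \<le> Suc (4850 * (k * length xs))"
    "computes_in kmeans_program xs k ms t (num_regs kmeans_program + 13 * (length xs + 1))"
proof -
  interpret sorted_points "(!) xs" "length xs"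
    by unfold_locales (use assms(1) in \<open>auto simp: mono_on_def sorted_nth_mono\<close>)
  have cells: "cells = 13 * (length xs + 1)" by (simp add: layout_defs)
  have "wp cells kmeans_code (\<lambda>R' M' Y' f'. 0 \<le> f' \<and> padded_clustering k Y')
      (regs (init_config xs k)) (mem (init_config xs k)) [] (real (4850 * (k * length xs)))"
    by (rule wp_kmeans) (use assms(2,3) in \<open>auto simp: init_config_def\<close>)
  moreover have "length xs \<le> cells" by (simp add: cells)
  ultimately obtain t ys where run: "computes_in kmeans_program xs k ys t (num_regs kmeans_program + cells)"
      "t \<le> Suc (4850 * (k * length xs))" and "padded_clustering k ys"
    unfolding kmeans_program_def by (rule computes_in_compile)
  then have "optimal_kmeans xs k ys"
    using optimal_kmeans_padded[OF assms] by (auto simp: padded_clustering_def kmeans_cost_eq)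
  with run show thesis by (intro that) (simp_all add: cells)
qed

theorem mainTheorem4:
  "\<exists>(p :: program) (C :: nat).
     \<forall>(xs :: real list) (k :: nat). sorted xs \<and> length xs \<ge> 1 \<and> k \<ge> 1 \<longrightarrow>
       (\<exists>ms t s. computes_in p xs k ms t s \<and> optimal_kmeans xs k ms \<and>
          t \<le> C * (k * length xs) \<and> s \<le> C * length xs)"
proof -
  define C where "C = num_regs kmeans_program + 4851"
  have "\<exists>ms t s. computes_in kmeans_program xs k ms t s \<and> optimal_kmeans xs k ms \<and>
      t \<le> C * (k * length xs) \<and> s \<le> C * length xs"
    if xs: "sorted xs" "1 \<le> length xs" "1 \<le> k" for xs k
  proof -
    obtain ms t where optimal: "optimal_kmeans xs k ms" and time: "t \<le> Suc (4850 * (k * length xs))"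
      and run: "computes_in kmeans_program xs k ms t (num_regs kmeans_program + 13 * (length xs + 1))"
      by (rule kmeans_program_computes[OF xs])
    have "1 * 1 \<le> k * length xs" using xs(2,3) by (rule mult_le_mono[rotated])
    then have "t \<le> 4851 * (k * length xs)" using time by linarith
    also have "\<dots> \<le> C * (k * length xs)" unfolding C_def by (rule mult_le_mono1) simp
    finally have "t \<le> C * (k * length xs)" .
    moreover obtain d where "length xs = Suc d" using xs(2) by (cases xs) auto
    then have "num_regs kmeans_program + 13 * (length xs + 1) \<le> C * length xs"
      by (simp add: C_def algebra_simps)
    ultimately show ?thesis using run optimal by blast
  qed
  then show ?thesis by blast
qed

end
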